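(* Let $d\in\{1,2,3\}$, $0<\alpha<1$, $\lambda\ge 0$, and let $\Omega=(a_1,b_1)\times\cdots\times(a_d,b_d)\subset\mathbb{R}^d$ be a bounded box. Let $(-\Delta+\lambda)^{\alpha/2}$ be the tempered integral fractional Laplacian, and let $(-\Delta+\lambda)^{\alpha/2}_{h,\gamma}$ be its finite difference approximation with splitting parameter $\gamma$ and small mesh size $h=L/N$, where $L=\max_i(b_i-a_i)$ and $N\ge 1$ is an integer (both operators are defined in the context). Suppose that $u$ has finite support on $\Omega$, in the sense that $u:\mathbb{R}^d\to\mathbb{R}$ with $u=0$ on $\mathbb{R}^d\setminus\Omega$, and put $$e^h_{\alpha,\gamma}(\mathbf{x})=(-\Delta+\lambda)^{\alpha/2}u(\mathbf{x})-(-\Delta+\lambda)^{\alpha/2}_{h,\gamma}u(\mathbf{x}),\qquad \mathbf{x}\in\Omega,\qquad \|e^h_{\alpha,\gamma}\|_\infty=\sup_{\mathbf{x}\in\Omega}|e^h_{\alpha,\gamma}(\mathbf{x})|.$$ For $0<\varepsilon\le 1-\alpha$, there exists a constant $C>0$ independent of $h$ such that: (i) if $u\in C^{0,\alpha+\varepsilon}(\bar\Omega)$ and $\gamma\in(\alpha,2]$, then $\|e^h_{\alpha,\gamma}\|_\infty\le C h^{\varepsilon}$; (ii) if $u\in C^{2,\alpha+\varepsilon}(\bar\Omega)$ and $\gamma=2$, then $\|e^h_{\alpha,2}\|_\infty\le C h^{2}$.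
   Context: Function spaces. For an integer $k\ge 0$ and $0\le s\le 1$, $C^{k,s}(\bar\Omega)$ is the space of functions on $\bar\Omega$ with continuous (partial) derivatives of order $\le k$ whose $k$-th order (partial) derivatives are uniformly Hölder continuous with exponent $s$. Tempered fractional Laplacian. For $\alpha\in(0,2)$, $\lambda\ge0$, $$(-\Delta+\lambda)^{\alpha/2}u(\mathbf{x})=c_d^{\alpha,\lambda}\,\mathrm{P.V.}\int_{\mathbb{R}^d}\frac{u(\mathbf{x})-u(\mathbf{y})}{e^{\lambda|\mathbf{x}-\mathbf{y}|}|\mathbf{x}-\mathbf{y}|^{d+\alpha}}\,d\mathbf{y},$$ where $|\cdot|$ is the Euclidean norm, P.V. denotes the principal value, and $$c_d^{\alpha,\lambda}=\frac{1}{2\sqrt{\pi^d}}\begin{cases}2^\alpha\alpha\,\Gamma\big(\tfrac{d+\alpha}{2}\big)/\Gamma\big(1-\tfrac{\alpha}{2}\big),&\lambda=0\text{ or }\alpha=1,\\[2pt] \Gamma\big(\tfrac d2\big)/|\Gamma(-\alpha)|,&\text{otherwise.}\end{cases}$$ Finite difference approximation. Let $\gamma\in(\alpha,2]$. For $\boldsymbol{\xi}\in[0,\infty)^d\setminus\{\mathbf{0}\}$ put $$\varphi_{d,\gamma}(\mathbf{x},\boldsymbol{\xi})=\frac{1}{|\boldsymbol{\xi}|^\gamma}\Big(\sum_{\mathbf{m}\in\{0,1\}^d}u\big(\mathbf{x}+((-1)^{m_1}\xi^{(1)},\dots,(-1)^{m_d}\xi^{(d)})\big)-2^d u(\mathbf{x})\Big),\qquad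 w_{\lambda,\gamma}(\boldsymbol{\xi})=e^{-\lambda|\boldsymbol{\xi}|}|\boldsymbol{\xi}|^{\gamma-(d+\alpha)}.$$ With $L=\max_{1\le i\le d}(b_i-a_i)$, $h=L/N$, for $\mathbf{k}\in\{0,\dots,N-1\}^d$ let $I_{\mathbf{k}}=\prod_{i=1}^d[k_ih,(k_i+1)h]$, and let $\boldsymbol{\xi}_{\mathbf{k}}=h\mathbf{k}$ for $\mathbf{k}\in\{0,\dots,N\}^d$. Let $D_d=[0,\infty)^d\setminus[0,L]^d$. For $\mathbf{n}\in\{0,1\}^d\setminus\{\mathbf{0}\}$ define $c^\gamma_{\mathbf{n}}=1$ if $\gamma\in(\alpha,2)$, and for $\gamma=2$: $c^{2}_{\mathbf{n}}=2^d/d$ if $|\mathbf{n}|=1$, $c^{2}_{\mathbf{n}}=0$ if $|\mathbf{n}|\ne1$. Then for $\mathbf{x}\in\Omega$ the approximation (weighted trapezoidal rule on each element) is $$(-\Delta+\lambda)^{\alpha/2}_{h,\gamma}u(\mathbf{x})=-c_d^{\alpha,\lambda}\bigg[\frac{1}{2^d}\sum_{\mathbf{n}\in\{0,1\}^d\setminus\{\mathbf{0}\}}c^\gamma_{\mathbf{n}}\varphi_{d,\gamma}(\mathbf{x},\boldsymbol{\xi}_{\mathbf{n}})\int_{I_{\mathbf{0}}}w_{\lambda,\gamma}\,d\boldsymbol{\xi}+\sum_{\mathbf{k}\in\{0,\dots,N-1\}^d\setminus\{\mathbf{0}\}}\frac{1}{2^d}\Big(\sum_{\mathbf{n}\in\{0,1\}^d}\varphi_{d,\gamma}(\mathbf{x},\boldsymbol{\xi}_{\mathbf{k}+\mathbf{n}})\Big)\int_{I_{\mathbf{k}}}w_{\lambda,\gamma}\,d\boldsymbol{\xi}-2^d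 u(\mathbf{x})\int_{D_d}e^{-\lambda|\boldsymbol{\xi}|}|\boldsymbol{\xi}|^{-(d+\alpha)}d\boldsymbol{\xi}\bigg].$$
   Formalization: In (ii), u∈C^{2,α+ε}(Ω̄) is taken to mean that u, extended by zero to R^d, has two-sided derivatives up to order 2 at all points of Ω̄ with the stated continuity; with one-sided derivatives at the boundary (ii) fails, e.g. d=1, λ=0, α=1/2, u=max(0,1-x²). *)

theory Defs
  imports "HOL-Analysis.Analysis"
begin

text \<open>
  The dimension is \<open>d = CARD('n)\<close>; points of \<open>\<real>\<^sup>d\<close> have type \<open>real ^ 'n\<close> and multi-indices
  have type \<open>nat ^ 'n\<close>.
\<close>

section \<open>Hoelder spaces\<close>

definition partial :: "'n::finite \<Rightarrow> (real ^ 'n \<Rightarrow> real) \<Rightarrow> real ^ 'n \<Rightarrow> real" where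
  "partial i u x = deriv (\<lambda>t. u (x + t *\<^sub>R axis i 1)) 0"

primrec iter_partial :: "'n::finite list \<Rightarrow> (real ^ 'n \<Rightarrow> real) \<Rightarrow> real ^ 'n \<Rightarrow> real" where
  "iter_partial [] u = u"
| "iter_partial (i # is) u = partial i (iter_partial is u)"

text \<open>
  \<open>holder_space k s S\<close> is $C^{k,s}(S)$, for functions \<open>u\<close> that are defined on all of \<open>\<real>\<^sup>d\<close>. The
  partial derivatives are those of \<open>u\<close> as a function on \<open>\<real>\<^sup>d\<close>, taken at the points of \<open>S\<close>. In
  particular, at a boundary point of a closed set \<open>S\<close> they are genuine two-sided derivatives,
  which also see the values of \<open>u\<close> outside \<open>S\<close>. For \<open>S\<close> the closure of a box and \<open>u\<close> vanishing
  off the open box, membership therefore says that the extension by zero is of class $C^{k,s}$;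
  functions such as $\max(0, 1 - x^2)$ on \<open>[-1, 1]\<close> are excluded for \<open>k > 0\<close>.
\<close>

definition holder_space :: "nat \<Rightarrow> real \<Rightarrow> (real ^ 'n::finite) set \<Rightarrow> (real ^ 'n \<Rightarrow> real) set" where
  "holder_space k s S = {u.
     (\<forall>is i. length is < k \<longrightarrow>
        (\<forall>x\<in>S. (\<lambda>t. iter_partial is u (x + t *\<^sub>R axis i 1)) field_differentiable (at 0))) \<and>
     (\<forall>is. length is \<le> k \<longrightarrow> continuous_on S (iter_partial is u)) \<and>
     (\<forall>is. length is = k \<longrightarrow>
        (\<exists>H. \<forall>x\<in>S. \<forall>y\<in>S. \<bar>iter_partial is u x - iter_partial is u y\<bar> \<le> H * norm (x - y) powr s))}"

section \<open>The tempered fractional Laplacian\<close>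

definition frac_const :: "nat \<Rightarrow> real \<Rightarrow> real \<Rightarrow> real" where
  "frac_const d \<alpha> lam = 1 / (2 * sqrt (pi ^ d)) *
     (if lam = 0 \<or> \<alpha> = 1
      then 2 powr \<alpha> * \<alpha> * Gamma ((real d + \<alpha>) / 2) / Gamma (1 - \<alpha> / 2)
      else Gamma (real d / 2) / \<bar>Gamma (- \<alpha>)\<bar>)"

definition tempered_frac_laplacian ::
    "real \<Rightarrow> real \<Rightarrow> (real ^ 'n::finite \<Rightarrow> real) \<Rightarrow> real ^ 'n \<Rightarrow> real" where
  "tempered_frac_laplacian \<alpha> lam u x = frac_const CARD('n) \<alpha> lam *
     Lim (at_right 0) (\<lambda>\<delta>.
       LINT y:{y. norm (x - y) > \<delta>}|lborel.
         (u x - u y) / (exp (lam * norm (x - y)) * norm (x - y) powr (real CARD('n) + \<alpha>)))"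

section \<open>The finite difference approximation\<close>

definition index_cube :: "nat \<Rightarrow> (nat ^ 'n::finite) set" where
  "index_cube M = {k. \<forall>i. k $ i < M}"

lemma finite_index_cube: "finite (index_cube M :: (nat ^ 'n::finite) set)"
proof (rule finite_subset)
  show "index_cube M \<subseteq> vec_lambda ` (UNIV \<rightarrow>\<^sub>E {..<M} :: ('n \<Rightarrow> nat) set)"
  proof
    fix k :: "nat ^ 'n" assume "k \<in> index_cube M"
    hence "vec_nth k \<in> (UNIV \<rightarrow>\<^sub>E {..<M})" by (auto simp: index_cube_def)
    moreover have "k = vec_lambda (vec_nth k)" by simp
    ultimately show "k \<in> vec_lambda ` (UNIV \<rightarrow>\<^sub>E {..<M} :: ('n \<Rightarrow> nat) set)" by blast
  qed
  show "finite (vec_lambda ` (UNIV \<rightarrow>\<^sub>E {..<M} :: ('n \<Rightarrow> nat) set))"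
    by (intro finite_imageI finite_PiE) auto
qed

definition phi :: "real \<Rightarrow> (real ^ 'n::finite \<Rightarrow> real) \<Rightarrow> real ^ 'n \<Rightarrow> real ^ 'n \<Rightarrow> real" where
  "phi \<gamma> u x \<xi> = 1 / norm \<xi> powr \<gamma> *
     ((\<Sum>m \<in> (index_cube 2 :: (nat ^ 'n) set). u (x + (\<chi> i. (-1) ^ (m $ i) * \<xi> $ i)))
      - 2 ^ CARD('n) * u x)"

definition weight :: "real \<Rightarrow> real \<Rightarrow> real \<Rightarrow> real ^ 'n::finite \<Rightarrow> real" where
  "weight \<alpha> lam \<gamma> \<xi> = exp (- lam * norm \<xi>) * norm \<xi> powr (\<gamma> - (real CARD('n) + \<alpha>))"

definition max_side :: "real ^ 'n::finite \<Rightarrow> real ^ 'n \<Rightarrow> real" where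
  "max_side a b = Max (range (\<lambda>i. b $ i - a $ i))"

definition mesh_size :: "real ^ 'n::finite \<Rightarrow> real ^ 'n \<Rightarrow> nat \<Rightarrow> real" where
  "mesh_size a b N = max_side a b / real N"

definition grid_point :: "real \<Rightarrow> nat ^ 'n::finite \<Rightarrow> real ^ 'n" where
  "grid_point h k = (\<chi> i. h * real (k $ i))"

definition element :: "real \<Rightarrow> nat ^ 'n::finite \<Rightarrow> (real ^ 'n) set" where
  "element h k = cbox (\<chi> i. real (k $ i) * h) (\<chi> i. (real (k $ i) + 1) * h)"

definition far_region :: "real \<Rightarrow> (real ^ 'n::finite) set" where
  "far_region L = {\<xi>. \<forall>i. 0 \<le> \<xi> $ i} - {\<xi>. \<forall>i. 0 \<le> \<xi> $ i \<and> \<xi> $ i \<le> L}"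

definition corner_coeff :: "real \<Rightarrow> nat ^ 'n::finite \<Rightarrow> real" where
  "corner_coeff \<gamma> n =
     (if \<gamma> = 2 then (if (\<Sum>i\<in>UNIV. n $ i) = 1 then 2 ^ CARD('n) / real CARD('n) else 0) else 1)"

definition fd_laplacian ::
    "real ^ 'n::finite \<Rightarrow> real ^ 'n \<Rightarrow> real \<Rightarrow> real \<Rightarrow> real \<Rightarrow> nat
      \<Rightarrow> (real ^ 'n \<Rightarrow> real) \<Rightarrow> real ^ 'n \<Rightarrow> real" where
  "fd_laplacian a b \<alpha> lam \<gamma> N u x = (let h = mesh_size a b N in
     - frac_const CARD('n) \<alpha> lam *
       (1 / 2 ^ CARD('n) *
          (\<Sum>n \<in> index_cube 2 - {0}. corner_coeff \<gamma> n * phi \<gamma> u x (grid_point h n)) *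
          (LINT \<xi>:element h (0 :: nat ^ 'n)|lborel. weight \<alpha> lam \<gamma> \<xi>)
        + (\<Sum>k \<in> index_cube N - {0}.
             1 / 2 ^ CARD('n) * (\<Sum>n \<in> index_cube 2. phi \<gamma> u x (grid_point h (k + n))) *
             (LINT \<xi>:element h k|lborel. weight \<alpha> lam \<gamma> \<xi>))
        - 2 ^ CARD('n) * u x *
          (LINT \<xi>:far_region (max_side a b)|lborel.
             exp (- lam * norm (\<xi> :: real ^ 'n)) * norm \<xi> powr (- (real CARD('n) + \<alpha>)))))"

definition fd_error ::
    "real ^ 'n::finite \<Rightarrow> real ^ 'n \<Rightarrow> real \<Rightarrow> real \<Rightarrow> real \<Rightarrow> nat
      \<Rightarrow> (real ^ 'n \<Rightarrow> real) \<Rightarrow> real ^ 'n \<Rightarrow> real" where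
  "fd_error a b \<alpha> lam \<gamma> N u x =
     tempered_frac_laplacian \<alpha> lam u x - fd_laplacian a b \<alpha> lam \<gamma> N u x"

text \<open>The supremum is taken in \<open>ereal\<close>, so that an unbounded function has norm \<open>\<infinity>\<close>.\<close>

definition sup_norm_on :: "'a set \<Rightarrow> ('a \<Rightarrow> real) \<Rightarrow> ereal" where
  "sup_norm_on S f = (SUP x\<in>S. ereal \<bar>f x\<bar>)"

end

theory Submission imports Defs begin

text \<open>
  Since \<open>\<alpha> < 1\<close> and \<open>u\<close> is better than \<open>\<alpha>\<close>-Hoelder, the singular integral converges absolutely.
  Folding it onto the positive orthant by the reflections \<open>\<xi> \<mapsto> s * \<xi>\<close>, \<open>s \<in> {-1, 1}\<^sup>d\<close>, turns it into
  the integral of \<open>- \<phi> w\<close>, and outside the cube \<open>[0, L]\<^sup>d\<close> only \<open>u x\<close> survives. So the error is a constant times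
  the sum over the mesh elements of the errors of the weighted trapezoidal rule applied to \<open>\<phi>\<close>.

  For Hoelder \<open>u\<close> these are at most \<open>C h\<^sup>s |\<xi>|\<^sup>-\<^sup>d\<^sup>-\<^sup>\<alpha> h\<^sup>d\<close> with \<open>s = \<alpha> + \<epsilon>\<close>, and the sum over
  \<open>|\<xi>| \<ge> h\<close> is \<open>O(h\<^sup>\<epsilon>)\<close>. For smooth \<open>u\<close> and \<open>\<gamma> = 2\<close>, \<open>\<phi>\<close> is a combination of the functions
  \<open>\<xi>\<^sub>i\<^sup>2 / |\<xi>|\<^sup>2\<close> plus a remainder \<open>R\<close>. The former contribute nothing in total, by symmetry
  in the coordinates. The latter satisfies \<open>D\<^sup>2 R = O(|\<xi>|\<^sup>s\<^sup>-\<^sup>2)\<close>; reflecting each element in its centre shows that the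
  rule is second order for \<open>R\<close>, and the resulting sum of \<open>h\<^sup>2 |\<xi>|\<^sup>\<epsilon>\<^sup>-\<^sup>d h\<^sup>d\<close> is \<open>O(h\<^sup>2)\<close>.
\<close>

section \<open>Lebesgue measure under signed permutations of the coordinates\<close>

text \<open>Polar coordinates are avoided throughout. For p \<le> 0 one has |\<xi>|^p \<le> prod_i
  |\<xi>_i|^(p/d) almost everywhere, and p compares with -d as p/d does with -1, so every radial
  integral and every lattice sum is bounded by the d-th power of a one-dimensional one. The obstacle
  in the smooth case is that \<xi>_i^2 / |\<xi>|^2 is homogeneous of degree 0. Its second
  derivatives are of order |\<xi>|^-2, so an estimate element by element gives only h^2 times the
  sum of |\<xi>|^(-d-\<alpha>) h^d, that is h^(2-\<alpha>). The missing power of h has to come from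
  cancellation over the whole mesh, and for this the rule must be exact on constants even on the
  first element, which is what the coefficients 2^d/d achieve. Reflected points leave the box, and
  the Taylor expansion runs along arbitrary lines. Regularity is therefore first carried from the
  closed box to the whole space, and from coordinate directions to all directions.\<close>

lemma Basis_vec_range: "(Basis :: (real ^ 'n::finite) set) = range (\<lambda>i. axis i 1)"
  by (auto simp: Basis_vec_def)

lemma prod_Basis_cart:
  "(\<Prod>b\<in>(Basis :: (real ^ 'n::finite) set). f b) = (\<Prod>i\<in>UNIV. f (axis i 1))"
  unfolding Basis_vec_range by (subst prod.reindex) (auto simp: inj_on_def axis_eq_axis)

lemma emeasure_lborel_box_cart:
  fixes l u :: "real ^ 'n::finite"
  assumes "\<And>i. l $ i \<le> u $ i"
  shows "emeasure lborel (box l u) = ennreal (\<Prod>i\<in>UNIV. u $ i - l $ i)"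
proof -
  have "\<And>b. b \<in> Basis \<Longrightarrow> l \<bullet> b \<le> u \<bullet> b"
    using assms by (auto simp: Basis_vec_range inner_axis)
  then show ?thesis
    by (subst emeasure_lborel_box) (auto simp: prod_Basis_cart inner_axis)
qed

text \<open>One family for all changes of variables used below: translations, reflections in
  coordinate hyperplanes and in the centre of an element, and permutations of the
  coordinates.\<close>

definition signed_permutation ::
    "real ^ 'n \<Rightarrow> real ^ 'n \<Rightarrow> ('n \<Rightarrow> 'n) \<Rightarrow> real ^ 'n::finite \<Rightarrow> real ^ 'n" where
  "signed_permutation t s \<tau> \<xi> = (\<chi> i. t $ i + s $ i * \<xi> $ \<tau> i)"

lemma measurable_signed_permutation [measurable]:
  "signed_permutation t s \<tau> \<in> borel_measurable borel"
  unfolding signed_permutation_def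
  by (intro borel_measurable_continuous_onI continuous_intros)

text \<open>Lebesgue measure is determined by its values on boxes, and the preimage of a box is a
  box with the same side lengths in permuted order.\<close>

lemma distr_signed_permutation:
  fixes t s :: "real ^ 'n::finite"
  assumes s: "\<And>i. \<bar>s $ i\<bar> = 1" and \<tau>: "bij \<tau>"
  shows "distr lborel borel (signed_permutation t s \<tau>) = lborel"
proof (rule lborel_eqI[symmetric])
  fix l u :: "real ^ 'n" assume le: "\<And>b. b \<in> Basis \<Longrightarrow> l \<bullet> b \<le> u \<bullet> b"
  have le': "l $ i \<le> u $ i" for i using le[of "axis i 1"] by (simp add: inner_axis Basis_vec_range)
  define \<sigma> where "\<sigma> = inv \<tau>"
  have \<sigma>: "\<tau> (\<sigma> j) = j" "\<sigma> (\<tau> j) = j" for j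
    using \<tau> by (auto simp: \<sigma>_def bij_def surj_f_inv_f)
  \<comment> \<open>A coordinate with sign -1 is reversed, so its two endpoints change
    roles.\<close>
  define l' u' where
    "l' = (\<chi> j. if s $ \<sigma> j = 1 then l $ \<sigma> j - t $ \<sigma> j else t $ \<sigma> j - u $ \<sigma> j)" and
    "u' = (\<chi> j. if s $ \<sigma> j = 1 then u $ \<sigma> j - t $ \<sigma> j else t $ \<sigma> j - l $ \<sigma> j)"
  have s': "s $ i = 1 \<or> s $ i = -1" for i using s[of i] by linarith
  have eq: "signed_permutation t s \<tau> -` box l u = box l' u'"
  proof (intro set_eqI)
    fix \<xi> :: "real ^ 'n"
    have "\<xi> \<in> box l' u' \<longleftrightarrow> (\<forall>j. l' $ j < \<xi> $ j \<and> \<xi> $ j < u' $ j)"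
      by (simp add: mem_box_cart)
    also have "\<dots> \<longleftrightarrow> (\<forall>i. l' $ \<tau> i < \<xi> $ \<tau> i \<and> \<xi> $ \<tau> i < u' $ \<tau> i)"
      using \<sigma> by metis
    also have "\<dots> \<longleftrightarrow> (\<forall>i. l $ i < t $ i + s $ i * \<xi> $ \<tau> i \<and> t $ i + s $ i * \<xi> $ \<tau> i < u $ i)"
    proof (intro all_cong1)
      fix i
      show "(l' $ \<tau> i < \<xi> $ \<tau> i \<and> \<xi> $ \<tau> i < u' $ \<tau> i) \<longleftrightarrow>
        (l $ i < t $ i + s $ i * \<xi> $ \<tau> i \<and> t $ i + s $ i * \<xi> $ \<tau> i < u $ i)"
        using s'[of i] by (auto simp: l'_def u'_def \<sigma>)
    qed
    finally show "\<xi> \<in> signed_permutation t s \<tau> -` box l u \<longleftrightarrow> \<xi> \<in> box l' u'"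
      by (simp add: mem_box_cart signed_permutation_def)
  qed
  have "l' $ j \<le> u' $ j" for j using le' by (auto simp: l'_def u'_def)
  then have "emeasure lborel (box l' u') = ennreal (\<Prod>j\<in>UNIV. u' $ j - l' $ j)"
    by (rule emeasure_lborel_box_cart)
  also have "(\<Prod>j\<in>UNIV. u' $ j - l' $ j) = (\<Prod>j\<in>UNIV. u $ \<sigma> j - l $ \<sigma> j)"
    by (intro prod.cong) (auto simp: l'_def u'_def)
  also have "\<dots> = (\<Prod>i\<in>UNIV. u $ i - l $ i)"
    by (rule prod.reindex_bij_witness[of _ \<tau> \<sigma>]) (auto simp: \<sigma>)
  finally show "emeasure (distr lborel borel (signed_permutation t s \<tau>)) (box l u) = (\<Prod>b\<in>Basis. (u - l) \<bullet> b)"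
    by (simp add: emeasure_distr eq prod_Basis_cart inner_axis)
qed simp

lemma
  fixes f :: "real ^ 'n::finite \<Rightarrow> real"
  assumes s: "\<And>i. \<bar>s $ i\<bar> = 1" and \<tau>: "bij \<tau>" and f: "f \<in> borel_measurable borel"
  shows integral_signed_permutation:
      "(\<integral>\<xi>. f (signed_permutation t s \<tau> \<xi>) \<partial>lborel) = (\<integral>\<xi>. f \<xi> \<partial>lborel)"
    and integrable_signed_permutation:
      "integrable lborel (\<lambda>\<xi>. f (signed_permutation t s \<tau> \<xi>)) \<longleftrightarrow> integrable lborel f"
proof -
  note * = distr_signed_permutation[OF s \<tau>, of t]
  have f': "f \<in> borel_measurable lborel" using f by simp
  show "(\<integral>\<xi>. f (signed_permutation t s \<tau> \<xi>) \<partial>lborel) = (\<integral>\<xi>. f \<xi> \<partial>lborel)"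
    by (subst (2) *[symmetric]) (simp add: integral_distr f)
  show "integrable lborel (\<lambda>\<xi>. f (signed_permutation t s \<tau> \<xi>)) \<longleftrightarrow> integrable lborel f"
    by (subst (2) *[symmetric]) (simp add: integrable_distr_eq f)
qed

lemma set_integral_signed_permutation:
  fixes f :: "real ^ 'n::finite \<Rightarrow> real"
  assumes "\<And>i. \<bar>s $ i\<bar> = 1" "bij \<tau>" "f \<in> borel_measurable borel" "A \<in> sets borel"
    and A: "signed_permutation t s \<tau> -` A = B"
  shows "(LINT \<xi>:B|lborel. f (signed_permutation t s \<tau> \<xi>)) = (LINT \<xi>:A|lborel. f \<xi>)"
proof -
  have "(LINT \<xi>:B|lborel. f (signed_permutation t s \<tau> \<xi>)) =
    (\<integral>\<xi>. (\<lambda>\<eta>. indicator A \<eta> *\<^sub>R f \<eta>) (signed_permutation t s \<tau> \<xi>) \<partial>lborel)"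
    unfolding set_lebesgue_integral_def A[symmetric] by (intro Bochner_Integration.integral_cong) (auto simp: indicator_def)
  also have "\<dots> = (LINT \<xi>:A|lborel. f \<xi>)"
    unfolding set_lebesgue_integral_def using assms by (intro integral_signed_permutation) auto
  finally show ?thesis .
qed

section \<open>Integrals of products and of one-dimensional powers\<close>

lemma nn_integral_prod_cart:
  fixes g :: "real \<Rightarrow> ennreal"
  assumes "g \<in> borel_measurable borel"
  shows "(\<integral>\<^sup>+\<xi>. (\<Prod>i\<in>UNIV. g (\<xi> $ i)) \<partial>(lborel :: (real ^ 'n::finite) measure))
    = (\<integral>\<^sup>+t. g t \<partial>lborel) ^ CARD('n)"
  using nn_integral_lborel_prod[of "\<lambda>_::real^'n. g"] assms
  by (simp add: prod_Basis_cart inner_axis prod_constant)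

text \<open>Supplies the null sets to be discarded: the coordinate hyperplanes, where the sign
  vector of a point is ambiguous, and the faces shared by neighbouring elements.\<close>

lemma AE_component_neq:
  "AE \<xi> in (lborel :: (real ^ 'n::finite) measure). \<xi> $ i \<noteq> c"
proof -
  have "negligible {\<xi> :: real ^ 'n. \<xi> \<bullet> axis i 1 = c}"
    by (rule negligible_standard_hyperplane) (simp add: Basis_vec_range)
  then have "{\<xi> :: real ^ 'n. \<xi> $ i = c} \<in> null_sets lebesgue"
    by (simp add: negligible_iff_null_sets inner_axis)
  moreover have "{\<xi> :: real ^ 'n. \<xi> $ i = c} \<in> sets borel"
    by (intro borel_closed closed_Collect_eq continuous_intros)
  ultimately have "{\<xi> :: real ^ 'n. \<xi> $ i = c} \<in> null_sets lborel"
    by (simp add: null_sets_def)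
  from AE_not_in[OF this] show ?thesis by simp
qed

lemma nn_integral_even:
  fixes g :: "real \<Rightarrow> ennreal"
  assumes [measurable]: "g \<in> borel_measurable borel" and even: "\<And>t. g (- t) = g t"
  shows "(\<integral>\<^sup>+t. g t \<partial>lborel) = 2 * (\<integral>\<^sup>+t. g t * indicator {0..} t \<partial>lborel)"
proof -
  have "(\<integral>\<^sup>+t. g t \<partial>lborel) = (\<integral>\<^sup>+t. g t * indicator {0..} t + g t * indicator {..0} t \<partial>lborel)"
  proof (rule nn_integral_cong_AE)
    have "AE t in lborel. t \<noteq> (0::real)" by (rule AE_lborel_singleton)
    then show "AE t in lborel. g t = g t * indicator {0..} t + g t * indicator {..0} t"
      by eventually_elim (auto simp: indicator_def)
  qed
  also have "\<dots> = (\<integral>\<^sup>+t. g t * indicator {0..} t \<partial>lborel) + (\<integral>\<^sup>+t. g t * indicator {..0} t \<partial>lborel)"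
    by (rule nn_integral_add) auto
  also have "(\<integral>\<^sup>+t. g t * indicator {..0} t \<partial>lborel) = (\<integral>\<^sup>+t. g t * indicator {0..} t \<partial>lborel)"
    by (subst nn_integral_real_affine[where c = "-1" and t = 0])
      (auto simp: even indicator_def intro!: nn_integral_cong)
  finally show ?thesis by (simp add: mult_2)
qed

lemma nn_integral_powr_Icc:
  fixes p R :: real
  assumes "0 \<le> R" "- 1 < p"
  shows "(\<integral>\<^sup>+t. ennreal (t powr p) * indicator {0..R} t \<partial>lborel) = ennreal (R powr (p + 1) / (p + 1))"
  using nn_integral_has_integral_lebesgue[OF _ has_integral_powr_from_0[OF assms(2,1)]]
  by (simp add: nn_integral_set_ennreal mult.commute)

lemma nn_integral_powr_atLeast:
  fixes p R :: real
  assumes "0 < R" "p < - 1"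
  shows "(\<integral>\<^sup>+t. ennreal (t powr p) * indicator {R..} t \<partial>lborel) = ennreal (- (R powr (p + 1)) / (p + 1))"
  using nn_integral_has_integral_lebesgue[OF _ has_integral_powr_to_inf[OF assms(2,1)]]
  by (simp add: nn_integral_set_ennreal mult.commute)

section \<open>Power integrals and lattice sums\<close>

text \<open>Each of the d coordinates receives the share \<open>p / d\<close> of the exponent. In
  the applications p is nonpositive and \<open>r\<close> dominates the coordinate behind
  \<open>f i\<close>, which gives the bound on each factor.\<close>

lemma powr_le_prod:
  fixes f :: "'n::finite \<Rightarrow> real"
  assumes "0 < r" "\<And>i. r powr (p / real CARD('n)) \<le> f i"
  shows "r powr p \<le> (\<Prod>i\<in>UNIV. f i)"
proof -
  have "r powr p = (\<Prod>i\<in>(UNIV::'n set). r powr (p / real CARD('n)))"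
    using assms(1) by (simp add: prod_constant powr_realpow[symmetric] powr_powr)
  also have "\<dots> \<le> (\<Prod>i\<in>UNIV. f i)"
    by (intro prod_mono) (use assms in auto)
  finally show ?thesis .
qed

text \<open>The constant comes from the d-th power of the integral of |t|^(p/d) over [-R, R], which
  is finite because p > -d.\<close>

lemma nn_integral_norm_powr_cube:
  fixes p R :: real
  assumes "0 \<le> R" "- real CARD('n) < p" "p \<le> 0"
  shows "(\<integral>\<^sup>+\<xi>. ennreal (norm \<xi> powr p) * indicator {\<xi>. \<forall>i. \<bar>\<xi> $ i\<bar> \<le> R} \<xi>
      \<partial>(lborel :: (real ^ 'n::finite) measure))
    \<le> ennreal ((2 / (p / real CARD('n) + 1)) ^ CARD('n) * R powr (real CARD('n) + p))"
proof -
  let ?M = "lborel :: (real ^ 'n) measure" and ?S = "{\<xi> :: real ^ 'n. \<forall>i. \<bar>\<xi> $ i\<bar> \<le> R}"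
  let ?d = "real CARD('n)"
  define e where "e = p / ?d"
  have d: "?d > 0" by simp
  have e: "- 1 < e" "e \<le> 0" using assms d by (auto simp: e_def field_simps)
  let ?g = "\<lambda>t::real. ennreal (\<bar>t\<bar> powr e) * indicator {-R..R} t"
  have "(\<integral>\<^sup>+\<xi>. ennreal (norm \<xi> powr p) * indicator ?S \<xi> \<partial>?M)
     \<le> (\<integral>\<^sup>+\<xi>. (\<Prod>i\<in>UNIV. ?g (\<xi> $ i)) \<partial>?M)"
  proof (rule nn_integral_mono_AE)
    \<comment> \<open>Since \<open>0 powr e = 0\<close>, a vanishing coordinate would make the
      product on the right zero; such points form a null set.\<close>
    have "AE \<xi> in ?M. \<forall>i. \<xi> $ i \<noteq> 0"
      by (subst AE_all_countable) (simp add: AE_component_neq)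
    then show "AE \<xi> in ?M.
        ennreal (norm \<xi> powr p) * indicator ?S \<xi> \<le> (\<Prod>i\<in>UNIV. ?g (\<xi> $ i))"
    proof eventually_elim
      fix \<xi> :: "real ^ 'n" assume nz: "\<forall>i. \<xi> $ i \<noteq> 0"
      have pos: "norm \<xi> > 0" using nz by auto
      have "norm \<xi> powr p \<le> (\<Prod>i\<in>UNIV. \<bar>\<xi> $ i\<bar> powr e)"
      proof (rule powr_le_prod[OF pos])
        fix i show "norm \<xi> powr (p / ?d) \<le> \<bar>\<xi> $ i\<bar> powr e"
          unfolding e_def[symmetric] using nz component_le_norm_cart[of \<xi> i] e
          by (intro powr_mono2') auto
      qed
      then have "ennreal (norm \<xi> powr p) \<le> (\<Prod>i\<in>UNIV. ennreal (\<bar>\<xi> $ i\<bar> powr e))"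
        by (subst prod_ennreal) (auto intro!: ennreal_leI)
      then show "ennreal (norm \<xi> powr p) * indicator ?S \<xi> \<le> (\<Prod>i\<in>UNIV. ?g (\<xi> $ i))"
        by (cases "\<forall>i. \<bar>\<xi> $ i\<bar> \<le> R") (auto simp: indicator_def abs_le_iff minus_le_iff)
    qed
  qed
  also have "\<dots> = (\<integral>\<^sup>+t. ?g t \<partial>lborel) ^ CARD('n)"
    by (rule nn_integral_prod_cart) auto
  also have "(\<integral>\<^sup>+t. ?g t \<partial>lborel) = 2 * (\<integral>\<^sup>+t. ?g t * indicator {0..} t \<partial>lborel)"
    by (rule nn_integral_even) (auto simp: indicator_def)
  also have "(\<integral>\<^sup>+t. ?g t * indicator {0..} t \<partial>lborel) = (\<integral>\<^sup>+t. ennreal (t powr e) * indicator {0..R} t \<partial>lborel)"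
    by (intro nn_integral_cong) (auto simp: indicator_def)
  also have "\<dots> = ennreal (R powr (e + 1) / (e + 1))"
    by (rule nn_integral_powr_Icc) (use assms e in auto)
  also have "(2 * ennreal (R powr (e + 1) / (e + 1))) ^ CARD('n) = ennreal ((2 * (R powr (e + 1) / (e + 1))) ^ CARD('n))"
  proof -
    have "2 * ennreal y = ennreal (2 * y)" if "0 \<le> y" for y
      using that by (simp add: ennreal_mult)
    moreover have "0 \<le> R powr (e + 1) / (e + 1)" using e by simp
    ultimately show ?thesis by (simp only: ennreal_power mult_nonneg_nonneg zero_le_numeral)
  qed
  also have "(2 * (R powr (e + 1) / (e + 1))) ^ CARD('n) = (2 / (e + 1)) ^ CARD('n) * (R powr (e + 1)) ^ CARD('n)"
    by (simp add: power_mult_distrib power_divide)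
  also have "(R powr (e + 1)) ^ CARD('n) = R powr (?d + p)"
  proof (cases "R = 0")
    case False
    then show ?thesis using assms(1)
      by (simp add: powr_realpow[symmetric] powr_powr e_def algebra_simps)
  qed auto
  finally show ?thesis unfolding e_def by simp
qed

text \<open>The majorant for the singular integral: the first branch is what Hoelder continuity
  leaves of the kernel near 0, the second is the decay of the kernel. The one-dimensional factors
  have exponent \<epsilon>/d - 1 > -1 near 0 and -1 - \<alpha>/d < -1 at infinity.\<close>

lemma integrable_kernel:
  fixes \<alpha> \<epsilon> :: real
  assumes "0 < \<alpha>" "0 < \<epsilon>" "\<epsilon> \<le> real CARD('n)"
  shows "integrable lborel (\<lambda>z::real ^ 'n::finite.
    if norm z \<le> 1 then norm z powr (\<epsilon> - real CARD('n)) else norm z powr (- (real CARD('n) + \<alpha>)))"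
    (is "integrable _ ?K")
proof -
  let ?d = "real CARD('n)"
  define p q where "p = \<epsilon> / ?d - 1" and "q = - 1 - \<alpha> / ?d"
  have d: "?d > 0" by simp
  have p: "- 1 < p" "p \<le> 0" and q: "q < - 1" using assms d by (auto simp: p_def q_def field_simps)
  let ?M = "lborel :: (real ^ 'n) measure"
  let ?k = "\<lambda>t::real. if \<bar>t\<bar> \<le> 1 then \<bar>t\<bar> powr p else \<bar>t\<bar> powr q"
  let ?g = "\<lambda>t. ennreal (?k t)"
  have "(\<integral>\<^sup>+z. ennreal (norm (?K z)) \<partial>?M)
     \<le> (\<integral>\<^sup>+\<xi>. (\<Prod>i\<in>UNIV. ?g (\<xi> $ i)) \<partial>?M)"
  proof (rule nn_integral_mono_AE)
    have "AE \<xi> in ?M. \<forall>i. \<xi> $ i \<noteq> 0"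
      by (subst AE_all_countable) (simp add: AE_component_neq)
    then show "AE \<xi> in ?M. ennreal (norm (?K \<xi>)) \<le> (\<Prod>i\<in>UNIV. ?g (\<xi> $ i))"
    proof eventually_elim
      fix \<xi> :: "real ^ 'n" assume nz: "\<forall>i. \<xi> $ i \<noteq> 0"
      have pos: "norm \<xi> > 0" using nz by auto
      have "?K \<xi> \<le> (\<Prod>i\<in>UNIV. ?k (\<xi> $ i))"
      proof (cases "norm \<xi> \<le> 1")
        case True
        have "norm \<xi> powr (\<epsilon> - ?d) \<le> (\<Prod>i\<in>UNIV. ?k (\<xi> $ i))"
        proof (rule powr_le_prod[OF pos])
          fix i
          have "\<bar>\<xi> $ i\<bar> \<le> norm \<xi>" by (rule component_le_norm_cart)
          moreover have "(\<epsilon> - ?d) / ?d = p" by (simp add: p_def field_simps)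
          ultimately show "norm \<xi> powr ((\<epsilon> - ?d) / ?d) \<le> ?k (\<xi> $ i)"
            using True nz p by (auto intro!: powr_mono2')
        qed
        then show ?thesis using True by simp
      next
        case False
        have "norm \<xi> powr (- (?d + \<alpha>)) \<le> (\<Prod>i\<in>UNIV. ?k (\<xi> $ i))"
        proof (rule powr_le_prod[OF pos])
          fix i
          have le: "\<bar>\<xi> $ i\<bar> \<le> norm \<xi>" by (rule component_le_norm_cart)
          have e: "(- (?d + \<alpha>)) / ?d = q" by (simp add: q_def field_simps)
          have "norm \<xi> powr q \<le> 1" using False q
            powr_mono2'[of q 1 "norm \<xi>"] by simp
          \<comment> \<open>A long vector may still have short coordinates. For these the factor is
            at least 1, while the share of the norm is at most 1.\<close>
          moreover have "1 \<le> \<bar>\<xi> $ i\<bar> powr p" if "\<bar>\<xi> $ i\<bar> \<le> 1"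
            using that nz p powr_mono2'[of p "\<bar>\<xi> $ i\<bar>" 1] by simp
          moreover have "norm \<xi> powr q \<le> \<bar>\<xi> $ i\<bar> powr q"
            using le nz q by (intro powr_mono2') auto
          ultimately show "norm \<xi> powr (- (?d + \<alpha>) / ?d) \<le> ?k (\<xi> $ i)"
            unfolding e by (cases "\<bar>\<xi> $ i\<bar> \<le> 1") auto
        qed
        then show ?thesis using False by simp
      qed
      then show "ennreal (norm (?K \<xi>)) \<le> (\<Prod>i\<in>UNIV. ?g (\<xi> $ i))"
        by (subst prod_ennreal) (auto intro!: ennreal_leI)
    qed
  qed
  also have "\<dots> = (\<integral>\<^sup>+t. ?g t \<partial>lborel) ^ CARD('n)"
    by (rule nn_integral_prod_cart) auto
  also have "(\<integral>\<^sup>+t. ?g t \<partial>lborel) = 2 * (\<integral>\<^sup>+t. ?g t * indicator {0..} t \<partial>lborel)"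
    by (rule nn_integral_even) auto
  also have "(\<integral>\<^sup>+t. ?g t * indicator {0..} t \<partial>lborel) \<le>
     (\<integral>\<^sup>+t. ennreal (t powr p) * indicator {0..1} t + ennreal (t powr q) * indicator {1..} t \<partial>lborel)"
    by (intro nn_integral_mono) (auto simp: indicator_def)
  also have "\<dots> = (\<integral>\<^sup>+t. ennreal (t powr p) * indicator {0..1} t \<partial>lborel)
      + (\<integral>\<^sup>+t. ennreal (t powr q) * indicator {1..} t \<partial>lborel)"
    by (rule nn_integral_add) auto
  also have "\<dots> = ennreal (1 powr (p + 1) / (p + 1)) + ennreal (- (1 powr (q + 1)) / (q + 1))"
    by (subst nn_integral_powr_Icc, simp, rule p, subst nn_integral_powr_atLeast) (use q in auto)
  also have "(2 * \<dots>) ^ CARD('n) < \<infinity>"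
    by (auto simp: power_less_top_ennreal ennreal_mult_less_top)
  finally have "(\<integral>\<^sup>+z. ennreal (norm (?K z)) \<partial>?M) < \<infinity>"
    by (simp add: mult_left_mono power_mono)
  then show ?thesis
    by (intro integrableI_bounded) auto
qed

section \<open>Lattice sums over the mesh\<close>

lemma sum_index_cube_prod:
  fixes c :: "nat \<Rightarrow> real"
  shows "(\<Sum>k\<in>(index_cube N :: (nat ^ 'n::finite) set). \<Prod>i\<in>UNIV. c (k $ i)) = (\<Sum>j<N. c j) ^ CARD('n)"
proof -
  have "(\<Sum>j<N. c j) ^ CARD('n) = (\<Prod>i\<in>(UNIV::'n set). \<Sum>j<N. c j)"
    by (simp add: prod_constant)
  also have "\<dots> = (\<Sum>g\<in>(UNIV::'n set) \<rightarrow>\<^sub>E {..<N}. \<Prod>i\<in>UNIV. c (g i))"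
    by (rule prod_sum_PiE) auto
  also have "\<dots> = (\<Sum>k\<in>(index_cube N :: (nat ^ 'n::finite) set). \<Prod>i\<in>UNIV. c (k $ i))"
    by (rule sum.reindex_bij_witness[of _ vec_nth vec_lambda]) (auto simp: index_cube_def PiE_def)
  finally show ?thesis by simp
qed

lemma grid_point_component [simp]: "grid_point h k $ i = h * real (k $ i)"
  by (simp add: grid_point_def)

lemma grid_point_scale: "grid_point h k = h *\<^sub>R grid_point 1 k"
  by (simp add: vec_eq_iff)

lemma norm_grid_point: "0 \<le> h \<Longrightarrow> norm (grid_point h k) = h * norm (grid_point 1 k)"
  by (subst grid_point_scale) (simp only: norm_scaleR abs_of_nonneg)

text \<open>\<open>h ^ CARD('n)\<close> is the volume of an element, so these are the terms of
  Riemann sums of |\<xi>|^p. Homogeneity separates the mesh size from a sum over integer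
  points.\<close>

lemma norm_grid_point_powr_scale:
  assumes "0 < h"
  shows "norm (grid_point h k :: real ^ 'n::finite) powr p * h ^ CARD('n)
    = h powr (real CARD('n) + p) * norm (grid_point 1 k :: real ^ 'n) powr p"
proof -
  have "norm (grid_point h k :: real ^ 'n) powr p * h ^ CARD('n)
    = h powr p * norm (grid_point 1 k :: real ^ 'n) powr p * h powr real CARD('n)"
    using assms by (simp add: norm_grid_point[of h k] powr_mult powr_realpow)
  also have "\<dots> = (h powr real CARD('n) * h powr p) * norm (grid_point 1 k :: real ^ 'n) powr p"
    by (simp only: mult_ac)
  finally show ?thesis by (simp only: powr_add)
qed

lemma norm_grid_point_ge1:
  assumes "k \<noteq> 0"
  shows "1 \<le> norm (grid_point 1 k :: real ^ 'n::finite)"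
proof -
  obtain i where "k $ i \<noteq> 0" using assms by (auto simp: vec_eq_iff)
  then show ?thesis using component_le_norm_cart[of "grid_point 1 k" i] by simp
qed

text \<open>The lattice counterpart of \<open>nn_integral_norm_powr_cube\<close>. Coordinates of
  \<open>k\<close> may vanish, so \<open>k $ i\<close> is replaced by \<open>Suc (k $ i)\<close>,
  which for \<open>k \<noteq> 0\<close> is at most \<open>2 * norm (grid_point 1 k)\<close>; this
  costs the factor \<open>2 powr (- p)\<close>.\<close>

lemma sum_grid_powr_le:
  assumes "p \<le> 0" "0 < h"
  shows "(\<Sum>k\<in>index_cube N - {0}. norm (grid_point h k :: real ^ 'n::finite) powr p * h ^ CARD('n))
    \<le> h powr (real CARD('n) + p) * (2 powr (- p) * (\<Sum>j<N. real (Suc j) powr (p / real CARD('n))) ^ CARD('n))"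
proof -
  let ?d = "real CARD('n)" and ?r = "\<lambda>k. norm (grid_point 1 k :: real ^ 'n)"
  let ?c = "\<lambda>j. real (Suc j) powr (p / real CARD('n))"
  have le: "?r k powr p \<le> 2 powr (- p) * (\<Prod>i\<in>UNIV. ?c (k $ i))" if "k \<noteq> 0" for k
  proof -
    have r: "1 \<le> ?r k" by (rule norm_grid_point_ge1[OF that])
    have "(2 * ?r k) powr p \<le> (\<Prod>i\<in>UNIV. ?c (k $ i))"
    proof (rule powr_le_prod)
      fix i
      have "real (k $ i) \<le> ?r k" using component_le_norm_cart[of "grid_point 1 k" i] by simp
      then show "(2 * ?r k) powr (p / ?d) \<le> ?c (k $ i)"
        using r assms by (intro powr_mono2') (auto simp: divide_nonpos_pos)
    qed (use r in linarith)
    moreover have "?r k powr p = 2 powr (- p) * (2 * ?r k) powr p"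
      using r by (simp add: powr_mult powr_minus field_simps)
    ultimately show ?thesis by (simp add: mult_left_mono)
  qed
  have "(\<Sum>k\<in>index_cube N - {0}. norm (grid_point h k :: real ^ 'n) powr p * h ^ CARD('n))
      = h powr (?d + p) * (\<Sum>k\<in>index_cube N - {0}. ?r k powr p)"
    using norm_grid_point_powr_scale[OF assms(2), where p = p and 'n = 'n] by (simp add: sum_distrib_left)
  also have "(\<Sum>k\<in>index_cube N - {0}. ?r k powr p) \<le> (\<Sum>k\<in>(index_cube N :: (nat ^ 'n) set) - {0}. 2 powr (- p) * (\<Prod>i\<in>UNIV. ?c (k $ i)))"
    by (intro sum_mono le) simp
  \<comment> \<open>With the term for \<open>k = 0\<close> added back, the sum factorises over the
    coordinates.\<close>
  also have "\<dots> \<le> (\<Sum>k\<in>(index_cube N :: (nat ^ 'n) set). 2 powr (- p) * (\<Prod>i\<in>UNIV. ?c (k $ i)))"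
    by (intro sum_mono2) (auto simp: finite_index_cube prod_nonneg)
  also have "\<dots> = 2 powr (- p) * (\<Sum>j<N. ?c j) ^ CARD('n)"
    unfolding sum_index_cube_prod[of ?c, symmetric] sum_distrib_left ..
  finally show ?thesis by (simp add: mult_left_mono)
qed

text \<open>Comparison with the integral of x^p over [0, N], one increment at a time: the mean value
  theorem writes the increment of x^(p+1)/(p+1) as z^p with z < N + 1, and p \<le> 0.\<close>

lemma sum_Suc_powr_le:
  fixes p :: real
  assumes "- 1 < p" "p \<le> 0"
  shows "(\<Sum>j<N. real (Suc j) powr p) \<le> real N powr (p + 1) / (p + 1)"
proof (induction N)
  case (Suc N)
  have "real (Suc N) powr p \<le> (real (Suc N) powr (p + 1) - real N powr (p + 1)) / (p + 1)"
  \<comment> \<open>x^(p+1) need not be differentiable at 0, so the first increment is computed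
    directly.\<close>
  proof (cases "N = 0")
    case True
    then show ?thesis using assms by (simp add: field_simps)
  next
    case False
    have "\<exists>z. real N < z \<and> z < real (Suc N) \<and>
      real (Suc N) powr (p + 1) - real N powr (p + 1) = (real (Suc N) - real N) * ((p + 1) * z powr p)"
    proof (rule MVT2)
      fix x :: real assume "real N \<le> x" "x \<le> real (Suc N)"
      then show "((\<lambda>x. x powr (p + 1)) has_real_derivative (p + 1) * x powr p) (at x)"
        using False has_real_derivative_powr[of x "p + 1"] by simp
    qed simp
    then obtain z where z: "real N < z" "z < real (Suc N)"
      "real (Suc N) powr (p + 1) - real N powr (p + 1) = (p + 1) * z powr p" by auto
    have "real (Suc N) powr p \<le> z powr p"
      using z False assms by (intro powr_mono2') auto
    then show ?thesis using z assms by simp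
  qed
  then show ?case using Suc by (simp add: diff_divide_distrib)
qed simp

text \<open>Here p/d < -1: the one-dimensional sums stay below the value of a convergent series,
  uniformly in N, and only the scaling factor h^(-\<alpha>) remains.\<close>

lemma sum_grid_far:
  assumes "0 < \<alpha>"
  shows "\<exists>C>0. \<forall>N h. 0 < h \<longrightarrow>
    (\<Sum>k\<in>index_cube N - {0}. norm (grid_point h k :: real ^ 'n::finite) powr (- (real CARD('n) + \<alpha>)) * h ^ CARD('n))
      \<le> C * h powr (- \<alpha>)"
proof -
  let ?d = "real CARD('n)"
  let ?p = "- (?d + \<alpha>)"
  have d: "?d > 0" by simp
  have "?p / ?d < - 1" using assms d by (simp add: field_simps)
  then have sm: "summable (\<lambda>j. real (Suc j) powr (?p / ?d))"
    by (subst summable_Suc_iff) (simp add: summable_real_powr_iff)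
  define Z where "Z = (\<Sum>j. real (Suc j) powr (?p / ?d))"
  have Z: "Z > 0" unfolding Z_def by (rule suminf_pos[OF sm]) simp
  show ?thesis
  proof (intro exI[of _ "2 powr (- ?p) * Z ^ CARD('n)"] conjI allI impI)
    fix N and h :: real assume h: "0 < h"
    have "(\<Sum>k\<in>index_cube N - {0}. norm (grid_point h k :: real ^ 'n) powr ?p * h ^ CARD('n))
      \<le> h powr (?d + ?p) * (2 powr (- ?p) * (\<Sum>j<N. real (Suc j) powr (?p / ?d)) ^ CARD('n))"
      using assms h by (intro sum_grid_powr_le) auto
    also have "\<dots> \<le> h powr (?d + ?p) * (2 powr (- ?p) * Z ^ CARD('n))"
      unfolding Z_def by (intro mult_left_mono power_mono sum_le_suminf[OF sm] sum_nonneg) auto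
    finally show "(\<Sum>k\<in>index_cube N - {0}. norm (grid_point h k :: real ^ 'n) powr ?p * h ^ CARD('n))
      \<le> 2 powr (- ?p) * Z ^ CARD('n) * h powr (- \<alpha>)" by (simp add: mult_ac)
  qed (use Z in auto)
qed

text \<open>Here p/d > -1: the one-dimensional sums grow, and the bound for their d-th power is a
  multiple of N^\<epsilon>. With the scaling factor h^\<epsilon> this becomes a power of
  \<open>h * real N\<close>, which is the fixed length L in the application.\<close>

lemma sum_grid_near:
  assumes "0 < \<epsilon>" "\<epsilon> \<le> real CARD('n)"
  shows "\<exists>C>0. \<forall>N h. 0 < h \<longrightarrow>
    (\<Sum>k\<in>index_cube N - {0}. norm (grid_point h k :: real ^ 'n::finite) powr (\<epsilon> - real CARD('n)) * h ^ CARD('n))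
      \<le> C * (h * real N) powr \<epsilon>"
proof -
  let ?d = "real CARD('n)"
  let ?p = "\<epsilon> - ?d"
  have d: "?d > 0" by simp
  have p: "- 1 < ?p / ?d" "?p / ?d \<le> 0" using assms d by (auto simp: field_simps)
  define Z where "Z = 1 / (?p / ?d + 1)"
  have Z: "Z > 0" unfolding Z_def using p by simp
  show ?thesis
  proof (intro exI[of _ "2 powr (- ?p) * Z ^ CARD('n)"] conjI allI impI)
    fix N and h :: real assume h: "0 < h"
    have "(\<Sum>k\<in>index_cube N - {0}. norm (grid_point h k :: real ^ 'n) powr ?p * h ^ CARD('n))
      \<le> h powr (?d + ?p) * (2 powr (- ?p) * (\<Sum>j<N. real (Suc j) powr (?p / ?d)) ^ CARD('n))"
      using assms h by (intro sum_grid_powr_le) auto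
    also have "\<dots> \<le> h powr (?d + ?p) * (2 powr (- ?p) * (real N powr (?p / ?d + 1) / (?p / ?d + 1)) ^ CARD('n))"
      by (intro mult_left_mono power_mono sum_Suc_powr_le p sum_nonneg) auto
    also have "(real N powr (?p / ?d + 1) / (?p / ?d + 1)) ^ CARD('n) = Z ^ CARD('n) * real N powr \<epsilon>"
    proof -
      have "(real N powr (?p / ?d + 1)) ^ CARD('n) = real N powr \<epsilon>"
        using d by (cases "N = 0") (auto simp: powr_realpow[symmetric] powr_powr field_simps)
      then show ?thesis by (simp only: Z_def power_divide power_one times_divide_eq_left mult_1)
    qed
    finally show "(\<Sum>k\<in>index_cube N - {0}. norm (grid_point h k :: real ^ 'n) powr ?p * h ^ CARD('n))
      \<le> 2 powr (- ?p) * Z ^ CARD('n) * (h * real N) powr \<epsilon>"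
      using h by (simp add: powr_mult mult_ac)
  qed (use Z in auto)
qed

section \<open>Extension by zero\<close>

text \<open>The case that needs an argument is one point inside and one outside: the segment between
  them meets the frontier, which lies in the closure and on which \<open>f\<close> vanishes, and the
  crossing point is no farther away than the outer point. The absolute value is taken because
  \<open>holder_space\<close> does not fix the sign of its constant.\<close>

lemma holder_extend_zero:
  fixes f :: "real ^ 'n::finite \<Rightarrow> real"
  assumes ab: "\<And>i. a $ i < b $ i" and zero: "\<And>x. x \<notin> box a b \<Longrightarrow> f x = 0" and s: "0 < s"
    and H: "\<And>x y. x \<in> closure (box a b) \<Longrightarrow> y \<in> closure (box a b) \<Longrightarrow> \<bar>f x - f y\<bar> \<le> H * norm (x - y) powr s"
  shows "\<bar>f x - f y\<bar> \<le> \<bar>H\<bar> * norm (x - y) powr s"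
proof -
  have H': "\<bar>f x - f y\<bar> \<le> \<bar>H\<bar> * norm (x - y) powr s"
    if "x \<in> closure (box a b)" "y \<in> closure (box a b)" for x y
    using H[OF that] by (rule order_trans) (simp add: mult_right_mono)
  have key: "\<bar>f x - f y\<bar> \<le> \<bar>H\<bar> * norm (x - y) powr s" if x: "x \<in> box a b" and y: "y \<notin> box a b" for x y
  proof -
    have "closed_segment x y \<inter> frontier (box a b) \<noteq> {}"
      by (rule connected_Int_frontier) (use x y in auto)
    then obtain z where z: "z \<in> closed_segment x y" "z \<in> frontier (box a b)" by blast
    have zc: "z \<in> closure (box a b)" and "z \<notin> box a b"
      using z(2) by (auto simp: frontier_def interior_open open_box)
    then have "f z = 0" by (intro zero)
    then have "\<bar>f x - f y\<bar> = \<bar>f x - f z\<bar>" using zero[OF y] by simp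
    also have "\<dots> \<le> \<bar>H\<bar> * norm (x - z) powr s"
      using x closure_subset zc by (intro H') auto
    also have "\<dots> \<le> \<bar>H\<bar> * norm (x - y) powr s"
      using s segment_bound(1)[OF z(1)] by (intro mult_left_mono powr_mono2) (auto simp: norm_minus_commute)
    finally show ?thesis .
  qed
  show ?thesis
  proof (cases "x \<in> box a b"; cases "y \<in> box a b")
    assume "x \<in> box a b" "y \<in> box a b"
    then show ?thesis using closure_subset by (intro H') auto
  next
    assume "x \<notin> box a b" "y \<notin> box a b"
    then show ?thesis using zero by simp
  next
    assume "x \<in> box a b" "y \<notin> box a b"
    then show ?thesis by (rule key)
  next
    assume "x \<notin> box a b" "y \<in> box a b"
    then show ?thesis using key[of y x] by (simp add: norm_minus_commute abs_minus_commute)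
  qed
qed

section \<open>Partial derivatives of a function that vanishes off the box\<close>

lemma deriv_zero_if_half_zero:
  fixes g :: "real \<Rightarrow> real"
  assumes g: "(g has_real_derivative D) (at 0)" and half: "(\<forall>t\<le>0. g t = 0) \<or> (\<forall>t\<ge>0. g t = 0)"
  shows "D = 0"
proof -
  have lim: "((\<lambda>h. (g h - g 0) / h) \<longlongrightarrow> D) (at 0)"
    using g by (simp add: has_field_derivative_iff)
  \<comment> \<open>A two-sided derivative is also the limit of the difference quotients along
    either half-line, and along one of them all quotients are 0.\<close>
  have eq: "D = 0" if F: "F \<le> at 0" "F \<noteq> bot" "\<forall>\<^sub>F t in F. g t = 0" and "g 0 = 0" for F
  proof -
    have "((\<lambda>h. (g h - g 0) / h) \<longlongrightarrow> D) F"
      using lim by (rule tendsto_mono[OF F(1)])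
    moreover have "((\<lambda>h. (g h - g 0) / h) \<longlongrightarrow> 0) F"
      by (rule tendsto_eventually) (use F(3) in eventually_elim, simp add: \<open>g 0 = 0\<close>)
    ultimately show ?thesis using F(2) tendsto_unique by blast
  qed
  show ?thesis using half
    by (elim disjE) (rule eq[of "at_left 0"] eq[of "at_right 0"]; auto simp: at_le eventually_at_filter)+
qed

lemma continuous_on_of_holder:
  fixes u :: "real ^ 'n::finite \<Rightarrow> real"
  assumes H: "\<And>x y. \<bar>u x - u y\<bar> \<le> H * norm (x - y) powr s" and s: "0 < s"
  shows "continuous_on UNIV u"
proof -
  have "isCont u x" for x
  proof -
    have "((\<lambda>y. norm (y - x)) \<longlongrightarrow> 0) (at x)"
      by (intro tendsto_norm_zero) (simp add: LIM_zero_iff)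
    then have "((\<lambda>y. norm (y - x) powr s) \<longlongrightarrow> 0) (at x)"
      using s by (intro tendsto_zero_powrI[of _ _ _ s]) auto
    from tendsto_mult_right_zero[OF this] have "((\<lambda>y. H * norm (y - x) powr s) \<longlongrightarrow> 0) (at x)" .
    then have "((\<lambda>y. u y - u x) \<longlongrightarrow> 0) (at x)"
      by (rule Lim_null_comparison[rotated]) (simp add: H)
    then show ?thesis by (simp add: isCont_def LIM_zero_iff)
  qed
  then show ?thesis by (simp add: continuous_at_imp_continuous_on)
qed

text \<open>The second conclusion has the form of the hypothesis \<open>zero\<close>, so the lemma
  can be applied again to the partial derivatives. On the boundary it rests on the derivatives being
  two-sided.\<close>

lemma partial_extend_zero:
  fixes f :: "real ^ 'n::finite \<Rightarrow> real"
  assumes ab: "\<And>i. a $ i < b $ i" and zero: "\<And>x. x \<notin> box a b \<Longrightarrow> f x = 0"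
    and diff: "\<And>x. x \<in> closure (box a b) \<Longrightarrow> (\<lambda>t. f (x + t *\<^sub>R axis i 1)) field_differentiable (at 0)"
  shows "((\<lambda>t. f (x + t *\<^sub>R axis i 1)) has_real_derivative partial i f x) (at 0)"
    and "x \<notin> box a b \<Longrightarrow> partial i f x = 0"
proof -
  have "box a b \<noteq> {}" using ab by (auto simp: mem_box_cart box_ne_empty Basis_vec_range inner_axis)
  then have cl: "closure (box a b) = cbox a b" by (rule closure_box)
  have out: "((\<lambda>t. f (x + t *\<^sub>R axis i 1)) has_real_derivative 0) (at 0)" if x: "x \<notin> cbox a b"
  proof -
    have "isCont (\<lambda>t. x + t *\<^sub>R axis i (1::real)) 0" by (intro continuous_intros)
    then have "((\<lambda>t. x + t *\<^sub>R axis i (1::real)) \<longlongrightarrow> x) (at 0)" by (simp add: isCont_def)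
    then have "\<forall>\<^sub>F t in at 0. x + t *\<^sub>R axis i (1::real) \<in> - cbox a b"
      using x by (intro topological_tendstoD) (auto simp: closed_cbox)
    then have "\<forall>\<^sub>F t in at 0. f (x + t *\<^sub>R axis i 1) = 0"
      by eventually_elim (use zero box_subset_cbox in blast)
    moreover have "f (x + 0 *\<^sub>R axis i 1) = 0" using x zero box_subset_cbox by auto
    ultimately have "\<forall>\<^sub>F t in nhds 0. f (x + t *\<^sub>R axis i 1) = 0"
      by (simp add: eventually_nhds_conv_at)
    then show ?thesis
      by (subst DERIV_cong_ev[OF refl, of _ "\<lambda>_. 0"]) auto
  qed
  show der: "((\<lambda>t. f (x + t *\<^sub>R axis i 1)) has_real_derivative partial i f x) (at 0)"
  proof (cases "x \<in> cbox a b")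
    case True
    then show ?thesis using diff[of x] by (simp add: cl partial_def DERIV_deriv_iff_field_differentiable)
  next
    case False
    then show ?thesis using out[OF False] DERIV_imp_deriv[OF out[OF False]] by (simp add: partial_def)
  qed
  assume x: "x \<notin> box a b"
  \<comment> \<open>A face that separates \<open>x\<close> from the box. If \<open>i = j\<close>,
    the half-line along axis \<open>i\<close> that points away from the face stays outside; if
    \<open>i \<noteq> j\<close>, the whole line does. In either case \<open>f\<close> vanishes on a
    half-line.\<close>
  then obtain j where j: "x $ j \<le> a $ j \<or> b $ j \<le> x $ j" by (auto simp: mem_box_cart not_less)
  have out: "f (x + t *\<^sub>R axis i 1) = 0"
    if "(x + t *\<^sub>R axis i 1) $ j \<le> a $ j \<or> b $ j \<le> (x + t *\<^sub>R axis i 1) $ j" for t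
    by (rule zero) (use that in \<open>auto simp: mem_box_cart not_less intro!: exI[of _ j]\<close>)
  have "(\<forall>t\<le>0. f (x + t *\<^sub>R axis i 1) = 0) \<or> (\<forall>t\<ge>0. f (x + t *\<^sub>R axis i 1) = 0)"
  proof (cases "x $ j \<le> a $ j")
    case True
    then have "\<forall>t\<le>0. f (x + t *\<^sub>R axis i 1) = 0" by (intro allI impI out) (auto simp: axis_def)
    then show ?thesis ..
  next
    case False
    with j have "\<forall>t\<ge>0. f (x + t *\<^sub>R axis i 1) = 0" by (intro allI impI out) (auto simp: axis_def)
    then show ?thesis ..
  qed
  with der show "partial i f x = 0" by (rule deriv_zero_if_half_zero)
qed

section \<open>From partial derivatives to derivatives along arbitrary lines\<close>

lemma MVT_from_zero:
  fixes g g' :: "real \<Rightarrow> real"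
  assumes g: "\<And>t. (g has_real_derivative g' t) (at t)"
  shows "\<exists>\<theta>. \<bar>\<theta>\<bar> \<le> \<bar>r\<bar> \<and> g r - g 0 = r * g' \<theta>"
proof -
  consider "r = 0" | "0 < r" | "r < 0" by linarith
  then show ?thesis
  proof cases
    case 1
    then show ?thesis by auto
  next
    case 2
    from MVT2[OF this g] obtain z where "0 < z" "z < r" "g r - g 0 = r * g' z" by auto
    then show ?thesis by (intro exI[of _ z]) auto
  next
    case 3
    from MVT2[OF this g] obtain z where "r < z" "z < 0" "g 0 - g r = (0 - r) * g' z" by auto
    then show ?thesis by (intro exI[of _ z]) auto
  qed
qed

text \<open>The classical criterion that continuous partial derivatives imply total
  differentiability. It is the bridge from \<open>holder_space\<close>, which speaks of coordinate
  directions, to Taylor expansion along arbitrary lines.\<close>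

lemma has_derivative_of_partials:
  fixes f :: "real ^ 'n::finite \<Rightarrow> real"
  assumes P: "\<And>i x. ((\<lambda>t. f (x + t *\<^sub>R axis i 1)) has_real_derivative P i x) (at 0)"
    and cont: "\<And>i. isCont (P i) x"
  shows "(f has_derivative (\<lambda>v. \<Sum>i\<in>UNIV. v $ i * P i x)) (at x)"
proof -
  have P': "((\<lambda>t. f (y + t *\<^sub>R axis i 1)) has_real_derivative P i (y + t *\<^sub>R axis i 1)) (at t)" for y i t
  proof -
    have "((\<lambda>s. (\<lambda>\<tau>. f (y + t *\<^sub>R axis i 1 + \<tau> *\<^sub>R axis i 1)) (s - t)) has_real_derivative
        P i (y + t *\<^sub>R axis i 1) * 1) (at t)"
      by (rule DERIV_chain2[of _ _ "\<lambda>s. s - t"]) (use P in \<open>auto intro!: derivative_eq_intros\<close>)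
    then show ?thesis by (simp add: scaleR_diff_left)
  qed
  \<comment> \<open>Induction on the set of coordinates in which the increment may be nonzero. The
    new coordinate is moved last and contributes one mean value error of at most
    \<open>e * norm v\<close>.\<close>
  have est: "\<exists>\<delta>>0. \<forall>v. norm v < \<delta> \<and> (\<forall>i. i \<notin> S \<longrightarrow> v $ i = 0) \<longrightarrow>
      \<bar>f (x + v) - f x - (\<Sum>i\<in>S. v $ i * P i x)\<bar> \<le> e * real (card S) * norm v"
    if "finite S" "0 < e" for S e
    using that
  proof (induction S)
    case empty
    have z: "v = 0" if "\<forall>i. v $ i = 0" for v :: "real ^ 'n" using that by (simp add: vec_eq_iff)
    show ?case by (intro exI[of _ 1]) (auto dest!: z)
  next
    case (insert j S)
    then obtain \<delta> where \<delta>: "\<delta> > 0" and IH: "\<And>v. norm v < \<delta> \<Longrightarrow> (\<And>i. i \<notin> S \<Longrightarrow> v $ i = 0) \<Longrightarrow>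
      \<bar>f (x + v) - f x - (\<Sum>i\<in>S. v $ i * P i x)\<bar> \<le> e * real (card S) * norm v" by blast
    obtain \<eta> where \<eta>: "\<eta> > 0" "\<And>y. norm (y - x) < \<eta> \<Longrightarrow> \<bar>P j y - P j x\<bar> < e"
      using cont[of j] \<open>0 < e\<close> by (force simp: continuous_at_eps_delta dist_norm)
    show ?case
    \<comment> \<open>The intermediate point has distance at most
      \<open>norm v' + \<bar>\<theta>\<bar>\<close> from \<open>x\<close>, hence at most
      \<open>2 * norm v\<close>; this explains \<open>\<eta> / 2\<close>.\<close>
    proof (intro exI[of _ "min \<delta> (\<eta> / 2)"] conjI allI impI)
      fix v :: "real ^ 'n" assume v: "norm v < min \<delta> (\<eta> / 2) \<and> (\<forall>i. i \<notin> insert j S \<longrightarrow> v $ i = 0)"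
      define v' where "v' = (\<chi> i. if i = j then 0 else v $ i)"
      have vv': "v = v' + (v $ j) *\<^sub>R axis j 1"
        by (auto simp: vec_eq_iff v'_def axis_def)
      have le: "norm v' \<le> norm v"
        by (rule norm_le_componentwise_cart) (auto simp: v'_def)
      have sum: "(\<Sum>i\<in>insert j S. v $ i * P i x) = v $ j * P j x + (\<Sum>i\<in>S. v' $ i * P i x)"
        using insert.hyps by (auto simp: v'_def intro!: sum.cong)
      have IH': "\<bar>f (x + v') - f x - (\<Sum>i\<in>S. v' $ i * P i x)\<bar> \<le> e * real (card S) * norm v'"
        using v le by (intro IH) (auto simp: v'_def)
      obtain \<theta> where \<theta>: "\<bar>\<theta>\<bar> \<le> \<bar>v $ j\<bar>"
        "f (x + v' + (v $ j) *\<^sub>R axis j 1) - f (x + v') = v $ j * P j (x + v' + \<theta> *\<^sub>R axis j 1)"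
        using MVT_from_zero[of "\<lambda>t. f (x + v' + t *\<^sub>R axis j 1)", OF P'] by force
      then have \<theta>2: "f (x + v) - f (x + v') = v $ j * P j (x + v' + \<theta> *\<^sub>R axis j 1)"
        by (subst vv') (simp add: add.assoc)
      have "norm (x + v' + \<theta> *\<^sub>R axis j 1 - x) \<le> norm v' + \<bar>\<theta>\<bar>"
        using norm_triangle_ineq[of v' "\<theta> *\<^sub>R axis j 1"] by (simp add: norm_axis_1)
      also have "\<dots> < \<eta>" using le v \<theta>(1) component_le_norm_cart[of v j] by linarith
      finally have "\<bar>P j (x + v' + \<theta> *\<^sub>R axis j 1) - P j x\<bar> < e" by (rule \<eta>(2))
      then have "\<bar>v $ j * P j (x + v' + \<theta> *\<^sub>R axis j 1) - v $ j * P j x\<bar> \<le> norm v * e"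
        unfolding right_diff_distrib[symmetric] abs_mult
        using component_le_norm_cart[of v j] by (intro mult_mono) auto
      moreover have "e * real (card S) * norm v' \<le> e * real (card S) * norm v"
        using le insert.prems by (intro mult_left_mono) auto
      ultimately have "\<bar>f (x + v) - f x - (v $ j * P j x + (\<Sum>i\<in>S. v' $ i * P i x))\<bar>
          \<le> norm v * e + e * real (card S) * norm v"
        using IH' \<theta>2 by linarith
      also have "\<dots> = e * real (card (insert j S)) * norm v"
        using insert.hyps by (simp add: algebra_simps)
      finally show "\<bar>f (x + v) - f x - (\<Sum>i\<in>insert j S. v $ i * P i x)\<bar> \<le> e * real (card (insert j S)) * norm v"
        unfolding sum .
    qed (use \<delta> \<eta> in auto)
  qed
  show ?thesis
    unfolding has_derivative_at_alt
  proof (intro conjI allI impI)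
    show "bounded_linear (\<lambda>v. \<Sum>i\<in>UNIV. v $ i * P i x)"
      by (intro bounded_linear_sum bounded_linear_mult_const bounded_linear_vec_nth)
    fix e :: real assume "0 < e"
    then have "0 < e / real CARD('n)" by simp
    from est[OF finite this, of UNIV] obtain \<delta> where \<delta>: "\<delta> > 0" "\<And>v. norm v < \<delta> \<Longrightarrow>
      \<bar>f (x + v) - f x - (\<Sum>i\<in>UNIV. v $ i * P i x)\<bar> \<le> e * norm v" by auto
    show "\<exists>d>0. \<forall>y. norm (y - x) < d \<longrightarrow>
      norm (f y - f x - (\<Sum>i\<in>UNIV. (y - x) $ i * P i x)) \<le> e * norm (y - x)"
    proof (intro exI conjI allI impI)
      fix y assume "norm (y - x) < \<delta>"
      from \<delta>(2)[OF this] show "norm (f y - f x - (\<Sum>i\<in>UNIV. (y - x) $ i * P i x)) \<le> e * norm (y - x)" by simp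
    qed (rule \<delta>)
  qed
qed

lemma has_real_derivative_along:
  fixes f :: "real ^ 'n::finite \<Rightarrow> real"
  assumes "\<And>x. (f has_derivative (\<lambda>v. \<Sum>i\<in>UNIV. v $ i * P i x)) (at x)"
  shows "((\<lambda>t. f (x + t *\<^sub>R v)) has_real_derivative (\<Sum>i\<in>UNIV. v $ i * P i (x + t *\<^sub>R v))) (at t)"
proof -
  have "((\<lambda>t. x + t *\<^sub>R v) has_derivative (\<lambda>h. h *\<^sub>R v)) (at t)"
    by (auto intro!: derivative_eq_intros)
  from diff_chain_at[OF this assms]
  have "((\<lambda>t. f (x + t *\<^sub>R v)) has_derivative
      (\<lambda>h. \<Sum>i\<in>UNIV. (h *\<^sub>R v) $ i * P i (x + t *\<^sub>R v))) (at t)"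
    by (simp add: o_def)
  moreover have "(\<lambda>h. \<Sum>i\<in>UNIV. (h *\<^sub>R v) $ i * P i (x + t *\<^sub>R v)) = (*) (\<Sum>i\<in>UNIV. v $ i * P i (x + t *\<^sub>R v))"
    by (auto simp: fun_eq_iff sum_distrib_left sum_distrib_right mult_ac)
  ultimately show ?thesis by (simp add: has_field_derivative_def)
qed

section \<open>Sign patterns\<close>

text \<open>The patterns \<open>(-1) ^ m\<close> as real vectors, so that a reflection becomes the
  componentwise product \<open>s * \<xi>\<close>.\<close>

definition signs :: "(real ^ 'n::finite) set" where
  "signs = {s. \<forall>i. s $ i = 1 \<or> s $ i = -1}"

lemma bij_betw_signs:
  "bij_betw (\<lambda>m. \<chi> i. (-1) ^ (m $ i)) (index_cube 2 :: (nat ^ 'n) set) (signs :: (real ^ 'n::finite) set)"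
proof (rule bij_betw_byWitness[where f' = "\<lambda>s. \<chi> i. if s $ i = 1 then 0 else 1"])
  show "\<forall>m\<in>index_cube 2. (\<chi> i. if (\<chi> i. (-1::real) ^ (m $ i)) $ i = 1 then 0 else 1) = (m :: nat ^ 'n)"
  proof (intro ballI, unfold vec_eq_iff, intro allI)
    fix m :: "nat ^ 'n" and i assume "m \<in> index_cube 2"
    then have "m $ i = 0 \<or> m $ i = 1" by (auto simp: index_cube_def less_2_cases_iff)
    then show "(\<chi> i. if (\<chi> i. (-1::real) ^ (m $ i)) $ i = 1 then 0 else 1) $ i = m $ i" by auto
  qed
  show "\<forall>s\<in>signs. (\<chi> i. (-1::real) ^ ((\<chi> i. if s $ i = 1 then 0 else 1) $ i)) = (s :: real ^ 'n)"
    by (auto simp: signs_def vec_eq_iff)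
  show "(\<lambda>m. \<chi> i. (-1) ^ (m $ i)) ` (index_cube 2 :: (nat ^ 'n) set) \<subseteq> (signs :: (real ^ 'n) set)"
  proof (clarsimp simp: signs_def index_cube_def)
    fix m :: "nat ^ 'n" and i assume "(-1::real) ^ m $ i \<noteq> -1"
    then show "(-1::real) ^ m $ i = 1" by (cases "even (m $ i)") auto
  qed
  show "(\<lambda>s. \<chi> i. if s $ i = 1 then 0 else 1) ` (signs :: (real ^ 'n) set) \<subseteq> (index_cube 2 :: (nat ^ 'n) set)"
    by (auto simp: index_cube_def)
qed

lemma card_index_cube: "card (index_cube N :: (nat ^ 'n::finite) set) = N ^ CARD('n)"
proof -
  have "real (card (index_cube N :: (nat ^ 'n::finite) set)) = real (N ^ CARD('n))"
    using sum_index_cube_prod[of "\<lambda>_. 1" N, where 'n = 'n] by simp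
  then show ?thesis by (simp only: of_nat_eq_iff)
qed

lemma finite_signs [simp]: "finite (signs :: (real ^ 'n::finite) set)"
  using bij_betw_finite[OF bij_betw_signs] finite_index_cube by blast

lemma card_signs: "card (signs :: (real ^ 'n::finite) set) = 2 ^ CARD('n)"
  using bij_betw_same_card[OF bij_betw_signs] card_index_cube by metis

lemma abs_sign: "s \<in> signs \<Longrightarrow> \<bar>s $ i\<bar> = 1"
  by (auto simp: signs_def dest: spec[of _ i])

lemma sign_square: "s \<in> signs \<Longrightarrow> s $ i * s $ i = 1"
  by (auto simp: signs_def dest: spec[of _ i])

lemma norm_sign_mult [simp]: "s \<in> signs \<Longrightarrow> norm (s * \<xi>) = norm (\<xi> :: real ^ 'n::finite)"
  by (simp add: norm_vec_def abs_sign L2_set_def power_mult_distrib) (simp add: abs_sign sign_square power2_eq_square)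

text \<open>Flipping coordinate \<open>i\<close> is an involution of \<open>signs\<close>, so the
  sum equals its own negative.\<close>

lemma sum_signs_odd:
  fixes f :: "real ^ 'n::finite \<Rightarrow> real"
  assumes "\<And>s. f (\<chi> l. if l = i then - s $ l else s $ l) = - f s"
  shows "(\<Sum>s\<in>signs. f s) = 0"
proof -
  define flip where "flip = (\<lambda>s :: real ^ 'n. \<chi> l. if l = i then - s $ l else s $ l)"
  have inv: "flip (flip s) = s" for s by (simp add: flip_def vec_eq_iff)
  have "flip s \<in> signs" if "s \<in> signs" for s using that by (auto simp: signs_def flip_def)
  then have "(\<Sum>s\<in>signs. f s) = (\<Sum>s\<in>signs. f (flip s))"
    by (intro sum.reindex_bij_witness[of _ flip flip]) (auto simp: inv)
  then show ?thesis using assms by (simp add: flip_def sum_negf)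
qed

lemma sum_signs_component: "(\<Sum>s\<in>(signs :: (real ^ 'n::finite) set). s $ i) = 0"
  by (rule sum_signs_odd[of _ i]) simp

text \<open>Orthogonality of the coordinates over the sign patterns. Together with
  \<open>sum_signs_component\<close> it removes the gradient and the mixed second derivatives from
  the symmetrised Taylor expansion.\<close>

lemma sum_signs_component2:
  "(\<Sum>s\<in>(signs :: (real ^ 'n::finite) set). s $ i * s $ j) = (if i = j then 2 ^ CARD('n) else 0)"
proof (cases "i = j")
  case True
  then show ?thesis by (simp add: sign_square card_signs)
next
  case False
  then show ?thesis by (simp add: sum_signs_odd[of _ i])
qed

lemma phi_eq_signs:
  "phi \<gamma> u x \<xi> = ((\<Sum>s\<in>signs. u (x + s * \<xi>)) - 2 ^ CARD('n) * u x) / norm (\<xi> :: real ^ 'n::finite) powr \<gamma>"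
proof -
  have "(\<Sum>m\<in>(index_cube 2 :: (nat ^ 'n) set). u (x + (\<chi> i. (-1) ^ (m $ i) * \<xi> $ i)))
     = (\<Sum>m\<in>(index_cube 2 :: (nat ^ 'n) set). u (x + (\<chi> i. (-1) ^ (m $ i)) * \<xi>))"
    by (intro sum.cong refl arg_cong[of _ _ u]) (simp add: vec_eq_iff)
  also have "\<dots> = (\<Sum>s\<in>signs. u (x + s * \<xi>))"
    by (rule sum.reindex_bij_betw[OF bij_betw_signs])
  finally show ?thesis by (simp add: phi_def)
qed

text \<open>Turns membership in the Hoelder space into global data: a gradient \<open>P\<close> and
  a Hessian \<open>Q\<close> valid along every line, one Hoelder constant for all entries of
  \<open>Q\<close>, and a Lipschitz bound for \<open>u\<close>, which serves as Hoelder continuity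
  of exponent 1 in the representation of the error.\<close>

lemma holder_space_2_dest:
  fixes u :: "real ^ 'n::finite \<Rightarrow> real"
  assumes u: "u \<in> holder_space 2 s (closure (box a b))"
    and ab: "\<And>i. a $ i < b $ i" and zero: "\<And>x. x \<notin> box a b \<Longrightarrow> u x = 0" and s: "0 < s"
  obtains P Q K B where
    "\<And>x v t. ((\<lambda>t. u (x + t *\<^sub>R v)) has_real_derivative (\<Sum>i\<in>UNIV. v $ i * P i (x + t *\<^sub>R v))) (at t)"
    "\<And>i x v t. ((\<lambda>t. P i (x + t *\<^sub>R v)) has_real_derivative (\<Sum>j\<in>UNIV. v $ j * Q i j (x + t *\<^sub>R v))) (at t)"
    "0 \<le> K" "\<And>i j x y. \<bar>Q i j x - Q i j y\<bar> \<le> K * norm (x - y) powr s"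
    "\<And>x y. \<bar>u x - u y\<bar> \<le> B * norm (x - y)"
proof -
  define P where "P = (\<lambda>i. partial i u)"
  define Q where "Q = (\<lambda>i j. partial j (partial i u))"
  from u have d: "\<And>is i x. length is < 2 \<Longrightarrow> x \<in> closure (box a b) \<Longrightarrow>
      (\<lambda>t. iter_partial is u (x + t *\<^sub>R axis i 1)) field_differentiable (at 0)"
    and h: "\<And>is. length is = 2 \<Longrightarrow> \<exists>H. \<forall>x\<in>closure (box a b). \<forall>y\<in>closure (box a b).
      \<bar>iter_partial is u x - iter_partial is u y\<bar> \<le> H * norm (x - y) powr s"
    unfolding holder_space_def by auto
  have d0: "(\<lambda>t. u (x + t *\<^sub>R axis i 1)) field_differentiable (at 0)" if "x \<in> closure (box a b)" for x i
    using d[of "[]"] that by simp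
  have d1: "(\<lambda>t. P j (x + t *\<^sub>R axis i 1)) field_differentiable (at 0)" if "x \<in> closure (box a b)" for x i j
    using d[of "[j]"] that by (simp add: P_def)
  note u1 = partial_extend_zero[OF ab zero d0]
  have P1: "((\<lambda>t. u (x + t *\<^sub>R axis i 1)) has_real_derivative P i x) (at 0)" for x i
    using u1(1) by (simp add: P_def)
  have P0: "P i x = 0" if "x \<notin> box a b" for x i
    using u1(2) that by (simp add: P_def)
  note u2 = partial_extend_zero[OF ab P0 d1]
  have Q1: "((\<lambda>t. P i (x + t *\<^sub>R axis j 1)) has_real_derivative Q i j x) (at 0)" for x i j
    using u2(1) by (simp add: Q_def P_def)
  have Q0: "Q i j x = 0" if "x \<notin> box a b" for x i j
    using u2(2) that by (simp add: Q_def P_def)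
  have "\<forall>i j. \<exists>H. \<forall>x\<in>closure (box a b). \<forall>y\<in>closure (box a b). \<bar>Q i j x - Q i j y\<bar> \<le> H * norm (x - y) powr s"
  proof (intro allI)
    fix i j show "\<exists>H. \<forall>x\<in>closure (box a b). \<forall>y\<in>closure (box a b). \<bar>Q i j x - Q i j y\<bar> \<le> H * norm (x - y) powr s"
      \<comment> \<open>\<open>iter_partial\<close> differentiates by the last list entry
        first.\<close>
      using h[of "[j, i]"] by (simp add: Q_def)
  qed
  then obtain H where H: "\<And>i j x y. x \<in> closure (box a b) \<Longrightarrow> y \<in> closure (box a b) \<Longrightarrow>
      \<bar>Q i j x - Q i j y\<bar> \<le> H i j * norm (x - y) powr s" by metis
  define K where "K = (\<Sum>i\<in>UNIV. \<Sum>j\<in>UNIV. \<bar>H i j\<bar>)"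
  have K: "\<bar>Q i j x - Q i j y\<bar> \<le> K * norm (x - y) powr s" for i j x y
  proof -
    have "\<bar>H i j\<bar> \<le> (\<Sum>j\<in>UNIV. \<bar>H i j\<bar>)" by (rule member_le_sum) auto
    also have "\<dots> \<le> K" unfolding K_def by (rule member_le_sum[where f = "\<lambda>i. \<Sum>j\<in>UNIV. \<bar>H i j\<bar>"]) (auto intro: sum_nonneg)
    finally have "\<bar>H i j\<bar> \<le> K" .
    moreover have "\<bar>Q i j x - Q i j y\<bar> \<le> \<bar>H i j\<bar> * norm (x - y) powr s"
      by (rule holder_extend_zero[OF ab Q0 s H])
    ultimately show ?thesis by (meson mult_right_mono order_trans powr_ge_zero)
  qed
  have K0: "0 \<le> K" unfolding K_def by (intro sum_nonneg) auto
  have Qc: "isCont (Q i j) x" for i j x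
    using continuous_on_of_holder[OF K s] by (simp add: continuous_on_eq_continuous_at)
  have PD: "(P i has_derivative (\<lambda>v. \<Sum>j\<in>UNIV. v $ j * Q i j x)) (at x)" for i x
    by (rule has_derivative_of_partials[OF Q1 Qc])
  have Pc: "isCont (P i) x" for i x
    using PD has_derivative_continuous by blast
  have uD: "(u has_derivative (\<lambda>v. \<Sum>i\<in>UNIV. v $ i * P i x)) (at x)" for x
    by (rule has_derivative_of_partials[OF P1 Pc])
  note u' = has_real_derivative_along[of u P, OF uD]
  note P' = has_real_derivative_along[OF PD]
  have "\<exists>B. \<forall>x. \<bar>P i x\<bar> \<le> B" for i
  proof -
    have "compact (P i ` cbox a b)"
      by (intro compact_continuous_image continuous_at_imp_continuous_on) (auto simp: Pc)
    then obtain B where B: "\<And>x. x \<in> cbox a b \<Longrightarrow> \<bar>P i x\<bar> \<le> B"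
      using compact_imp_bounded[THEN bounded_iff[THEN iffD1]] by (metis image_eqI real_norm_def)
    have "\<bar>P i x\<bar> \<le> max B 0" for x
      using B[of x] P0[of x i] box_subset_cbox[of a b] by (cases "x \<in> box a b") (auto simp: le_max_iff_disj)
    then show ?thesis by blast
  qed
  then obtain B where B: "\<And>i x. \<bar>P i x\<bar> \<le> B i" by metis
  have L: "\<bar>u x - u y\<bar> \<le> (\<Sum>i\<in>UNIV. B i) * norm (x - y)" for x y
  proof -
    have "\<exists>t. 0 < t \<and> t < 1 \<and> u (y + 1 *\<^sub>R (x - y)) - u (y + 0 *\<^sub>R (x - y))
        = (1 - 0) * (\<Sum>i\<in>UNIV. (x - y) $ i * P i (y + t *\<^sub>R (x - y)))"
      by (rule MVT2[OF _ u']) simp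
    then obtain t where t: "u x - u y = (\<Sum>i\<in>UNIV. (x - y) $ i * P i (y + t *\<^sub>R (x - y)))" by auto
    have "\<bar>u x - u y\<bar> \<le> (\<Sum>i\<in>UNIV. \<bar>(x - y) $ i * P i (y + t *\<^sub>R (x - y))\<bar>)"
      unfolding t by (rule sum_abs)
    also have "\<dots> \<le> (\<Sum>i\<in>UNIV. norm (x - y) * B i)"
      unfolding abs_mult by (intro sum_mono mult_mono component_le_norm_cart B) auto
    finally show ?thesis by (simp add: sum_distrib_right mult.commute)
  qed
  show ?thesis by (rule that[OF u' P' K0 K L])
qed

section \<open>Taylor remainder of the symmetrised function\<close>

text \<open>The symmetrised increment of \<open>u\<close> minus its Taylor polynomial of order 2 at
  \<xi> = 0. Gradient and mixed terms have cancelled, so that polynomial contains the pure second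
  derivatives only.\<close>

definition taylor_remainder ::
    "(real ^ 'n::finite \<Rightarrow> real) \<Rightarrow> ('n \<Rightarrow> 'n \<Rightarrow> real ^ 'n \<Rightarrow> real) \<Rightarrow> real ^ 'n \<Rightarrow> real ^ 'n \<Rightarrow> real" where
  "taylor_remainder u Q x \<xi> = (\<Sum>s\<in>signs. u (x + s * \<xi>)) - 2 ^ CARD('n) * u x
     - 2 ^ CARD('n) / 2 * (\<Sum>i\<in>UNIV. Q i i x * (\<xi> $ i)\<^sup>2)"

text \<open>Averaging a bilinear form over the sign patterns leaves its diagonal.\<close>

lemma sum_signs_quadratic:
  fixes v w :: "real ^ 'n::finite"
  shows "(\<Sum>s\<in>signs. \<Sum>i\<in>UNIV. \<Sum>j\<in>UNIV. (s * v) $ i * ((s * w) $ j * q i j))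
    = 2 ^ CARD('n) * (\<Sum>i\<in>UNIV. q i i * (v $ i * w $ i))"
proof -
  have "(\<Sum>s\<in>signs. \<Sum>i\<in>UNIV. \<Sum>j\<in>UNIV. (s * v) $ i * ((s * w) $ j * q i j))
    = (\<Sum>i\<in>UNIV. \<Sum>j\<in>UNIV. \<Sum>s\<in>signs. (s * v) $ i * ((s * w) $ j * q i j))"
    by (subst sum.swap, intro sum.cong refl, subst sum.swap, rule refl)
  also have "\<dots> = (\<Sum>i\<in>UNIV. \<Sum>j\<in>UNIV. (v $ i * w $ j * q i j) * (\<Sum>s\<in>(signs :: (real ^ 'n) set). s $ i * s $ j))"
    by (intro sum.cong refl) (simp add: sum_distrib_left mult_ac)
  also have "\<dots> = (\<Sum>i\<in>UNIV. \<Sum>j\<in>UNIV. if i = j then (v $ i * w $ j * q i j) * 2 ^ CARD('n) else 0)"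
    by (intro sum.cong refl) (simp add: sum_signs_component2)
  also have "\<dots> = 2 ^ CARD('n) * (\<Sum>i\<in>UNIV. q i i * (v $ i * w $ i))"
    by (simp add: sum_distrib_left mult_ac)
  finally show ?thesis .
qed

lemma sum_component_mult_le:
  fixes v :: "real ^ 'n::finite"
  assumes "\<And>i. \<bar>q i\<bar> \<le> c"
  shows "\<bar>\<Sum>i\<in>UNIV. v $ i * q i\<bar> \<le> real CARD('n) * norm v * c"
proof -
  have "\<bar>\<Sum>i\<in>UNIV. v $ i * q i\<bar> \<le> (\<Sum>i\<in>UNIV. \<bar>v $ i * q i\<bar>)" by (rule sum_abs)
  also have "\<dots> \<le> (\<Sum>i\<in>(UNIV::'n set). norm v * c)"
    unfolding abs_mult by (intro sum_mono mult_mono component_le_norm_cart assms) auto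
  finally show ?thesis by simp
qed

text \<open>\<open>R1\<close> and \<open>R2\<close> are the first and second directional derivatives
  of the remainder. Moving the subtracted polynomial inside the sum over signs turns them into first
  order Taylor errors of \<open>P\<close> and increments of \<open>Q\<close>, of order |\<xi>|^(1+s)
  and |\<xi>|^s. The conclusions then follow by the mean value theorem. \<open>K2\<close> accounts
  for 2^d sign patterns and two sums over d coordinates.\<close>

lemma taylor_remainder_bounds:
  fixes u :: "real ^ 'n::finite \<Rightarrow> real"
  assumes u': "\<And>x v t. ((\<lambda>t. u (x + t *\<^sub>R v)) has_real_derivative (\<Sum>i\<in>UNIV. v $ i * P i (x + t *\<^sub>R v))) (at t)"
    and P': "\<And>i x v t. ((\<lambda>t. P i (x + t *\<^sub>R v)) has_real_derivative (\<Sum>j\<in>UNIV. v $ j * Q i j (x + t *\<^sub>R v))) (at t)"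
    and K0: "0 \<le> K" and K: "\<And>i j x y. \<bar>Q i j x - Q i j y\<bar> \<le> K * norm (x - y) powr s"
    and s: "0 < s"
  defines "K2 \<equiv> 2 ^ CARD('n) * (real CARD('n))\<^sup>2 * K"
  shows "\<bar>taylor_remainder u Q x \<xi>\<bar> \<le> K2 * norm \<xi> powr (2 + s)"
    and "norm \<xi> \<le> M \<Longrightarrow> norm \<eta> \<le> M \<Longrightarrow>
      \<bar>taylor_remainder u Q x \<xi> - taylor_remainder u Q x \<eta>\<bar> \<le> K2 * M powr (1 + s) * norm (\<xi> - \<eta>)"
    and "norm (c + v) \<le> M \<Longrightarrow> norm (c - v) \<le> M \<Longrightarrow>
      \<bar>taylor_remainder u Q x (c + v) + taylor_remainder u Q x (c - v) - 2 * taylor_remainder u Q x c\<bar>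
        \<le> 2 * K2 * M powr s * (norm v)\<^sup>2"
proof -
  let ?d = "real CARD('n)"
  define R1 where "R1 \<xi> v = (\<Sum>e\<in>signs. \<Sum>i\<in>UNIV. (e * v) $ i * P i (x + e * \<xi>))
      - 2 ^ CARD('n) * (\<Sum>i\<in>UNIV. Q i i x * (\<xi> $ i * v $ i))" for \<xi> v :: "real ^ 'n"
  define R2 where "R2 \<xi> v = (\<Sum>e\<in>signs. \<Sum>i\<in>UNIV. (e * v) $ i * (\<Sum>j\<in>UNIV. (e * v) $ j * Q i j (x + e * \<xi>)))
      - 2 ^ CARD('n) * (\<Sum>i\<in>UNIV. Q i i x * (v $ i * v $ i))" for \<xi> v :: "real ^ 'n"
  have line: "x + e * (y + t *\<^sub>R v) = (x + e * y) + t *\<^sub>R (e * v)" for e y v :: "real ^ 'n" and t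
    by (simp add: vec_eq_iff algebra_simps)
  have comp: "((\<lambda>t. (y + t *\<^sub>R v) $ i) has_real_derivative v $ i) (at t)" for y v :: "real ^ 'n" and i t
    by (auto intro!: derivative_eq_intros)
  have D1: "((\<lambda>t. taylor_remainder u Q x (y + t *\<^sub>R v)) has_real_derivative R1 (y + t *\<^sub>R v) v) (at t)" for y v t
    unfolding taylor_remainder_def R1_def line
    by (rule comp u' derivative_eq_intros refl)+
      (simp add: sum_distrib_left mult_ac, intro sum.cong refl, simp add: field_simps)
  have D2: "((\<lambda>t. R1 (y + t *\<^sub>R v) w) has_real_derivative
      (\<Sum>e\<in>signs. \<Sum>i\<in>UNIV. (e * w) $ i * (\<Sum>j\<in>UNIV. (e * v) $ j * Q i j (x + e * (y + t *\<^sub>R v))))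
      - 2 ^ CARD('n) * (\<Sum>i\<in>UNIV. Q i i x * (v $ i * w $ i))) (at t)" for y v w t
    unfolding R1_def line
    by (rule comp P' derivative_eq_intros refl)+ (simp add: mult_ac)
  have b0: "\<bar>P i (x + z) - P i x - (\<Sum>j\<in>UNIV. z $ j * Q i j x)\<bar> \<le> ?d * norm z * (K * norm z powr s)" for i z
  proof -
    have "\<exists>t. 0 < t \<and> t < 1 \<and> P i (x + 1 *\<^sub>R z) - P i (x + 0 *\<^sub>R z) = (1 - 0) * (\<Sum>j\<in>UNIV. z $ j * Q i j (x + t *\<^sub>R z))"
      by (rule MVT2[OF _ P']) simp
    then obtain t where t: "0 < t" "t < 1" "P i (x + z) - P i x = (\<Sum>j\<in>UNIV. z $ j * Q i j (x + t *\<^sub>R z))" by auto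
    have "P i (x + z) - P i x - (\<Sum>j\<in>UNIV. z $ j * Q i j x) = (\<Sum>j\<in>UNIV. z $ j * (Q i j (x + t *\<^sub>R z) - Q i j x))"
      unfolding t(3) by (simp add: right_diff_distrib sum_subtractf)
    also have "\<bar>\<dots>\<bar> \<le> ?d * norm z * (K * norm z powr s)"
    proof (rule sum_component_mult_le)
      fix j
      have "norm (t *\<^sub>R z) \<le> norm z" using t by (simp add: mult_left_le_one_le)
      then have "K * norm (t *\<^sub>R z) powr s \<le> K * norm z powr s"
        using K0 s by (intro mult_left_mono powr_mono2) auto
      then show "\<bar>Q i j (x + t *\<^sub>R z) - Q i j x\<bar> \<le> K * norm z powr s"
        using K[of i j "x + t *\<^sub>R z" x] by (simp del: norm_scaleR)
    qed
    finally show ?thesis .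
  qed
  have b1: "\<bar>R1 \<xi> v\<bar> \<le> K2 * norm \<xi> powr (1 + s) * norm v" for \<xi> v
  proof -
    have "(\<Sum>e\<in>signs. \<Sum>i\<in>UNIV. (e * v) $ i * P i x) = (\<Sum>i\<in>UNIV. \<Sum>e\<in>signs. (e * v) $ i * P i x)"
      by (rule sum.swap)
    also have "\<dots> = (\<Sum>i\<in>UNIV. (v $ i * P i x) * (\<Sum>e\<in>(signs :: (real ^ 'n) set). e $ i))"
      by (intro sum.cong refl) (simp add: sum_distrib_left mult_ac)
    also have "\<dots> = 0" by (simp add: sum_signs_component)
    finally have z: "(\<Sum>e\<in>signs. \<Sum>i\<in>UNIV. (e * v) $ i * P i x) = 0" .
    \<comment> \<open>The gradient term may be inserted because it sums to 0, and
      \<open>sum_signs_quadratic\<close> distributes the quadratic term, so that every sign pattern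
      receives its own affine approximation of \<open>P\<close>.\<close>
    have "R1 \<xi> v = (\<Sum>e\<in>signs. \<Sum>i\<in>UNIV. (e * v) $ i * P i (x + e * \<xi>))
       - (\<Sum>e\<in>signs. \<Sum>i\<in>UNIV. (e * v) $ i * P i x)
       - (\<Sum>e\<in>signs. \<Sum>i\<in>UNIV. \<Sum>j\<in>UNIV. (e * v) $ i * ((e * \<xi>) $ j * Q i j x))"
      unfolding z sum_signs_quadratic R1_def by (simp add: mult_ac)
    also have "\<dots> = (\<Sum>e\<in>signs. \<Sum>i\<in>UNIV. (e * v) $ i *
         (P i (x + e * \<xi>) - P i x - (\<Sum>j\<in>UNIV. (e * \<xi>) $ j * Q i j x)))"
      by (simp only: right_diff_distrib sum_subtractf sum_distrib_left)
    also have "\<bar>\<dots>\<bar> \<le> (\<Sum>e\<in>(signs :: (real ^ 'n) set). ?d * norm v * (?d * norm \<xi> * (K * norm \<xi> powr s)))"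
    proof (rule order_trans[OF sum_abs], rule sum_mono)
      fix e :: "real ^ 'n" assume e: "e \<in> signs"
      have "\<bar>P i (x + e * \<xi>) - P i x - (\<Sum>j\<in>UNIV. (e * \<xi>) $ j * Q i j x)\<bar> \<le> ?d * norm \<xi> * (K * norm \<xi> powr s)" for i
        using b0[of i "e * \<xi>"] e by simp
      from sum_component_mult_le[OF this, of "e * v"] e
      show "\<bar>\<Sum>i\<in>UNIV. (e * v) $ i * (P i (x + e * \<xi>) - P i x - (\<Sum>j\<in>UNIV. (e * \<xi>) $ j * Q i j x))\<bar>
        \<le> ?d * norm v * (?d * norm \<xi> * (K * norm \<xi> powr s))" by simp
    qed
    also have "\<dots> = K2 * norm \<xi> powr (1 + s) * norm v"
      by (simp add: card_signs K2_def powr_add power2_eq_square)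
    finally show ?thesis .
  qed
  have b2: "\<bar>R2 \<xi> v\<bar> \<le> K2 * norm \<xi> powr s * (norm v)\<^sup>2" for \<xi> v
  proof -
    have "R2 \<xi> v = (\<Sum>e\<in>signs. \<Sum>i\<in>UNIV. (e * v) $ i * (\<Sum>j\<in>UNIV. (e * v) $ j * Q i j (x + e * \<xi>)))
       - (\<Sum>e\<in>signs. \<Sum>i\<in>UNIV. \<Sum>j\<in>UNIV. (e * v) $ i * ((e * v) $ j * Q i j x))"
      unfolding sum_signs_quadratic R2_def by (simp add: mult_ac)
    also have "\<dots> = (\<Sum>e\<in>signs. \<Sum>i\<in>UNIV. (e * v) $ i * (\<Sum>j\<in>UNIV. (e * v) $ j * (Q i j (x + e * \<xi>) - Q i j x)))"
      by (simp only: right_diff_distrib sum_subtractf sum_distrib_left)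
    also have "\<bar>\<dots>\<bar> \<le> (\<Sum>e\<in>(signs :: (real ^ 'n) set). ?d * norm v * (?d * norm v * (K * norm \<xi> powr s)))"
    proof (rule order_trans[OF sum_abs], rule sum_mono)
      fix e :: "real ^ 'n" assume e: "e \<in> signs"
      have "\<bar>Q i j (x + e * \<xi>) - Q i j x\<bar> \<le> K * norm \<xi> powr s" for i j
        using K[of i j "x + e * \<xi>" x] e by simp
      then have "\<bar>\<Sum>j\<in>UNIV. (e * v) $ j * (Q i j (x + e * \<xi>) - Q i j x)\<bar> \<le> ?d * norm (e * v) * (K * norm \<xi> powr s)" for i
        by (rule sum_component_mult_le)
      from sum_component_mult_le[OF this, of "e * v"] e
      show "\<bar>\<Sum>i\<in>UNIV. (e * v) $ i * (\<Sum>j\<in>UNIV. (e * v) $ j * (Q i j (x + e * \<xi>) - Q i j x))\<bar>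
        \<le> ?d * norm v * (?d * norm v * (K * norm \<xi> powr s))" by simp
    qed
    also have "\<dots> = K2 * norm \<xi> powr s * (norm v)\<^sup>2"
      by (simp add: card_signs K2_def power2_eq_square)
    finally show ?thesis .
  qed
  have K2: "0 \<le> K2" using K0 by (simp add: K2_def)
  let ?r = "taylor_remainder u Q x"
  have convex: "norm (y + t *\<^sub>R (z - y)) \<le> M" if "norm y \<le> M" "norm z \<le> M" "0 \<le> t" "t \<le> 1" for y z :: "real ^ 'n" and t M
  proof -
    have "y + t *\<^sub>R (z - y) = (1 - t) *\<^sub>R y + t *\<^sub>R z" by (simp add: algebra_simps)
    also have "norm \<dots> \<le> (1 - t) * norm y + t * norm z"
      using norm_triangle_ineq[of "(1 - t) *\<^sub>R y" "t *\<^sub>R z"] that by simp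
    also have "\<dots> \<le> M" using that by (intro convex_bound_le) auto
    finally show ?thesis .
  qed
  have lip: "\<bar>?r \<xi> - ?r \<eta>\<bar> \<le> K2 * M powr (1 + s) * norm (\<xi> - \<eta>)" if "norm \<xi> \<le> M" "norm \<eta> \<le> M" for \<xi> \<eta> M
  proof -
    have "\<exists>t. 0 < t \<and> t < 1 \<and> ?r (\<eta> + 1 *\<^sub>R (\<xi> - \<eta>)) - ?r (\<eta> + 0 *\<^sub>R (\<xi> - \<eta>)) = (1 - 0) * R1 (\<eta> + t *\<^sub>R (\<xi> - \<eta>)) (\<xi> - \<eta>)"
      by (rule MVT2[OF _ D1]) simp
    then obtain t where t: "0 < t" "t < 1" "?r \<xi> - ?r \<eta> = R1 (\<eta> + t *\<^sub>R (\<xi> - \<eta>)) (\<xi> - \<eta>)" by auto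
    have "norm (\<eta> + t *\<^sub>R (\<xi> - \<eta>)) \<le> M" using convex[OF that(2,1)] t by simp
    then show ?thesis unfolding t(3)
      using s K2 by (intro order_trans[OF b1] mult_right_mono mult_left_mono powr_mono2) auto
  qed
  then show "norm \<xi> \<le> M \<Longrightarrow> norm \<eta> \<le> M \<Longrightarrow> \<bar>?r \<xi> - ?r \<eta>\<bar> \<le> K2 * M powr (1 + s) * norm (\<xi> - \<eta>)" .
  have "?r 0 = 0" by (simp add: taylor_remainder_def card_signs times_vec_def zero_vec_def[symmetric])
  then show "\<bar>?r \<xi>\<bar> \<le> K2 * norm \<xi> powr (2 + s)"
    using lip[of \<xi> "norm \<xi>" 0] powr_add[of "norm \<xi>" 1 "1 + s"] by (simp add: mult_ac add_ac)
  assume M: "norm (c + v) \<le> M" "norm (c - v) \<le> M"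
  \<comment> \<open>The second difference is an increment of \<open>?g\<close>. One mean value
    theorem leaves a difference of \<open>R1\<close> between two points symmetric about
    \<open>c\<close>; a second one, on the segment joining them, turns it into
    \<open>R2\<close>.\<close>
  let ?g = "\<lambda>t. ?r (c + t *\<^sub>R v) + ?r (c + t *\<^sub>R (- v))"
  have "\<exists>t. 0 < t \<and> t < 1 \<and> ?g 1 - ?g 0 = (1 - 0) * (R1 (c + t *\<^sub>R v) v + R1 (c + t *\<^sub>R (- v)) (- v))"
    by (rule MVT2) (auto intro!: DERIV_add D1 simp del: scaleR_minus_right)
  then obtain t where t: "0 < t" "t < 1"
      "?r (c + v) + ?r (c - v) - 2 * ?r c = R1 (c + t *\<^sub>R v) v + R1 (c + t *\<^sub>R (- v)) (- v)" by auto
  have neg: "R1 \<xi> (- v) = - R1 \<xi> v" for \<xi>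
    by (simp add: R1_def sum_negf)
  have "\<exists>\<tau>. - t < \<tau> \<and> \<tau> < t \<and> R1 (c + t *\<^sub>R v) v - R1 (c + (- t) *\<^sub>R v) v = (t - (- t)) * R2 (c + \<tau> *\<^sub>R v) v"
    unfolding R2_def by (rule MVT2[OF _ D2]) (use t in auto)
  then obtain \<tau> where \<tau>: "- t < \<tau>" "\<tau> < t" "R1 (c + t *\<^sub>R v) v - R1 (c + (- t) *\<^sub>R v) v = 2 * t * R2 (c + \<tau> *\<^sub>R v) v"
    by auto
  have eq: "?r (c + v) + ?r (c - v) - 2 * ?r c = 2 * t * R2 (c + \<tau> *\<^sub>R v) v"
    unfolding t(3) neg using \<tau>(3) by simp
  \<comment> \<open>Written as a convex combination of \<open>c - v\<close> and
    \<open>c + v\<close>, the two points whose norms are assumed to be at most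
    \<open>M\<close>.\<close>
  have e: "c + \<tau> *\<^sub>R v = (c - v) + ((\<tau> + 1) / 2) *\<^sub>R ((c + v) - (c - v))"
    by (simp add: vec_eq_iff field_simps)
  have "norm (c + \<tau> *\<^sub>R v) \<le> M"
    unfolding e by (rule convex[OF M(2,1)]) (use \<tau> t in auto)
  then have "\<bar>R2 (c + \<tau> *\<^sub>R v) v\<bar> \<le> K2 * M powr s * (norm v)\<^sup>2"
    using s K2 by (intro order_trans[OF b2] mult_right_mono mult_left_mono powr_mono2) auto
  then have "2 * t * \<bar>R2 (c + \<tau> *\<^sub>R v) v\<bar> \<le> 2 * 1 * (K2 * M powr s * (norm v)\<^sup>2)"
    using t by (intro mult_mono) auto
  then show "\<bar>?r (c + v) + ?r (c - v) - 2 * ?r c\<bar> \<le> 2 * K2 * M powr s * (norm v)\<^sup>2"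
    unfolding eq using t by (simp add: abs_mult)
qed

section \<open>The mesh elements\<close>

text \<open>Extends the estimate to positive exponents: the positive part of p is estimated by its
  maximum, as |\<xi>| \<le> d R on the cube, and the negative part is integrated as before.\<close>

lemma nn_integral_norm_powr_cube':
  fixes p R :: real
  assumes "0 \<le> R" "- real CARD('n) < p"
  shows "(\<integral>\<^sup>+\<xi>. ennreal (norm \<xi> powr p) * indicator {\<xi>. \<forall>i. \<bar>\<xi> $ i\<bar> \<le> R} \<xi>
      \<partial>(lborel :: (real ^ 'n::finite) measure))
    \<le> ennreal ((real CARD('n) powr (p - min p 0) * (2 / (min p 0 / real CARD('n) + 1)) ^ CARD('n))
        * R powr (real CARD('n) + p))"
proof (cases "R = 0")
  case True
  have "(\<integral>\<^sup>+\<xi>. ennreal (norm \<xi> powr p) * indicator {\<xi>. \<forall>i. \<bar>\<xi> $ i\<bar> \<le> R} \<xi> \<partial>(lborel :: (real ^ 'n) measure)) = 0"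
  proof -
    have "ennreal (norm \<xi> powr p) * indicator {\<xi>. \<forall>i. \<bar>\<xi> $ i\<bar> \<le> R} \<xi> = 0" for \<xi> :: "real ^ 'n"
    proof (cases "\<forall>i. \<bar>\<xi> $ i\<bar> \<le> R")
      case True
      then have "\<xi> = 0" using \<open>R = 0\<close> by (simp add: vec_eq_iff)
      then show ?thesis by simp
    qed simp
    then show ?thesis by (simp only: nn_integral_const mult_zero_left)
  qed
  then show ?thesis by simp
next
  case False
  let ?M = "lborel :: (real ^ 'n) measure" and ?S = "{\<xi> :: real ^ 'n. \<forall>i. \<bar>\<xi> $ i\<bar> \<le> R}"
  let ?d = "real CARD('n)"
  let ?p' = "min p 0"
  have R: "R > 0" using False assms by simp
  have "(\<integral>\<^sup>+\<xi>. ennreal (norm \<xi> powr p) * indicator ?S \<xi> \<partial>?M)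
    \<le> (\<integral>\<^sup>+\<xi>. ennreal ((?d * R) powr (p - ?p')) * (ennreal (norm \<xi> powr ?p') * indicator ?S \<xi>)
      \<partial>?M)"
  proof (rule nn_integral_mono)
    fix \<xi> :: "real ^ 'n"
    show "ennreal (norm \<xi> powr p) * indicator ?S \<xi>
      \<le> ennreal ((?d * R) powr (p - ?p')) * (ennreal (norm \<xi> powr ?p') * indicator ?S \<xi>)"
    proof (cases "\<forall>i. \<bar>\<xi> $ i\<bar> \<le> R")
      case True
      have "norm \<xi> \<le> (\<Sum>i\<in>UNIV. \<bar>\<xi> $ i\<bar>)" by (rule norm_le_l1_cart)
      also have "\<dots> \<le> ?d * R" using True by (simp add: sum_bounded_above)
      finally have "norm \<xi> powr (p - ?p') \<le> (?d * R) powr (p - ?p')"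
        by (intro powr_mono2) auto
      then have "norm \<xi> powr (p - ?p') * norm \<xi> powr ?p' \<le> (?d * R) powr (p - ?p') * norm \<xi> powr ?p'"
        by (rule mult_right_mono) simp
      then have "norm \<xi> powr p \<le> (?d * R) powr (p - ?p') * norm \<xi> powr ?p'"
        by (simp add: powr_add[symmetric])
      then show ?thesis using True by (simp add: ennreal_mult[symmetric] ennreal_leI)
    qed simp
  qed
  also have "\<dots> = ennreal ((?d * R) powr (p - ?p')) * (\<integral>\<^sup>+\<xi>. ennreal (norm \<xi> powr ?p') * indicator ?S \<xi>
      \<partial>?M)"
    by (rule nn_integral_cmult) measurable
  also have "\<dots> \<le> ennreal ((?d * R) powr (p - ?p')) * ennreal ((2 / (?p' / ?d + 1)) ^ CARD('n) * R powr (?d + ?p'))"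
    using assms by (intro mult_left_mono nn_integral_norm_powr_cube) auto
  also have "\<dots> = ennreal ((?d * R) powr (p - ?p') * ((2 / (?p' / ?d + 1)) ^ CARD('n) * R powr (?d + ?p')))"
    by (rule ennreal_mult'[symmetric]) simp
  also have "(?d * R) powr (p - ?p') * ((2 / (?p' / ?d + 1)) ^ CARD('n) * R powr (?d + ?p'))
      = (?d powr (p - ?p') * (2 / (?p' / ?d + 1)) ^ CARD('n)) * (R powr (p - ?p') * R powr (?d + ?p'))"
    using R by (subst powr_mult) (simp_all only: mult_ac of_nat_0_le_iff less_imp_le)
  also have "R powr (p - ?p') * R powr (?d + ?p') = R powr (?d + p)"
    by (simp add: powr_add[symmetric] add.commute)
  finally show ?thesis .
qed

lemma
  fixes p R :: real
  assumes "0 \<le> R" "- real CARD('n) < p" and A: "A \<subseteq> {\<xi>. \<forall>i. \<bar>\<xi> $ i\<bar> \<le> R}" "A \<in> sets borel"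
  shows set_integrable_norm_powr: "set_integrable lborel A (\<lambda>\<xi>::real ^ 'n::finite. norm \<xi> powr p)"
    and set_integral_norm_powr_le: "(LINT \<xi>:A|lborel. norm (\<xi> :: real ^ 'n::finite) powr p) \<le>
      (real CARD('n) powr (p - min p 0) * (2 / (min p 0 / real CARD('n) + 1)) ^ CARD('n)) * R powr (real CARD('n) + p)"
      (is "_ \<le> ?C")
proof -
  have C: "0 \<le> ?C" using assms(2)
    by (intro mult_nonneg_nonneg zero_le_power divide_nonneg_nonneg) (auto simp: min_def field_simps)
  have [measurable]: "A \<in> sets borel" by (rule A)
  have "(\<integral>\<^sup>+\<xi>. ennreal (indicator A \<xi> *\<^sub>R norm \<xi> powr p) \<partial>lborel)
     \<le> (\<integral>\<^sup>+\<xi>. ennreal (norm \<xi> powr p) * indicator {\<xi>. \<forall>i. \<bar>\<xi> $ i\<bar> \<le> R} \<xi> \<partial>(lborel :: (real ^ 'n) measure))"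
    using A by (intro nn_integral_mono) (auto simp: indicator_def)
  also have "\<dots> \<le> ennreal ?C" by (rule nn_integral_norm_powr_cube'[OF assms(1,2)])
  finally have le: "(\<integral>\<^sup>+\<xi>. ennreal (indicator A \<xi> *\<^sub>R norm \<xi> powr p) \<partial>(lborel :: (real ^ 'n) measure)) \<le> ennreal ?C" .
  show "set_integrable lborel A (\<lambda>\<xi>::real ^ 'n. norm \<xi> powr p)"
    unfolding set_integrable_def
  proof (rule integrableI_nonneg)
    show "(\<integral>\<^sup>+\<xi>. ennreal (indicator A \<xi> *\<^sub>R norm \<xi> powr p) \<partial>(lborel :: (real ^ 'n) measure)) < \<infinity>"
      using le by (rule order_le_less_trans) simp
  qed (auto intro!: AE_I2)
  show "(LINT \<xi>:A|lborel. norm (\<xi> :: real ^ 'n) powr p) \<le> ?C"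
    unfolding set_lebesgue_integral_def
    by (rule integral_real_bounded[OF C le])
qed

text \<open>Also true of a non-integrable \<open>f\<close>: its integral is 0 by convention, while
  \<open>g\<close> is nonnegative on \<open>A\<close>.\<close>

lemma set_integral_abs_le:
  fixes f g :: "'a \<Rightarrow> real"
  assumes "set_integrable M A g" "\<And>x. x \<in> A \<Longrightarrow> \<bar>f x\<bar> \<le> g x"
  shows "\<bar>LINT x:A|M. f x\<bar> \<le> (LINT x:A|M. g x)"
proof -
  have "norm (\<integral>x. indicator A x *\<^sub>R f x \<partial>M) \<le> (\<integral>x. norm (indicator A x *\<^sub>R f x) \<partial>M)"
    by (rule integral_norm_bound)
  also have "\<dots> \<le> (\<integral>x. indicator A x *\<^sub>R g x \<partial>M)"
    using assms by (intro integral_mono') (auto simp: set_integrable_def indicator_def intro: order_trans[OF abs_ge_zero])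
  finally have "norm (\<integral>x. indicator A x *\<^sub>R f x \<partial>M) \<le> (\<integral>x. indicator A x *\<^sub>R g x \<partial>M)" .
  then show ?thesis by (simp add: set_lebesgue_integral_def)
qed

lemma mem_element: "\<xi> \<in> element h k \<longleftrightarrow> (\<forall>i. real (k $ i) * h \<le> \<xi> $ i \<and> \<xi> $ i \<le> (real (k $ i) + 1) * h)"
  by (auto simp: element_def mem_box_cart)

lemma element_borel [measurable]: "element h k \<in> sets borel"
  by (simp add: element_def)

lemma emeasure_element:
  assumes "0 \<le> h"
  shows "emeasure lborel (element h k :: (real ^ 'n::finite) set) = ennreal (h ^ CARD('n))"
proof -
  have "emeasure lborel (element h k :: (real ^ 'n) set) = emeasure lborel (box (\<chi> i. real (k $ i) * h) (\<chi> i. (real (k $ i) + 1) * h) :: (real ^ 'n) set)"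
    unfolding element_def by (simp add: emeasure_lborel_cbox_eq emeasure_lborel_box_eq)
  also have "\<dots> = ennreal (h ^ CARD('n))"
    using assms by (subst emeasure_lborel_box_cart) (auto simp: algebra_simps prod_constant)
  finally show ?thesis .
qed

lemma set_integrable_const_element:
  "0 \<le> h \<Longrightarrow> set_integrable lborel (element h k :: (real ^ 'n::finite) set) (\<lambda>_. c :: real)"
  unfolding set_integrable_def by (intro integrable_scaleR_left) (auto simp: emeasure_element)

lemma set_integral_const_element:
  "0 \<le> h \<Longrightarrow> (LINT \<xi>:(element h k :: (real ^ 'n::finite) set)|lborel. c) = (c :: real) * h ^ CARD('n)"
  by (subst set_integral_const) (auto simp: emeasure_element measure_def)

lemma norm_diff_element:
  fixes \<xi> \<eta> :: "real ^ 'n::finite"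
  assumes "\<xi> \<in> element h k" "\<eta> \<in> element h k"
  shows "norm (\<xi> - \<eta>) \<le> real CARD('n) * h"
proof -
  have "norm (\<xi> - \<eta>) \<le> (\<Sum>i\<in>UNIV. \<bar>(\<xi> - \<eta>) $ i\<bar>)" by (rule norm_le_l1_cart)
  also have "\<dots> \<le> (\<Sum>i\<in>(UNIV :: 'n set). h)"
  proof (rule sum_mono)
    fix i
    have "real (k $ i) * h \<le> \<xi> $ i" "\<xi> $ i \<le> (real (k $ i) + 1) * h"
      "real (k $ i) * h \<le> \<eta> $ i" "\<eta> $ i \<le> (real (k $ i) + 1) * h"
      using assms by (auto simp: mem_element)
    then show "\<bar>(\<xi> - \<eta>) $ i\<bar> \<le> h" by (auto simp: algebra_simps abs_le_iff)
  qed
  finally show ?thesis by simp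
qed

lemma grid_point_mem_element:
  "0 \<le> h \<Longrightarrow> n \<in> index_cube 2 \<Longrightarrow> grid_point h (k + n) \<in> element h k"
proof -
  assume h: "0 \<le> h" and n: "n \<in> index_cube 2"
  have n1: "n $ i \<le> 1" for i using n by (auto simp: index_cube_def less_Suc_eq_le numeral_2_eq_2)
  have "h * real (k $ i) \<le> h * real (k $ i + n $ i)" "h * real (k $ i + n $ i) \<le> h * (real (k $ i) + 1)" for i
    using h n1[of i] by (intro mult_left_mono; simp)+
  then show ?thesis by (auto simp: mem_element mult.commute)
qed

lemma norm_element_ge:
  fixes \<xi> :: "real ^ 'n::finite"
  assumes "0 \<le> h" "\<xi> \<in> element h k"
  shows "norm (grid_point h k :: real ^ 'n) \<le> norm \<xi>"
proof (rule norm_le_componentwise_cart)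
  fix i
  have "0 \<le> h * real (k $ i)" using assms(1) by simp
  moreover have "h * real (k $ i) \<le> \<xi> $ i" using assms(2) by (auto simp: mem_element mult.commute)
  ultimately show "norm (grid_point h k $ i) \<le> norm (\<xi> $ i)" by simp
qed

lemma norm_grid_point_ge:
  assumes "0 \<le> h" "k \<noteq> 0"
  shows "h \<le> norm (grid_point h k :: real ^ 'n::finite)"
  using mult_left_mono[OF norm_grid_point_ge1[OF assms(2)] assms(1)] norm_grid_point[OF assms(1), of k]
  by simp

text \<open>An element has diameter at most d h, and \<open>k \<noteq> 0\<close> makes h at most the
  norm of the corner. With \<open>norm_element_ge\<close> the norm is thus comparable on the whole
  element to its value at the corner, and powers of it may be evaluated there.\<close>

lemma norm_element_le:
  fixes \<xi> :: "real ^ 'n::finite"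
  assumes h: "0 \<le> h" and \<xi>: "\<xi> \<in> element h k" and k: "k \<noteq> 0"
  shows "norm \<xi> \<le> (1 + real CARD('n)) * norm (grid_point h k :: real ^ 'n)"
proof -
  have "grid_point h (k + 0) \<in> (element h k :: (real ^ 'n) set)"
    by (rule grid_point_mem_element[OF h]) (simp add: index_cube_def)
  then have "norm (\<xi> - grid_point h k) \<le> real CARD('n) * h"
    using norm_diff_element[OF \<xi>] by simp
  also have "\<dots> \<le> real CARD('n) * norm (grid_point h k :: real ^ 'n)"
    using norm_grid_point_ge[OF h k] by (intro mult_left_mono) auto
  finally show ?thesis
    using norm_triangle_sub[of \<xi> "grid_point h k"] by (simp add: algebra_simps)
qed

lemma element_0_subset: "element h 0 \<subseteq> {\<xi> :: real ^ 'n::finite. \<forall>i. \<bar>\<xi> $ i\<bar> \<le> h}"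
  by (auto simp: mem_element)

section \<open>Representation of the error\<close>

text \<open>The constant by which the quadrature rule replaces \<open>f\<close> on an element. On
  the first element the corner at the origin, where the quotient \<open>phi\<close> is singular, is
  left out.\<close>

definition corner_mean :: "real \<Rightarrow> real \<Rightarrow> nat ^ 'n::finite \<Rightarrow> (real ^ 'n \<Rightarrow> real) \<Rightarrow> real" where
  "corner_mean \<gamma> h k f = 1 / 2 ^ CARD('n) *
     (if k = 0 then \<Sum>n\<in>index_cube 2 - {0}. corner_coeff \<gamma> n * f (grid_point h n)
      else \<Sum>n\<in>index_cube 2. f (grid_point h (k + n)))"

definition element_error ::
    "real \<Rightarrow> real \<Rightarrow> real \<Rightarrow> real \<Rightarrow> nat ^ 'n::finite \<Rightarrow> (real ^ 'n \<Rightarrow> real) \<Rightarrow> real" where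
  "element_error \<alpha> lam \<gamma> h k f = (LINT \<xi>:element h k|lborel. f \<xi> * weight \<alpha> lam \<gamma> \<xi>)
     - corner_mean \<gamma> h k f * (LINT \<xi>:element h k|lborel. weight \<alpha> lam \<gamma> \<xi>)"

text \<open>Disjointness is asked for only almost everywhere, since it is applied to closed orthants
  and to closed mesh elements.\<close>

lemma set_integral_eq_sum_cover:
  fixes f :: "'a \<Rightarrow> real"
  assumes fin: "finite I" and f: "set_integrable M B f" and A: "\<And>i. i \<in> I \<Longrightarrow> A i \<in> sets M" "\<And>i. i \<in> I \<Longrightarrow> A i \<subseteq> B"
    and ex1: "AE x in M. x \<in> B \<longrightarrow> (\<exists>!i. i \<in> I \<and> x \<in> A i)"
  shows "(LINT x:B|M. f x) = (\<Sum>i\<in>I. LINT x:A i|M. f x)"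
proof -
  have int: "integrable M (\<lambda>x. indicator (A i) x *\<^sub>R f x)" if "i \<in> I" for i
    using set_integrable_subset[OF f A[OF that]] by (simp add: set_integrable_def)
  have "AE x in M. indicator B x *\<^sub>R f x = (\<Sum>i\<in>I. indicator (A i) x *\<^sub>R f x)"
    using ex1
  proof eventually_elim
    fix x assume x: "x \<in> B \<longrightarrow> (\<exists>!i. i \<in> I \<and> x \<in> A i)"
    show "indicator B x *\<^sub>R f x = (\<Sum>i\<in>I. indicator (A i) x *\<^sub>R f x)"
    proof (cases "x \<in> B")
      case True
      then obtain i where i: "i \<in> I" "x \<in> A i" "\<And>j. j \<in> I \<Longrightarrow> x \<in> A j \<Longrightarrow> j = i" using x by blast
      have "(\<Sum>j\<in>I. indicator (A j) x *\<^sub>R f x) = (\<Sum>j\<in>I. if j = i then f x else 0)"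
      proof (rule sum.cong[OF refl])
        fix j assume "j \<in> I"
        then show "indicator (A j) x *\<^sub>R f x = (if j = i then f x else 0)"
          using i(2) i(3)[of j] by (cases "x \<in> A j") auto
      qed
      then show ?thesis using fin i(1) True by simp
    next
      case False
      then have "x \<notin> A i" if "i \<in> I" for i using A(2)[OF that] by blast
      then show ?thesis using False by simp
    qed
  qed
  then have "(LINT x:B|M. f x) = (\<integral>x. (\<Sum>i\<in>I. indicator (A i) x *\<^sub>R f x) \<partial>M)"
    unfolding set_lebesgue_integral_def
    using f int by (intro integral_cong_AE) (auto simp: set_integrable_def)
  also have "\<dots> = (\<Sum>i\<in>I. LINT x:A i|M. f x)"
    unfolding set_lebesgue_integral_def by (rule Bochner_Integration.integral_sum) (rule int)
  finally show ?thesis .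
qed

lemma weight_measurable [measurable]: "weight \<alpha> lam \<gamma> \<in> borel_measurable (borel :: (real ^ 'n::finite) measure)"
  unfolding weight_def by measurable

lemma bij_ident [simp]: "bij (\<lambda>x. x)"
  by (rule bij_id[unfolded id_def])

lemma sign_mult_eq_signed_permutation:
  "s * \<xi> = signed_permutation 0 s id (\<xi> :: real ^ 'n::finite)"
  by (simp add: signed_permutation_def vec_eq_iff)

lemma orthant_borel: "{\<xi> :: real ^ 'n::finite. \<forall>i. 0 \<le> s $ i * \<xi> $ i} \<in> sets borel"
proof -
  have "closed {\<xi> :: real ^ 'n. \<forall>i. 0 \<le> s $ i * \<xi> $ i}"
    by (intro closed_Collect_all closed_Collect_le continuous_intros)
  then show ?thesis by (rule borel_closed)
qed

text \<open>A point without zero coordinates lies in exactly one closed orthant, the one named by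
  its vector of signs, and the reflection with these signs carries that orthant onto the positive
  one.\<close>

lemma integral_eq_orthant:
  fixes F :: "real ^ 'n::finite \<Rightarrow> real"
  assumes F: "integrable lborel F" and [measurable]: "F \<in> borel_measurable borel"
  shows "integrable lborel (\<lambda>\<xi>. \<Sum>s\<in>signs. F (s * \<xi>))"
    and "(\<integral>z. F z \<partial>lborel) = (LINT \<xi>:{\<xi>. \<forall>i. 0 \<le> \<xi> $ i}|lborel. \<Sum>s\<in>signs. F (s * \<xi>))"
proof -
  let ?O = "\<lambda>s::real ^ 'n. {\<xi> :: real ^ 'n. \<forall>i. 0 \<le> s $ i * \<xi> $ i}"
  let ?P = "{\<xi> :: real ^ 'n. \<forall>i. 0 \<le> \<xi> $ i}"
  have P: "?P \<in> sets borel" using orthant_borel[of 1] by simp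
  have int: "integrable lborel (\<lambda>\<xi>. F (s * \<xi>))" if "s \<in> signs" for s
    unfolding sign_mult_eq_signed_permutation
    using that by (subst integrable_signed_permutation) (auto simp: abs_sign F)
  then show "integrable lborel (\<lambda>\<xi>. \<Sum>s\<in>signs. F (s * \<xi>))" by auto
  have "(\<integral>z. F z \<partial>lborel) = (LINT z:UNIV|lborel. F z)" by (simp add: set_lebesgue_integral_def)
  also have "\<dots> = (\<Sum>s\<in>signs. LINT z:?O s|lborel. F z)"
  proof (rule set_integral_eq_sum_cover)
    have "AE z in (lborel :: (real ^ 'n) measure). \<forall>i. z $ i \<noteq> 0"
      by (subst AE_all_countable) (simp add: AE_component_neq)
    then show "AE z in (lborel :: (real ^ 'n) measure). z \<in> UNIV \<longrightarrow> (\<exists>!s. s \<in> signs \<and> z \<in> ?O s)"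
    proof eventually_elim
      fix z :: "real ^ 'n" assume nz: "\<forall>i. z $ i \<noteq> 0"
      show "z \<in> UNIV \<longrightarrow> (\<exists>!s. s \<in> signs \<and> z \<in> ?O s)"
      proof (intro impI ex1I[of _ "\<chi> i. sgn (z $ i)"] conjI)
        show "(\<chi> i. sgn (z $ i)) \<in> signs" using nz by (auto simp: signs_def sgn_if)
        show "z \<in> ?O (\<chi> i. sgn (z $ i))" by (auto simp: sgn_if)
        fix s assume s: "s \<in> signs \<and> z \<in> ?O s"
        show "s = (\<chi> i. sgn (z $ i))"
          unfolding vec_eq_iff
        proof
          fix i
          have "s $ i = 1 \<or> s $ i = -1" "0 \<le> s $ i * z $ i" using s by (auto simp: signs_def)
          then show "s $ i = (\<chi> i. sgn (z $ i)) $ i" using nz[rule_format, of i] by (auto simp: sgn_if)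
        qed
      qed
    qed
  qed (use F orthant_borel in \<open>auto simp: set_integrable_def\<close>)
  also have "\<dots> = (\<Sum>s\<in>signs. LINT \<xi>:?P|lborel. F (s * \<xi>))"
  proof (rule sum.cong[OF refl])
    fix s :: "real ^ 'n" assume s: "s \<in> signs"
    show "(LINT z:?O s|lborel. F z) = (LINT \<xi>:?P|lborel. F (s * \<xi>))"
      unfolding sign_mult_eq_signed_permutation
      using s orthant_borel
    proof (intro set_integral_signed_permutation[symmetric])
      show "signed_permutation 0 s id -` ?O s = ?P"
        using s by (auto simp: signed_permutation_def mult.assoc[symmetric] sign_square)
    qed (auto simp: abs_sign)
  qed
  also have "\<dots> = (LINT \<xi>:?P|lborel. \<Sum>s\<in>signs. F (s * \<xi>))"
    unfolding set_lebesgue_integral_def scaleR_sum_right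
    by (rule Bochner_Integration.integral_sum[symmetric], rule integrable_mult_indicator)
      (use int P in auto)
  finally show "(\<integral>z. F z \<partial>lborel) = (LINT \<xi>:?P|lborel. \<Sum>s\<in>signs. F (s * \<xi>))" .
qed

lemma set_integral_cube_eq_sum_elements:
  fixes f :: "real ^ 'n::finite \<Rightarrow> real"
  assumes h: "0 < h" and f: "set_integrable lborel {\<xi>. \<forall>i. 0 \<le> \<xi> $ i \<and> \<xi> $ i \<le> h * real N} f"
      (is "set_integrable _ ?C _")
  shows "(LINT \<xi>:{\<xi>. \<forall>i. 0 \<le> \<xi> $ i \<and> \<xi> $ i \<le> h * real N}|lborel. f \<xi>)
    = (\<Sum>k\<in>index_cube N. LINT \<xi>:element h k|lborel. f \<xi>)"
proof (rule set_integral_eq_sum_cover[OF finite_index_cube f])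
  fix k :: "nat ^ 'n" assume k: "k \<in> index_cube N"
  show "element h k \<in> sets lborel" by simp
  show "element h k \<subseteq> ?C"
  proof (intro subsetI CollectI allI)
    fix \<xi> :: "real ^ 'n" and i assume "\<xi> \<in> element h k"
    then have x: "real (k $ i) * h \<le> \<xi> $ i" "\<xi> $ i \<le> (real (k $ i) + 1) * h" by (auto simp: mem_element)
    have "Suc (k $ i) \<le> N" using k by (auto simp: index_cube_def Suc_le_eq)
    then have "real (Suc (k $ i)) * h \<le> real N * h" using h by (intro mult_right_mono) (simp_all only: of_nat_mono less_imp_le)
    moreover have "0 \<le> real (k $ i) * h" using h by simp
    moreover have "real (Suc (k $ i)) * h = (real (k $ i) + 1) * h" by simp
    ultimately show "0 \<le> \<xi> $ i \<and> \<xi> $ i \<le> h * real N" using x by (metis mult.commute order_trans)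
  qed
next
  \<comment> \<open>Off the mesh hyperplanes the element is found by rounding down
    \<open>\<xi> $ i / h\<close>. On them neighbouring elements overlap, and on the outer faces
    rounding down would give the index N.\<close>
  have "AE \<xi> in (lborel :: (real ^ 'n) measure). \<forall>i. \<forall>j::nat. \<xi> $ i \<noteq> real j * h"
    by (subst AE_all_countable, intro allI, subst AE_all_countable) (simp add: AE_component_neq)
  then show "AE \<xi> in (lborel :: (real ^ 'n) measure). \<xi> \<in> ?C \<longrightarrow>
      (\<exists>!k. k \<in> index_cube N \<and> \<xi> \<in> element h k)"
  proof eventually_elim
    fix \<xi> :: "real ^ 'n" assume nz: "\<forall>i. \<forall>j::nat. \<xi> $ i \<noteq> real j * h"
    show "\<xi> \<in> ?C \<longrightarrow>
      (\<exists>!k. k \<in> index_cube N \<and> \<xi> \<in> element h k)"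
    proof (intro impI)
      assume \<xi>: "\<xi> \<in> ?C"
      define k :: "nat ^ 'n" where "k = (\<chi> i. nat \<lfloor>\<xi> $ i / h\<rfloor>)"
      have k: "real (k $ i) * h \<le> \<xi> $ i" "\<xi> $ i \<le> (real (k $ i) + 1) * h" for i
      proof -
        have q: "0 \<le> \<xi> $ i / h" using \<xi> h by simp
        then have "real (k $ i) = of_int \<lfloor>\<xi> $ i / h\<rfloor>" by (simp add: k_def)
        then have "real (k $ i) \<le> \<xi> $ i / h" "\<xi> $ i / h \<le> real (k $ i) + 1" by linarith+
        then show "real (k $ i) * h \<le> \<xi> $ i" "\<xi> $ i \<le> (real (k $ i) + 1) * h"
          using h by (auto simp: field_simps)
      qed
      have kN: "k $ i < N" for i
      proof -
        have "real (k $ i) * h \<le> real N * h" using k(1)[of i] \<xi> by (auto simp: mult.commute intro: order_trans)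
        then have "k $ i \<le> N" using h by simp
        moreover have "k $ i \<noteq> N"
        proof
          assume "k $ i = N"
          then have "\<xi> $ i = real N * h" using k(1)[of i] \<xi> by (auto simp: mult.commute intro!: antisym)
          then show False using nz by blast
        qed
        ultimately show ?thesis by simp
      qed
      show "\<exists>!k. k \<in> index_cube N \<and> \<xi> \<in> element h k"
      proof (intro ex1I[of _ k] conjI)
        show "k \<in> index_cube N" using kN by (simp add: index_cube_def)
        show "\<xi> \<in> element h k" using k by (simp add: mem_element)
        fix k' assume k': "k' \<in> index_cube N \<and> \<xi> \<in> element h k'"
        show "k' = k"
          unfolding vec_eq_iff
        proof
          fix i
          have a: "real (k' $ i) * h \<le> \<xi> $ i" "\<xi> $ i \<le> (real (k' $ i) + 1) * h"
            using k' by (auto simp: mem_element)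
          have lt: "\<xi> $ i < (real m + 1) * h" if "\<xi> $ i \<le> (real m + 1) * h" for m
            using that nz[rule_format, of i "Suc m"] by (simp add: algebra_simps less_le)
          have "real (k' $ i) * h < (real (k $ i) + 1) * h" "real (k $ i) * h < (real (k' $ i) + 1) * h"
            using a k[of i] lt by (meson le_less_trans)+
          then show "k' $ i = k $ i" using h by simp
        qed
      qed
    qed
  qed
qed

section \<open>The principal value as an absolutely convergent integral\<close>

lemma tempered_frac_laplacian_eq_integral:
  fixes u :: "real ^ 'n::finite \<Rightarrow> real"
  assumes F: "integrable lborel (\<lambda>z. (u x - u (x + z)) * (exp (- lam * norm z) * norm z powr (- (real CARD('n) + \<alpha>))))"
    and [measurable]: "u \<in> borel_measurable borel"
  shows "tempered_frac_laplacian \<alpha> lam u x = frac_const CARD('n) \<alpha> lam *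
    (\<integral>z. (u x - u (x + z)) * (exp (- lam * norm z) * norm z powr (- (real CARD('n) + \<alpha>))) \<partial>lborel)"
proof -
  let ?F = "\<lambda>z. (u x - u (x + z)) * (exp (- lam * norm z) * norm z powr (- (real CARD('n) + \<alpha>)))"
  let ?J = "\<lambda>y. (u x - u y) / (exp (lam * norm (x - y)) * norm (x - y) powr (real CARD('n) + \<alpha>))"
  have FJ: "?J y = ?F (signed_permutation (- x) 1 id y)" for y
  proof -
    have e: "signed_permutation (- x) 1 id y = y - x"
      by (simp add: signed_permutation_def vec_eq_iff)
    show ?thesis unfolding e
      unfolding powr_minus by (simp add: norm_minus_commute[of y x] exp_minus divide_inverse)
  qed
  have Fm: "?F \<in> borel_measurable borel" by measurable
  have J: "integrable lborel ?J"
    unfolding FJ using F by (subst integrable_signed_permutation) (auto simp: Fm)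
  have IJ: "(\<integral>y. ?J y \<partial>lborel) = (\<integral>z. ?F z \<partial>lborel)"
    unfolding FJ by (rule integral_signed_permutation) (auto simp: Fm)
  have "((\<lambda>\<delta>. LINT y:{y. norm (x - y) > \<delta>}|lborel. ?J y) \<longlongrightarrow> (\<integral>y. ?J y \<partial>lborel)) (at_right 0)"
    \<comment> \<open>With \<delta> = 1/t the limit becomes one at infinity, where dominated
      convergence applies with the absolute value of the full integrand as majorant.\<close>
    unfolding filterlim_at_right_to_top set_lebesgue_integral_def
  proof (rule integral_dominated_convergence_at_top[where w = "\<lambda>y. norm (?J y)"])
    show "\<forall>\<^sub>F t in at_top. AE y in lborel. norm (indicat_real {y. inverse t < norm (x - y)} y *\<^sub>R ?J y) \<le> norm (?J y)"
      by (auto simp: indicator_def)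
    show "AE y in lborel. ((\<lambda>t. indicat_real {y. inverse t < norm (x - y)} y *\<^sub>R ?J y) \<longlongrightarrow> ?J y) at_top"
    proof (rule AE_I2)
      fix y
      show "((\<lambda>t. indicat_real {y. inverse t < norm (x - y)} y *\<^sub>R ?J y) \<longlongrightarrow> ?J y) at_top"
      \<comment> \<open>At \<open>y = x\<close> the truncation never includes the point, but the
        integrand is 0 there.\<close>
      proof (cases "x = y")
        case False
        then have "\<forall>\<^sub>F t in at_top. inverse t < norm (x - y)"
          by (intro order_tendstoD(2)[OF tendsto_inverse_0_at_top[OF filterlim_ident]]) simp
        then show ?thesis
          by (intro tendsto_eventually, elim eventually_mono) simp
      qed simp
    qed
    show "integrable lborel (\<lambda>y. norm (?J y))" by (rule integrable_norm[OF J])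
  qed measurable
  then have "Lim (at_right 0) (\<lambda>\<delta>. LINT y:{y. norm (x - y) > \<delta>}|lborel. ?J y) = (\<integral>y. ?J y \<partial>lborel)"
    by (intro tendsto_Lim) auto
  then show ?thesis unfolding tempered_frac_laplacian_def IJ by simp
qed

definition tempered_kernel :: "real \<Rightarrow> real \<Rightarrow> real ^ 'n::finite \<Rightarrow> real" where
  "tempered_kernel \<alpha> lam z = exp (- lam * norm z) * norm z powr (- (real CARD('n) + \<alpha>))"

text \<open>The factors |\<xi>|^\<gamma> cancel, so the exact integrand does not depend on the
  splitting parameter; \<gamma> only influences the quadrature. At \<xi> = 0 both sides are 0 by the
  convention \<open>0 powr y = 0\<close>.\<close>

lemma phi_mult_weight:
  "phi \<gamma> u x \<xi> * weight \<alpha> lam \<gamma> \<xi> =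
    - (\<Sum>s\<in>signs. (u x - u (x + s * \<xi>)) * tempered_kernel \<alpha> lam (s * \<xi>))" for \<xi> :: "real ^ 'n::finite"
proof (cases "\<xi> = 0")
  case True
  then show ?thesis by (simp add: weight_def tempered_kernel_def)
next
  case False
  have "norm \<xi> powr (\<gamma> - (real CARD('n) + \<alpha>)) / norm \<xi> powr \<gamma> = norm \<xi> powr (- (real CARD('n) + \<alpha>))"
    unfolding powr_diff[symmetric] by simp
  then have k: "weight \<alpha> lam \<gamma> \<xi> / norm \<xi> powr \<gamma> = tempered_kernel \<alpha> lam \<xi>"
    by (simp only: weight_def tempered_kernel_def times_divide_eq_right[symmetric])
  have "(\<Sum>s\<in>signs. (u x - u (x + s * \<xi>)) * tempered_kernel \<alpha> lam (s * \<xi>)) = (\<Sum>s\<in>(signs :: (real ^ 'n) set). (u x - u (x + s * \<xi>)) * tempered_kernel \<alpha> lam \<xi>)"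
    by (rule sum.cong) (auto simp: tempered_kernel_def)
  also have "\<dots> = (2 ^ CARD('n) * u x - (\<Sum>s\<in>signs. u (x + s * \<xi>))) * tempered_kernel \<alpha> lam \<xi>"
    by (simp add: sum_distrib_right[symmetric] sum_subtractf card_signs)
  finally show ?thesis
    unfolding phi_eq_signs k[symmetric] by (simp add: algebra_simps diff_divide_distrib)
qed

lemma tempered_kernel_measurable [measurable]: "tempered_kernel \<alpha> lam \<in> borel_measurable (borel :: (real ^ 'n::finite) measure)"
  unfolding tempered_kernel_def by measurable

text \<open>Near 0 Hoelder continuity leaves |z|^(s-\<alpha>-d), and farther out boundedness of
  \<open>u\<close> leaves |z|^(-d-\<alpha>). Both are covered by \<open>integrable_kernel\<close>
  with \<open>s - \<alpha>\<close> in the place of \<open>\<epsilon>\<close>.\<close>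

lemma integrable_difference_kernel:
  fixes u :: "real ^ 'n::finite \<Rightarrow> real"
  assumes zero: "\<And>x. x \<notin> box a b \<Longrightarrow> u x = 0"
    and H: "\<And>x y. \<bar>u x - u y\<bar> \<le> H * norm (x - y) powr s" and s: "\<alpha> < s" "s \<le> 1" and \<alpha>: "0 < \<alpha>" and lam: "0 \<le> lam"
  shows "integrable lborel (\<lambda>z. (u x - u (x + z)) * tempered_kernel \<alpha> lam z)"
proof -
  let ?d = "real CARD('n)"
  have u: "continuous_on UNIV u" by (rule continuous_on_of_holder[OF H]) (use s \<alpha> in simp)
  then have [measurable]: "u \<in> borel_measurable borel" by (rule borel_measurable_continuous_onI)
  have "compact (u ` cbox a b)"
    by (intro compact_continuous_image continuous_on_subset[OF u]) auto
  then obtain M where M: "\<And>y. y \<in> cbox a b \<Longrightarrow> \<bar>u y\<bar> \<le> M"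
    using compact_imp_bounded[THEN bounded_iff[THEN iffD1]] by (metis image_eqI real_norm_def)
  have M': "\<bar>u y\<bar> \<le> \<bar>M\<bar>" for y
    using M[of y] zero[of y] box_subset_cbox[of a b] by (cases "y \<in> box a b") auto
  define C where "C = max \<bar>H\<bar> (2 * \<bar>M\<bar>)"
  let ?K = "\<lambda>z::real ^ 'n. if norm z \<le> 1 then norm z powr ((s - \<alpha>) - ?d) else norm z powr (- (?d + \<alpha>))"
  have "1 \<le> ?d" by simp
  then have K: "integrable lborel ?K" using s \<alpha> by (intro integrable_kernel) (assumption | linarith)+
  have bound: "\<bar>(u x - u (x + z)) * tempered_kernel \<alpha> lam z\<bar> \<le> C * ?K z" for z
  proof -
    have ker: "0 \<le> tempered_kernel \<alpha> lam z" "tempered_kernel \<alpha> lam z \<le> norm z powr (- (?d + \<alpha>))"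
      using lam by (auto simp: tempered_kernel_def mult_left_le_one_le)
    show ?thesis
    proof (cases "norm z \<le> 1")
      case True
      have "\<bar>u x - u (x + z)\<bar> \<le> C * norm z powr s"
        using H[of x "x + z"] by (rule order_trans) (auto simp: C_def intro!: mult_right_mono)
      then have "\<bar>u x - u (x + z)\<bar> * tempered_kernel \<alpha> lam z \<le> (C * norm z powr s) * norm z powr (- (?d + \<alpha>))"
        using ker by (intro mult_mono) auto
      also have "\<dots> = C * norm z powr ((s - \<alpha>) - ?d)"
        by (simp add: powr_add[symmetric] mult.assoc algebra_simps)
      finally show ?thesis using True ker by (simp add: abs_mult)
    next
      case False
      have "\<bar>u x - u (x + z)\<bar> \<le> C"
        using M'[of x] M'[of "x + z"] by (auto simp: C_def)
      then have "\<bar>u x - u (x + z)\<bar> * tempered_kernel \<alpha> lam z \<le> C * norm z powr (- (?d + \<alpha>))"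
        using ker by (intro mult_mono) auto
      then show ?thesis using False ker by (simp add: abs_mult)
    qed
  qed
  show ?thesis
  proof (rule Bochner_Integration.integrable_bound)
    show "integrable lborel (\<lambda>z. C * ?K z)" using K by simp
    show "AE z in lborel. norm ((u x - u (x + z)) * tempered_kernel \<alpha> lam z) \<le> norm (C * ?K z)"
      unfolding real_norm_def by (intro AE_I2 order_trans[OF bound abs_ge_self])
  qed measurable
qed

lemma max_side_ge: "b $ i - a $ i \<le> max_side a b"
  unfolding max_side_def by (rule Max_ge) auto

lemma max_side_pos:
  assumes "\<And>i. a $ i < b $ i"
  shows "0 < max_side a b"
  using assms[of undefined] max_side_ge[of b undefined a] by simp

lemma index_cube_0: "0 < N \<Longrightarrow> 0 \<in> index_cube N"
  by (simp add: index_cube_def)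

text \<open>Outside the cube of side L some coordinate of \<xi> exceeds the longest side of the box,
  so every reflected point \<open>x + s * \<xi>\<close> misses the box. There the exact integrand is
  the far-field term of the scheme, and truncation adds no error.\<close>

lemma fd_error_eq_sum_element_error:
  fixes u :: "real ^ 'n::finite \<Rightarrow> real"
  assumes ab: "\<And>i. a $ i < b $ i" and zero: "\<And>x. x \<notin> box a b \<Longrightarrow> u x = 0"
    and H: "\<And>x y. \<bar>u x - u y\<bar> \<le> H * norm (x - y) powr s" and s: "\<alpha> < s" "s \<le> 1" and \<alpha>: "0 < \<alpha>" and lam: "0 \<le> lam"
    and x: "x \<in> box a b" and N: "1 \<le> N"
  shows "\<And>k. set_integrable lborel (element (mesh_size a b N) k) (\<lambda>\<xi>. phi \<gamma> u x \<xi> * weight \<alpha> lam \<gamma> \<xi>)"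
    and "fd_error a b \<alpha> lam \<gamma> N u x = - frac_const CARD('n) \<alpha> lam *
      (\<Sum>k\<in>index_cube N. element_error \<alpha> lam \<gamma> (mesh_size a b N) k (phi \<gamma> u x))"
proof -
  define L where "L = max_side a b"
  define h where "h = mesh_size a b N"
  define c where "c = frac_const CARD('n) \<alpha> lam"
  have L: "0 < L" unfolding L_def by (rule max_side_pos[OF ab])
  have h: "0 < h" "h * real N = L" using L N by (auto simp: h_def mesh_size_def L_def)
  let ?F = "\<lambda>z. (u x - u (x + z)) * tempered_kernel \<alpha> lam z"
  let ?G = "\<lambda>\<xi>. phi \<gamma> u x \<xi> * weight \<alpha> lam \<gamma> \<xi>"
  have "continuous_on UNIV u" by (rule continuous_on_of_holder[OF H]) (use s \<alpha> in simp)
  then have [measurable]: "u \<in> borel_measurable borel" by (rule borel_measurable_continuous_onI)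
  have F: "integrable lborel ?F" by (rule integrable_difference_kernel[OF zero H s \<alpha> lam])
  have Fm: "?F \<in> borel_measurable borel" by measurable
  note O = integral_eq_orthant[OF F Fm]
  have G: "integrable lborel ?G"
    unfolding phi_mult_weight using O(1) by simp
  have GA: "set_integrable lborel A ?G" if "A \<in> sets borel" for A
    unfolding set_integrable_def by (rule integrable_mult_indicator) (use that G in auto)
  then show "\<And>k. set_integrable lborel (element (mesh_size a b N) k) ?G" by simp
  let ?O = "{\<xi> :: real ^ 'n. \<forall>i. 0 \<le> \<xi> $ i}"
  let ?C = "{\<xi> :: real ^ 'n. \<forall>i. 0 \<le> \<xi> $ i \<and> \<xi> $ i \<le> h * real N}"
  have Om: "?O \<in> sets borel" using orthant_borel[of 1] by simp
  have "?C = cbox 0 (\<chi> i. h * real N)" by (auto simp: mem_box_cart)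
  then have Cm: "?C \<in> sets borel" by simp
  have far: "far_region L = ?O - ?C" by (simp add: far_region_def h(2))
  have farm: "(far_region L :: (real ^ 'n) set) \<in> sets borel" unfolding far using Om Cm by (rule sets.Diff)
  have "(\<integral>z. ?F z \<partial>lborel) = - (LINT \<xi>:?O|lborel. ?G \<xi>)"
    unfolding O(2) phi_mult_weight by (simp add: set_lebesgue_integral_def)
  also have "?O = ?C \<union> far_region L" unfolding far by auto
  also have "(LINT \<xi>:?C \<union> far_region L|lborel. ?G \<xi>) = (LINT \<xi>:?C|lborel. ?G \<xi>) + (LINT \<xi>:far_region L|lborel. ?G \<xi>)"
    by (rule set_integral_Un) (use GA Cm farm in \<open>auto simp: far\<close>)
  also have "(LINT \<xi>:?C|lborel. ?G \<xi>) = (\<Sum>k\<in>index_cube N. LINT \<xi>:element h k|lborel. ?G \<xi>)"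
    by (rule set_integral_cube_eq_sum_elements[OF h(1) GA[OF Cm]])
  also have farG: "(LINT \<xi>:far_region L|lborel. ?G \<xi>) = (LINT \<xi>:(far_region L :: (real ^ 'n) set)|lborel. - (2 ^ CARD('n) * u x) * tempered_kernel \<alpha> lam \<xi>)"
  proof (intro set_lebesgue_integral_cong allI impI)
    fix \<xi> :: "real ^ 'n" assume \<xi>: "\<xi> \<in> far_region L"
    have "\<forall>i. 0 \<le> \<xi> $ i" "\<not> (\<forall>i. 0 \<le> \<xi> $ i \<and> \<xi> $ i \<le> L)" using \<xi> unfolding far_region_def by blast+
    then obtain i where i: "0 \<le> \<xi> $ i" "L < \<xi> $ i" by (meson not_le)
    have "u (x + s * \<xi>) = 0" if s: "s \<in> signs" for s
    proof (rule zero)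
      have "a $ i < x $ i" "x $ i < b $ i" using x by (auto simp: mem_box_cart)
      moreover have "b $ i - a $ i < \<xi> $ i" using max_side_ge[of b i a] i by (simp add: L_def)
      moreover have "s $ i = 1 \<or> s $ i = -1" using s by (auto simp: signs_def)
      ultimately have "b $ i < (x + s * \<xi>) $ i \<or> (x + s * \<xi>) $ i < a $ i" by auto
      then show "x + s * \<xi> \<notin> box a b" by (auto simp: mem_box_cart not_less intro!: exI[of _ i])
    qed
    then have "(\<Sum>s\<in>signs. (u x - u (x + s * \<xi>)) * tempered_kernel \<alpha> lam (s * \<xi>)) = (\<Sum>s\<in>(signs :: (real ^ 'n) set). u x * tempered_kernel \<alpha> lam \<xi>)"
      by (intro sum.cong) (auto simp: tempered_kernel_def)
    then show "?G \<xi> = - (2 ^ CARD('n) * u x) * tempered_kernel \<alpha> lam \<xi>"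
      unfolding phi_mult_weight by (simp add: card_signs)
  qed (use farm in simp)
  also have "\<dots> = - (2 ^ CARD('n) * u x) * (LINT \<xi>:(far_region L :: (real ^ 'n) set)|lborel. tempered_kernel \<alpha> lam \<xi>)"
    by (rule set_integral_mult_right)
  finally have IF: "(\<integral>z. ?F z \<partial>lborel) = - (\<Sum>k\<in>index_cube N. LINT \<xi>:element h k|lborel. ?G \<xi>)
      + 2 ^ CARD('n) * u x * (LINT \<xi>:(far_region L :: (real ^ 'n) set)|lborel. tempered_kernel \<alpha> lam \<xi>)" by simp
  have T: "tempered_frac_laplacian \<alpha> lam u x = c * (\<integral>z. ?F z \<partial>lborel)"
    using tempered_frac_laplacian_eq_integral[OF F[unfolded tempered_kernel_def]] by (simp add: c_def tempered_kernel_def)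
  let ?W = "\<lambda>k. LINT \<xi>:(element h k :: (real ^ 'n) set)|lborel. weight \<alpha> lam \<gamma> \<xi>"
  have split: "(\<Sum>k\<in>index_cube N. corner_mean \<gamma> h k (phi \<gamma> u x) * ?W k) =
      1 / 2 ^ CARD('n) * (\<Sum>n\<in>index_cube 2 - {0}. corner_coeff \<gamma> n * phi \<gamma> u x (grid_point h n)) * ?W 0
    + (\<Sum>k\<in>index_cube N - {0}. 1 / 2 ^ CARD('n) * (\<Sum>n\<in>index_cube 2. phi \<gamma> u x (grid_point h (k + n))) * ?W k)"
  proof -
    have "(0 :: nat ^ 'n) \<in> index_cube N" using N by (intro index_cube_0) simp
    then have "(\<Sum>k\<in>index_cube N. corner_mean \<gamma> h k (phi \<gamma> u x) * ?W k)
      = corner_mean \<gamma> h 0 (phi \<gamma> u x) * ?W 0 + (\<Sum>k\<in>index_cube N - {0}. corner_mean \<gamma> h k (phi \<gamma> u x) * ?W k)"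
      by (rule sum.remove[OF finite_index_cube])
    also have "(\<Sum>k\<in>index_cube N - {0}. corner_mean \<gamma> h k (phi \<gamma> u x) * ?W k)
      = (\<Sum>k\<in>index_cube N - {0}. 1 / 2 ^ CARD('n) * (\<Sum>n\<in>index_cube 2. phi \<gamma> u x (grid_point h (k + n))) * ?W k)"
      by (intro sum.cong refl) (simp add: corner_mean_def)
    finally show ?thesis by (simp add: corner_mean_def)
  qed
  have D: "fd_laplacian a b \<alpha> lam \<gamma> N u x = - c * ((\<Sum>k\<in>index_cube N. corner_mean \<gamma> h k (phi \<gamma> u x) * ?W k)
      - 2 ^ CARD('n) * u x * (LINT \<xi>:(far_region L :: (real ^ 'n) set)|lborel. tempered_kernel \<alpha> lam \<xi>))"
    unfolding fd_laplacian_def Let_def c_def L_def tempered_kernel_def h_def[symmetric] split ..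
  show "fd_error a b \<alpha> lam \<gamma> N u x = - frac_const CARD('n) \<alpha> lam *
      (\<Sum>k\<in>index_cube N. element_error \<alpha> lam \<gamma> (mesh_size a b N) k (phi \<gamma> u x))"
    unfolding fd_error_def T IF D h_def[symmetric] c_def[symmetric] element_error_def sum_subtractf
    by (simp add: algebra_simps)
qed

section \<open>Element errors\<close>

text \<open>One bound for both signs of p; \<open>D\<close> absorbs the variation of the norm over
  an element.\<close>

lemma powr_comparable:
  fixes h \<rho> D p :: real
  assumes "0 < h" "h \<le> \<rho>" "\<rho> \<le> D * h" "1 \<le> D"
  shows "\<rho> powr p \<le> D powr \<bar>p\<bar> * h powr p"
proof (cases "0 \<le> p")
  case True
  have "\<rho> powr p \<le> (D * h) powr p" using assms True by (intro powr_mono2) auto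
  then show ?thesis using True assms by (simp add: powr_mult)
next
  case False
  have "\<rho> powr p \<le> h powr p" using assms False by (intro powr_mono2') auto
  also have "\<dots> \<le> D powr \<bar>p\<bar> * h powr p"
    using assms ge_one_powr_ge_zero[of D "\<bar>p\<bar>"] by (simp add: mult_le_cancel_right1)
  finally show ?thesis .
qed

text \<open>By \<open>p \<le> 1\<close> the derivative \<open>p * z powr (p - 1)\<close> is largest
  in absolute value at the lower end \<open>m\<close>.\<close>

lemma powr_diff_le:
  fixes \<rho> \<sigma> m p :: real
  assumes "0 < m" "m \<le> \<rho>" "m \<le> \<sigma>" "p \<le> 1"
  shows "\<bar>\<rho> powr p - \<sigma> powr p\<bar> \<le> \<bar>p\<bar> * m powr (p - 1) * \<bar>\<rho> - \<sigma>\<bar>"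
proof -
  have *: "\<bar>\<rho> powr p - \<sigma> powr p\<bar> \<le> \<bar>p\<bar> * m powr (p - 1) * \<bar>\<rho> - \<sigma>\<bar>"
    if "m \<le> \<sigma>" "\<sigma> < \<rho>" for \<rho> \<sigma>
  proof -
    have "\<exists>z. \<sigma> < z \<and> z < \<rho> \<and> \<rho> powr p - \<sigma> powr p = (\<rho> - \<sigma>) * (p * z powr (p - 1))"
      by (rule MVT2[OF that(2)]) (use that assms in \<open>auto intro!: has_real_derivative_powr\<close>)
    then obtain z where z: "\<sigma> < z" "\<rho> powr p - \<sigma> powr p = (\<rho> - \<sigma>) * (p * z powr (p - 1))" by auto
    have "z powr (p - 1) \<le> m powr (p - 1)"
      using z that assms by (intro powr_mono2') auto
    then have "\<bar>p\<bar> * z powr (p - 1) * \<bar>\<rho> - \<sigma>\<bar> \<le> \<bar>p\<bar> * m powr (p - 1) * \<bar>\<rho> - \<sigma>\<bar>"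
      by (intro mult_right_mono mult_left_mono) auto
    then show ?thesis unfolding z(2) by (simp add: abs_mult mult_ac)
  qed
  show ?thesis
    using *[of \<sigma> \<rho>] *[of \<rho> \<sigma>] assms
    by (cases \<rho> \<sigma> rule: linorder_cases) (auto simp: abs_minus_commute)
qed

lemma weight_nonneg [simp]: "0 \<le> weight \<alpha> lam \<gamma> \<xi>"
  by (simp add: weight_def)

lemma weight_le_powr:
  "0 \<le> lam \<Longrightarrow> weight \<alpha> lam \<gamma> (\<xi> :: real ^ 'n::finite) \<le> norm \<xi> powr (\<gamma> - (real CARD('n) + \<alpha>))"
  by (simp add: weight_def mult_left_le_one_le)

lemma set_integrable_weight:
  assumes "\<alpha> < \<gamma>" "0 \<le> lam"
  shows "set_integrable lborel (element h k :: (real ^ 'n::finite) set) (weight \<alpha> lam \<gamma>)"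
proof -
  have "bounded (element h k :: (real ^ 'n) set)" by (simp add: element_def bounded_cbox)
  then obtain R where R: "\<And>\<xi>. \<xi> \<in> (element h k :: (real ^ 'n) set) \<Longrightarrow> norm \<xi> \<le> R" by (auto simp: bounded_iff)
  have "\<bar>\<xi> $ i\<bar> \<le> \<bar>R\<bar>" if "\<xi> \<in> element h k" for \<xi> :: "real ^ 'n" and i
    using R[OF that] component_le_norm_cart[of \<xi> i] by linarith
  then have "set_integrable lborel (element h k) (\<lambda>\<xi>::real ^ 'n. norm \<xi> powr (\<gamma> - (real CARD('n) + \<alpha>)))"
    using assms by (intro set_integrable_norm_powr[of "\<bar>R\<bar>"]) auto
  then show ?thesis
    by (rule set_integrable_bound)
      (use weight_le_powr[OF assms(2), of \<alpha> \<gamma>] in \<open>auto simp: set_borel_measurable_def\<close>)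
qed

lemma abs_integral_element_le:
  assumes "0 \<le> h" "\<And>\<xi>. \<xi> \<in> (element h k :: (real ^ 'n::finite) set) \<Longrightarrow> \<bar>f \<xi>\<bar> \<le> B"
  shows "\<bar>LINT \<xi>:element h k|lborel. f \<xi>\<bar> \<le> B * h ^ CARD('n)"
  using set_integral_abs_le[OF set_integrable_const_element[OF assms(1)], of k f B] assms(2)
  by (simp add: set_integral_const_element[OF assms(1)])

lemma corner_mean_deviation:
  fixes f :: "real ^ 'n::finite \<Rightarrow> real"
  assumes k: "k \<noteq> 0" and B: "\<And>n. n \<in> index_cube 2 \<Longrightarrow> \<bar>y - f (grid_point h (k + n))\<bar> \<le> B"
  shows "\<bar>y - corner_mean \<gamma> h k f\<bar> \<le> B"
proof -
  have c: "real (card (index_cube 2 :: (nat ^ 'n) set)) = 2 ^ CARD('n)" by (simp add: card_index_cube)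
  have "y - corner_mean \<gamma> h k f = 1 / 2 ^ CARD('n) * (\<Sum>n\<in>index_cube 2. y - f (grid_point h (k + n)))"
    using k by (simp add: corner_mean_def sum_subtractf c field_simps)
  also have "\<bar>\<dots>\<bar> \<le> 1 / 2 ^ CARD('n) * (\<Sum>n\<in>(index_cube 2 :: (nat ^ 'n) set). B)"
    unfolding abs_mult by (intro mult_mono order_trans[OF sum_abs] sum_mono B) auto
  also have "\<dots> = B" by (simp add: c)
  finally show ?thesis .
qed

lemma element_error_eq_integral:
  assumes "set_integrable lborel (element h k) (\<lambda>\<xi>. f \<xi> * weight \<alpha> lam \<gamma> \<xi>)"
    and "set_integrable lborel (element h k) (weight \<alpha> lam \<gamma>)"
  shows "element_error \<alpha> lam \<gamma> h k f = (LINT \<xi>:element h k|lborel. (f \<xi> - corner_mean \<gamma> h k f) * weight \<alpha> lam \<gamma> \<xi>)"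
  unfolding element_error_def left_diff_distrib using assms by simp

text \<open>An estimate without cancellation: oscillation of \<open>f\<close> times size of the
  weight times volume. It is sharp enough for Hoelder continuous \<open>u\<close>.\<close>

lemma element_error_rough:
  fixes f :: "real ^ 'n::finite \<Rightarrow> real"
  assumes h: "0 \<le> h" and k: "k \<noteq> 0" and f: "set_integrable lborel (element h k) (\<lambda>\<xi>. f \<xi> * weight \<alpha> lam \<gamma> \<xi>)"
    and w: "set_integrable lborel (element h k :: (real ^ 'n) set) (weight \<alpha> lam \<gamma>)"
    and B: "\<And>\<xi> \<eta>. \<xi> \<in> element h k \<Longrightarrow> \<eta> \<in> element h k \<Longrightarrow> \<bar>f \<xi> - f \<eta>\<bar> \<le> B"
    and W: "\<And>\<xi>. \<xi> \<in> element h k \<Longrightarrow> weight \<alpha> lam \<gamma> \<xi> \<le> W"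
  shows "\<bar>element_error \<alpha> lam \<gamma> h k f\<bar> \<le> B * W * h ^ CARD('n)"
  unfolding element_error_eq_integral[OF f w]
proof (rule abs_integral_element_le[OF h])
  fix \<xi> :: "real ^ 'n" assume \<xi>: "\<xi> \<in> element h k"
  have "\<bar>f \<xi> - corner_mean \<gamma> h k f\<bar> \<le> B"
    using B[OF \<xi> grid_point_mem_element[OF h]] by (rule corner_mean_deviation[OF k])
  then show "\<bar>(f \<xi> - corner_mean \<gamma> h k f) * weight \<alpha> lam \<gamma> \<xi>\<bar> \<le> B * W"
    unfolding abs_mult using W[OF \<xi>] by (intro mult_mono) auto
qed

lemma corner_coeff_bounds: "0 \<le> corner_coeff \<gamma> (n :: nat ^ 'n::finite)" "corner_coeff \<gamma> (n :: nat ^ 'n) \<le> 2 ^ CARD('n)"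
proof -
  have "1 \<le> real CARD('n)" by simp
  then show "0 \<le> corner_coeff \<gamma> n" "corner_coeff \<gamma> n \<le> 2 ^ CARD('n)"
    by (auto simp: corner_coeff_def field_simps)
qed

text \<open>On the first element the integral and the quadrature are bounded separately: the weight
  may be singular there, and the element is small enough to do without cancellation. The factor
  \<open>2 ^ CARD('n)\<close> bounds the coefficients, while averaging absorbs the number of
  corners.\<close>

lemma element_error_zero:
  fixes f :: "real ^ 'n::finite \<Rightarrow> real"
  assumes X: "\<bar>LINT \<xi>:element h 0|lborel. f \<xi> * weight \<alpha> lam \<gamma> \<xi>\<bar> \<le> X"
    and F: "\<And>n. n \<in> index_cube 2 \<Longrightarrow> n \<noteq> 0 \<Longrightarrow> \<bar>f (grid_point h n)\<bar> \<le> F" "0 \<le> F"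
  shows "\<bar>element_error \<alpha> lam \<gamma> h 0 f\<bar> \<le> X + 2 ^ CARD('n) * F * (LINT \<xi>:(element h 0 :: (real ^ 'n) set)|lborel. weight \<alpha> lam \<gamma> \<xi>)"
proof -
  let ?W = "LINT \<xi>:(element h 0 :: (real ^ 'n) set)|lborel. weight \<alpha> lam \<gamma> \<xi>"
  have W: "0 \<le> ?W" unfolding set_lebesgue_integral_def by (intro Bochner_Integration.integral_nonneg) auto
  have "\<bar>\<Sum>n\<in>index_cube 2 - {0}. corner_coeff \<gamma> n * f (grid_point h n)\<bar>
      \<le> (\<Sum>n\<in>index_cube 2 - {0 :: nat ^ 'n}. 2 ^ CARD('n) * F)"
    by (rule order_trans[OF sum_abs], unfold abs_mult, intro sum_mono mult_mono)
      (use F corner_coeff_bounds[where 'n = 'n] in \<open>auto simp: abs_of_nonneg\<close>)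
  also have "\<dots> \<le> (\<Sum>n\<in>(index_cube 2 :: (nat ^ 'n) set). 2 ^ CARD('n) * F)"
    by (rule sum_mono2) (use F finite_index_cube in auto)
  also have "\<dots> = 2 ^ CARD('n) * (2 ^ CARD('n) * F)" by (simp add: card_index_cube)
  finally have "\<bar>corner_mean \<gamma> h 0 f\<bar> \<le> 2 ^ CARD('n) * F"
    by (simp add: corner_mean_def abs_mult field_simps)
  then have "\<bar>corner_mean \<gamma> h 0 f * ?W\<bar> \<le> 2 ^ CARD('n) * F * ?W"
    unfolding abs_mult using W by (intro mult_mono) auto
  then show ?thesis unfolding element_error_def using X by linarith
qed

lemma element_error_add:
  assumes "set_integrable lborel (element h k) (\<lambda>\<xi>. f \<xi> * weight \<alpha> lam \<gamma> \<xi>)"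
    and "set_integrable lborel (element h k) (\<lambda>\<xi>. g \<xi> * weight \<alpha> lam \<gamma> \<xi>)"
  shows "element_error \<alpha> lam \<gamma> h k (\<lambda>\<xi>. f \<xi> + g \<xi>) = element_error \<alpha> lam \<gamma> h k f + element_error \<alpha> lam \<gamma> h k g"
proof -
  have "corner_mean \<gamma> h k (\<lambda>\<xi>. f \<xi> + g \<xi>) = corner_mean \<gamma> h k f + corner_mean \<gamma> h k g"
    by (simp add: corner_mean_def sum.distrib distrib_left add_divide_distrib)
  then show ?thesis
    using set_integral_add(2)[OF assms] by (simp add: element_error_def distrib_right algebra_simps)
qed

lemma element_error_cmult:
  "element_error \<alpha> lam \<gamma> h k (\<lambda>\<xi>. c * f \<xi>) = c * element_error \<alpha> lam \<gamma> h k f"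
proof -
  have "corner_mean \<gamma> h k (\<lambda>\<xi>. c * f \<xi>) = c * corner_mean \<gamma> h k f"
    by (simp add: corner_mean_def sum_distrib_left mult_ac)
  then show ?thesis by (simp add: element_error_def mult.assoc right_diff_distrib)
qed

lemma element_error_sum:
  assumes "finite I" "\<And>i. i \<in> I \<Longrightarrow> set_integrable lborel (element h k) (\<lambda>\<xi>. f i \<xi> * weight \<alpha> lam \<gamma> \<xi>)"
  shows "set_integrable lborel (element h k) (\<lambda>\<xi>. (\<Sum>i\<in>I. f i \<xi>) * weight \<alpha> lam \<gamma> \<xi>)
    \<and> element_error \<alpha> lam \<gamma> h k (\<lambda>\<xi>. \<Sum>i\<in>I. f i \<xi>) = (\<Sum>i\<in>I. element_error \<alpha> lam \<gamma> h k (f i))"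
  using assms
proof (induction I)
  case empty
  then show ?case by (simp add: element_error_def corner_mean_def set_integrable_def)
next
  case (insert i I)
  then have IH: "set_integrable lborel (element h k) (\<lambda>\<xi>. (\<Sum>i\<in>I. f i \<xi>) * weight \<alpha> lam \<gamma> \<xi>)"
    "element_error \<alpha> lam \<gamma> h k (\<lambda>\<xi>. \<Sum>i\<in>I. f i \<xi>) = (\<Sum>i\<in>I. element_error \<alpha> lam \<gamma> h k (f i))" by auto
  have i: "set_integrable lborel (element h k) (\<lambda>\<xi>. f i \<xi> * weight \<alpha> lam \<gamma> \<xi>)" using insert by simp
  from set_integral_add(1)[OF i IH(1)] element_error_add[OF i IH(1)] IH(2) show ?case
    using insert.hyps by (simp add: distrib_right)
qed

text \<open>With A the corner mean, the error is the integral of (f - A) w. Freezing w at the centre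
  costs a product of two first order quantities, \<open>B1 * V\<close>. The remaining integral of f
  - A is averaged with its reflection in the centre, which preserves both the element and its set of
  corners, so that second differences \<open>B2\<close> are all that is left.\<close>

lemma element_error_smooth:
  fixes f :: "real ^ 'n::finite \<Rightarrow> real"
  defines "c \<equiv> \<lambda>h k. \<chi> i. (real (k $ i) + 1 / 2) * h"
  assumes h: "0 \<le> h" and k: "k \<noteq> 0" and [measurable]: "f \<in> borel_measurable borel"
    and w: "set_integrable lborel (element h k :: (real ^ 'n) set) (weight \<alpha> lam \<gamma>)"
    and B1: "\<And>\<xi> \<eta>. \<xi> \<in> element h k \<Longrightarrow> \<eta> \<in> element h k \<Longrightarrow> \<bar>f \<xi> - f \<eta>\<bar> \<le> B1"
    and B2: "\<And>\<xi>. \<xi> \<in> element h k \<Longrightarrow> \<bar>f \<xi> + f (2 *\<^sub>R c h k - \<xi>) - 2 * f (c h k)\<bar> \<le> B2"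
    and V: "\<And>\<xi>. \<xi> \<in> element h k \<Longrightarrow> \<bar>weight \<alpha> lam \<gamma> \<xi> - weight \<alpha> lam \<gamma> (c h k)\<bar> \<le> V"
    and W: "weight \<alpha> lam \<gamma> (c h k) \<le> W"
  shows "\<bar>element_error \<alpha> lam \<gamma> h k f\<bar> \<le> (B1 * V + W * B2) * h ^ CARD('n)"
proof -
  define \<zeta> where "\<zeta> = c h k"
  let ?I = "element h k :: (real ^ 'n) set"
  let ?w = "weight \<alpha> lam \<gamma> :: real ^ 'n \<Rightarrow> real"
  let ?A = "corner_mean \<gamma> h k f"
  have \<zeta>: "\<zeta> \<in> ?I" unfolding \<zeta>_def c_def mem_element
    using h by (auto intro!: mult_right_mono)
  have refl_mem: "2 *\<^sub>R \<zeta> - \<xi> \<in> ?I \<longleftrightarrow> \<xi> \<in> ?I" for \<xi>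
    by (auto simp: \<zeta>_def c_def mem_element algebra_simps)
  have dev: "\<bar>f \<xi> - ?A\<bar> \<le> B1" if "\<xi> \<in> ?I" for \<xi>
    using B1[OF that grid_point_mem_element[OF h]] by (rule corner_mean_deviation[OF k])
  have fint: "set_integrable lborel ?I f"
  proof (rule set_integrable_bound[OF set_integrable_const_element[OF h, of k "\<bar>f \<zeta>\<bar> + B1"]])
    show "AE \<xi> in lborel. \<xi> \<in> ?I \<longrightarrow> norm (f \<xi>) \<le> norm (\<bar>f \<zeta>\<bar> + B1)"
      using B1[OF _ \<zeta>] by (intro AE_I2) force
  qed (simp add: set_borel_measurable_def)
  have gint: "set_integrable lborel ?I (\<lambda>\<xi>. f \<xi> - ?A)"
    by (rule set_integral_diff(1)[OF fint set_integrable_const_element[OF h]])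
  have fw: "set_integrable lborel ?I (\<lambda>\<xi>. f \<xi> * ?w \<xi>)"
  proof (rule set_integrable_bound[OF set_integrable_mult_right[OF w, of "\<bar>f \<zeta>\<bar> + B1"]])
    show "AE \<xi> in lborel. \<xi> \<in> ?I \<longrightarrow> norm (f \<xi> * ?w \<xi>) \<le> norm ((\<bar>f \<zeta>\<bar> + B1) * ?w \<xi>)"
    proof (intro AE_I2 impI)
      fix \<xi> assume "\<xi> \<in> ?I"
      then have "\<bar>f \<xi>\<bar> \<le> \<bar>\<bar>f \<zeta>\<bar> + B1\<bar>" using B1[OF _ \<zeta>, of \<xi>] by linarith
      then show "norm (f \<xi> * ?w \<xi>) \<le> norm ((\<bar>f \<zeta>\<bar> + B1) * ?w \<xi>)"
        unfolding real_norm_def abs_mult by (rule mult_right_mono) simp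
    qed
  qed (simp add: set_borel_measurable_def)
  have g\<zeta>: "set_integrable lborel ?I (\<lambda>\<xi>. (f \<xi> - ?A) * ?w \<zeta>)" using gint by simp
  have gw: "set_integrable lborel ?I (\<lambda>\<xi>. (f \<xi> - ?A) * ?w \<xi>)"
    unfolding left_diff_distrib using fw w by (intro set_integral_diff(1)) auto
  have "element_error \<alpha> lam \<gamma> h k f = (LINT \<xi>:?I|lborel. (f \<xi> - ?A) * ?w \<xi>)"
    by (rule element_error_eq_integral[OF fw w])
  also have "\<dots> = (LINT \<xi>:?I|lborel. (f \<xi> - ?A) * (?w \<xi> - ?w \<zeta>)) + (LINT \<xi>:?I|lborel. (f \<xi> - ?A) * ?w \<zeta>)"
    unfolding right_diff_distrib using gw g\<zeta> by simp
  also have "(LINT \<xi>:?I|lborel. (f \<xi> - ?A) * ?w \<zeta>) = ?w \<zeta> * (LINT \<xi>:?I|lborel. f \<xi> - ?A)"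
    by simp
  finally have E: "element_error \<alpha> lam \<gamma> h k f = (LINT \<xi>:?I|lborel. (f \<xi> - ?A) * (?w \<xi> - ?w \<zeta>)) + ?w \<zeta> * (LINT \<xi>:?I|lborel. f \<xi> - ?A)" .
  have 1: "\<bar>LINT \<xi>:?I|lborel. (f \<xi> - ?A) * (?w \<xi> - ?w \<zeta>)\<bar> \<le> (B1 * V) * h ^ CARD('n)"
  proof (rule abs_integral_element_le[OF h])
    fix \<xi> assume "\<xi> \<in> ?I"
    then show "\<bar>(f \<xi> - ?A) * (?w \<xi> - ?w \<zeta>)\<bar> \<le> B1 * V"
      unfolding abs_mult using dev V[of \<xi>] by (intro mult_mono) (auto simp: \<zeta>_def intro: order_trans[OF abs_ge_zero])
  qed
  \<comment> \<open>The map sending n to 1 - n pairs opposite corners, so twice the corner mean is a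
    mean of sums over opposite corners.\<close>
  have avg: "\<bar>2 * f \<zeta> - 2 * ?A\<bar> \<le> B2"
  proof -
    define n' where "n' n = (\<chi> i. 1 - n $ i)" for n :: "nat ^ 'n"
    have n1: "n $ i \<le> 1" if "n \<in> index_cube 2" for n :: "nat ^ 'n" and i
      using that by (auto simp: index_cube_def less_Suc_eq_le numeral_2_eq_2)
    have refl_corner: "grid_point h (k + n' n) = 2 *\<^sub>R \<zeta> - grid_point h (k + n)" if "n \<in> index_cube 2" for n
      unfolding vec_eq_iff
    proof
      fix i
      have "n $ i = 0 \<or> n $ i = 1" using n1[OF that, of i] by linarith
      then show "grid_point h (k + n' n) $ i = (2 *\<^sub>R \<zeta> - grid_point h (k + n)) $ i"
        by (auto simp: \<zeta>_def c_def n'_def algebra_simps)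
    qed
    have n'n': "n' (n' n) = n" if "n \<in> index_cube 2" for n
      using n1[OF that] by (simp add: vec_eq_iff n'_def)
    have n'm: "n' n \<in> index_cube 2" for n by (auto simp: index_cube_def n'_def numeral_2_eq_2 less_Suc_eq_le)
    have "(\<Sum>n\<in>index_cube 2. f (grid_point h (k + n))) = (\<Sum>n\<in>index_cube 2. f (grid_point h (k + n' n)))"
      by (rule sum.reindex_bij_witness[of _ n' n']) (auto simp: n'n' n'm)
    also have "\<dots> = (\<Sum>n\<in>index_cube 2. f (2 *\<^sub>R \<zeta> - grid_point h (k + n)))"
      by (intro sum.cong refl) (simp add: refl_corner)
    finally have "2 * ?A = 1 / 2 ^ CARD('n) * (\<Sum>n\<in>index_cube 2. f (grid_point h (k + n)) + f (2 *\<^sub>R \<zeta> - grid_point h (k + n)))"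
      using k by (simp add: corner_mean_def sum.distrib)
    also have "\<dots> = corner_mean \<gamma> h k (\<lambda>\<xi>. f \<xi> + f (2 *\<^sub>R \<zeta> - \<xi>))"
      using k by (simp add: corner_mean_def)
    finally have A2: "2 * ?A = corner_mean \<gamma> h k (\<lambda>\<xi>. f \<xi> + f (2 *\<^sub>R \<zeta> - \<xi>))" .
    show ?thesis unfolding A2
    proof (rule corner_mean_deviation[OF k])
      fix n :: "nat ^ 'n" assume "n \<in> index_cube 2"
      from B2[OF grid_point_mem_element[OF h this]]
      show "\<bar>2 * f \<zeta> - (f (grid_point h (k + n)) + f (2 *\<^sub>R \<zeta> - grid_point h (k + n)))\<bar> \<le> B2"
        by (simp add: \<zeta>_def abs_minus_commute)
    qed
  qed
  have 2: "\<bar>LINT \<xi>:?I|lborel. f \<xi> - ?A\<bar> \<le> B2 * h ^ CARD('n)"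
  proof -
    have T: "signed_permutation (2 *\<^sub>R \<zeta>) (- 1) (\<lambda>i. i) \<xi> = 2 *\<^sub>R \<zeta> - \<xi>" for \<xi>
      by (simp add: signed_permutation_def vec_eq_iff)
    have gm: "(\<lambda>\<xi>. f \<xi> - ?A) \<in> borel_measurable borel" by measurable
    have pre: "signed_permutation (2 *\<^sub>R \<zeta>) (- 1) (\<lambda>i. i) -` ?I = ?I"
      by (auto simp: T refl_mem)
    have R: "(LINT \<xi>:?I|lborel. f (2 *\<^sub>R \<zeta> - \<xi>) - ?A) = (LINT \<xi>:?I|lborel. f \<xi> - ?A)"
      using set_integral_signed_permutation[OF _ _ gm element_borel pre] by (simp add: T)
    have Rint: "set_integrable lborel ?I (\<lambda>\<xi>. f (2 *\<^sub>R \<zeta> - \<xi>) - ?A)"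
    proof (rule set_integrable_bound[OF set_integrable_const_element[OF h, of k B1]])
      show "AE \<xi> in lborel. \<xi> \<in> ?I \<longrightarrow> norm (f (2 *\<^sub>R \<zeta> - \<xi>) - ?A) \<le> norm B1"
        using dev[of "2 *\<^sub>R \<zeta> - _"] by (intro AE_I2) (auto simp: refl_mem intro: order_trans[OF _ abs_ge_self])
    qed (simp add: set_borel_measurable_def)
    have "2 * (LINT \<xi>:?I|lborel. f \<xi> - ?A) = (LINT \<xi>:?I|lborel. (f \<xi> - ?A) + (f (2 *\<^sub>R \<zeta> - \<xi>) - ?A))"
      using set_integral_add(2)[OF gint Rint] R by simp
    \<comment> \<open>With \<zeta> the centre, the integrand is (f(\<xi>) + f(2\<zeta> - \<xi>) -
      2f(\<zeta>)) + (2f(\<zeta>) - 2A): one \<open>B2\<close> for each bracket.\<close>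
    also have "\<bar>\<dots>\<bar> \<le> (2 * B2) * h ^ CARD('n)"
    proof (rule abs_integral_element_le[OF h])
      fix \<xi> assume "\<xi> \<in> ?I"
      from B2[OF this] avg show "\<bar>(f \<xi> - ?A) + (f (2 *\<^sub>R \<zeta> - \<xi>) - ?A)\<bar> \<le> 2 * B2"
        unfolding \<zeta>_def[symmetric] by linarith
    qed
    finally show ?thesis by simp
  qed
  have "\<bar>?w \<zeta> * (LINT \<xi>:?I|lborel. f \<xi> - ?A)\<bar> \<le> W * (B2 * h ^ CARD('n))"
    unfolding abs_mult using W 2 by (intro mult_mono) (auto simp: \<zeta>_def intro: order_trans[OF weight_nonneg])
  then show ?thesis unfolding E using 1 by (simp add: algebra_simps)
qed

text \<open>The d unit vectors carry 2^d/d each. After the factor 1/2^d of the corner mean, the rule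
  on the first element is exact on constants.\<close>

lemma sum_corner_coeff_2:
  "(\<Sum>n\<in>(index_cube 2 :: (nat ^ 'n::finite) set) - {0}. corner_coeff 2 n) = 2 ^ CARD('n)"
proof -
  let ?S = "{n \<in> (index_cube 2 :: (nat ^ 'n) set) - {0}. (\<Sum>i\<in>UNIV. n $ i) = 1}"
  have S: "?S = range (\<lambda>i. axis i 1)"
  proof (intro equalityI subsetI)
    fix n assume n: "n \<in> ?S"
    then have "(\<Sum>i\<in>UNIV. n $ i) = Suc 0" by simp
    then obtain i where i: "n $ i = Suc 0" "\<forall>j\<in>UNIV. i \<noteq> j \<longrightarrow> n $ j = 0"
      unfolding sum_eq_Suc0_iff[OF finite] by blast
    have "n = axis i 1" using i by (auto simp: vec_eq_iff axis_def)
    then show "n \<in> range (\<lambda>i. axis i 1)" by blast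
  next
    fix n :: "nat ^ 'n" assume "n \<in> range (\<lambda>i. axis i 1)"
    then obtain i where n: "n = axis i 1" by blast
    have "(axis i 1 :: nat ^ 'n) \<in> index_cube 2" by (auto simp: index_cube_def axis_def)
    moreover have "(axis i 1 :: nat ^ 'n) \<noteq> 0" by (simp add: axis_eq_0_iff)
    moreover have "(\<Sum>j\<in>UNIV. (axis i 1 :: nat ^ 'n) $ j) = 1" by (simp add: axis_def)
    ultimately show "n \<in> ?S" unfolding n by blast
  qed
  have "card ?S = CARD('n)"
    unfolding S by (rule card_image) (auto simp: inj_on_def axis_eq_axis)
  moreover have "(\<Sum>n\<in>(index_cube 2 :: (nat ^ 'n) set) - {0}. corner_coeff 2 n)
    = (\<Sum>n\<in>?S. 2 ^ CARD('n) / real CARD('n))"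
    by (rule sum.mono_neutral_cong_right) (auto simp: finite_index_cube corner_coeff_def)
  ultimately show ?thesis by simp
qed

section \<open>Invariance of the rule under permutations of the coordinates\<close>

lemma norm_permute:
  fixes \<xi> :: "real ^ 'n::finite"
  assumes "bij \<tau>"
  shows "norm (\<chi> l. \<xi> $ \<tau> l) = norm \<xi>"
proof -
  have "(\<Sum>l\<in>UNIV. (norm (\<xi> $ \<tau> l))\<^sup>2) = (\<Sum>l\<in>UNIV. (norm (\<xi> $ l))\<^sup>2)"
    by (rule sum.reindex_bij_betw[OF assms])
  then show ?thesis by (simp add: norm_vec_def L2_set_def)
qed

text \<open>Norm, weight and corner coefficients are symmetric in the coordinates, and a permutation
  carries elements to elements and corners to corners. Hence permuting the element and permuting the
  argument of \<open>f\<close> amount to the same.\<close>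

lemma element_error_permute:
  fixes f :: "real ^ 'n::finite \<Rightarrow> real" and \<tau> :: "'n \<Rightarrow> 'n"
  assumes \<tau>: "bij \<tau>" and [measurable]: "f \<in> borel_measurable borel"
  shows "element_error \<alpha> lam \<gamma> h (\<chi> l. k $ \<tau> l) f = element_error \<alpha> lam \<gamma> h k (\<lambda>\<xi>. f (\<chi> l. \<xi> $ \<tau> l))"
proof -
  define P :: "nat ^ 'n \<Rightarrow> nat ^ 'n" where "P k = (\<chi> l. k $ \<tau> l)" for k
  define T :: "real ^ 'n \<Rightarrow> real ^ 'n" where "T = signed_permutation 0 1 \<tau>"
  have T: "T \<xi> = (\<chi> l. \<xi> $ \<tau> l)" for \<xi> by (simp add: T_def signed_permutation_def)
  define \<sigma> where "\<sigma> = inv \<tau>"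
  have \<sigma>: "\<tau> (\<sigma> j) = j" "\<sigma> (\<tau> j) = j" for j
    using \<tau> by (auto simp: \<sigma>_def bij_def surj_f_inv_f)
  have sumP: "(\<Sum>i\<in>UNIV. g (\<tau> i)) = (\<Sum>i\<in>UNIV. g i)" for g :: "'n \<Rightarrow> 'b::comm_monoid_add"
    by (rule sum.reindex_bij_betw) (use \<tau> in simp)
  have nT: "norm (T \<xi>) = norm \<xi>" for \<xi>
    unfolding T by (rule norm_permute[OF \<tau>])
  then have wT: "weight \<alpha> lam \<gamma> (T \<xi>) = weight \<alpha> lam \<gamma> \<xi>" for \<xi> by (simp add: weight_def)
  have eq0: "P k = 0 \<longleftrightarrow> k = 0" for k by (auto simp: P_def vec_eq_iff) (metis \<sigma>(1))
  have pre: "T -` element h (P k) = element h k" for k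
    by (auto simp: mem_element T P_def) (metis \<sigma>(1))+
  have int: "(LINT \<xi>:element h k|lborel. g (T \<xi>)) = (LINT \<xi>:element h (P k)|lborel. g \<xi>)"
    if "g \<in> borel_measurable borel" for g :: "real ^ 'n \<Rightarrow> real" and k
    unfolding T_def
    by (rule set_integral_signed_permutation) (use that \<tau> pre in \<open>auto simp: T_def\<close>)
  have g: "grid_point h (P k) = T (grid_point h k)" for k by (simp add: T P_def vec_eq_iff)
  have add: "P k + P n = P (k + n)" for k n by (simp add: P_def vec_eq_iff)
  have cc: "corner_coeff \<gamma> (P n) = corner_coeff \<gamma> n" for n
    unfolding corner_coeff_def P_def by (simp add: sumP)
  have cm: "corner_mean \<gamma> h (P k) f = corner_mean \<gamma> h k (\<lambda>\<xi>. f (T \<xi>))"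
  proof -
    define P' :: "nat ^ 'n \<Rightarrow> nat ^ 'n" where "P' k = (\<chi> l. k $ \<sigma> l)" for k
    have PP: "P (P' k) = k" "P' (P k) = k" for k by (auto simp: P_def P'_def vec_eq_iff \<sigma>)
    have mem: "n \<in> index_cube 2 \<Longrightarrow> P n \<in> index_cube 2" "n \<in> index_cube 2 \<Longrightarrow> P' n \<in> index_cube 2" for n
      by (auto simp: index_cube_def P_def P'_def)
    have eq0': "P' n = 0 \<longleftrightarrow> n = 0" for n using eq0[of "P' n"] by (simp add: PP)
    have re: "(\<Sum>n\<in>index_cube 2. G n) = (\<Sum>n\<in>index_cube 2. G (P n))" for G :: "nat ^ 'n \<Rightarrow> real"
      by (rule sum.reindex_bij_witness[of _ P P']) (simp_all add: PP mem)
    have re0: "(\<Sum>n\<in>index_cube 2 - {0}. G n) = (\<Sum>n\<in>index_cube 2 - {0}. G (P n))" for G :: "nat ^ 'n \<Rightarrow> real"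
      by (rule sum.reindex_bij_witness[of _ P P']) (simp_all add: PP mem eq0 eq0')
    show ?thesis
      unfolding corner_mean_def eq0 re[of "\<lambda>n. f (grid_point h (P k + n))"] re0[of "\<lambda>n. corner_coeff \<gamma> n * f (grid_point h n)"]
      by (simp add: cc add g)
  qed
  have "(LINT \<xi>:element h (P k)|lborel. f \<xi> * weight \<alpha> lam \<gamma> \<xi>) = (LINT \<xi>:element h k|lborel. f (T \<xi>) * weight \<alpha> lam \<gamma> \<xi>)"
    using int[of "\<lambda>\<xi>. f \<xi> * weight \<alpha> lam \<gamma> \<xi>"] by (simp add: wT)
  moreover have "(LINT \<xi>:element h (P k)|lborel. weight \<alpha> lam \<gamma> \<xi>) = (LINT \<xi>:element h k|lborel. weight \<alpha> lam \<gamma> \<xi>)"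
    using int[of "weight \<alpha> lam \<gamma>"] by (simp add: wT)
  ultimately show ?thesis unfolding element_error_def P_def[symmetric] T[symmetric] cm by simp
qed

lemma sum_component_square: "(\<Sum>i\<in>UNIV. (\<xi> $ i)\<^sup>2) = (norm (\<xi> :: real ^ 'n::finite))\<^sup>2"
  by (simp add: norm_vec_def L2_set_def sum_nonneg)

text \<open>The errors for \<open>\<xi>\<^sub>i\<^sup>2 / |\<xi>|\<^sup>2\<close> are equal for all \<open>i\<close> by symmetry, and they add up to the error
  for the constant \<open>1\<close>, on which the quadrature rule is exact.\<close>

lemma sum_element_error_homogeneous:
  assumes "\<alpha> < 2" "0 \<le> lam" "0 < h"
  shows "(\<Sum>k\<in>index_cube N. element_error \<alpha> lam 2 h k (\<lambda>\<xi>::real ^ 'n::finite. (\<xi> $ i)\<^sup>2 / (norm \<xi>)\<^sup>2)) = 0"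
proof -
  let ?q = "\<lambda>i. \<lambda>\<xi>::real ^ 'n. (\<xi> $ i)\<^sup>2 / (norm \<xi>)\<^sup>2"
  let ?E = "\<lambda>i. \<Sum>k\<in>index_cube N. element_error \<alpha> lam 2 h k (?q i)"
  have qm: "?q i \<in> borel_measurable borel" for i by measurable
  have w: "set_integrable lborel (element h k :: (real ^ 'n) set) (weight \<alpha> lam 2)" for k
    by (rule set_integrable_weight) (use assms in auto)
  have q1: "\<bar>?q i \<xi>\<bar> \<le> 1" for i \<xi>
    using component_le_norm_cart[of \<xi> i] by (auto simp: divide_le_eq_1 abs_le_square_iff[symmetric])
  have qw: "set_integrable lborel (element h k) (\<lambda>\<xi>. ?q i \<xi> * weight \<alpha> lam 2 \<xi>)" for k i
  proof (rule set_integrable_bound[OF w[of k]])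
    show "AE \<xi> in lborel. \<xi> \<in> element h k \<longrightarrow> norm (?q i \<xi> * weight \<alpha> lam 2 \<xi>) \<le> norm (weight \<alpha> lam 2 \<xi>)"
      unfolding real_norm_def abs_mult by (intro AE_I2 impI mult_left_le_one_le q1) auto
  qed (simp add: set_borel_measurable_def)
  have eq: "?E i = ?E j" for i j
  proof -
    \<comment> \<open>The transposition exchanges \<open>?q i\<close> with \<open>?q j\<close> and
      only rearranges the elements of the cube.\<close>
    define \<tau> where "\<tau> = Transposition.transpose i j"
    have \<tau>: "bij \<tau>" "\<tau> (\<tau> l) = l" for l by (auto simp: \<tau>_def)
    have "norm (\<chi> l. \<xi> $ \<tau> l) = norm \<xi>" for \<xi> :: "real ^ 'n"
      by (rule norm_permute[OF \<tau>(1)])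
    then have "?q i (\<chi> l. \<xi> $ \<tau> l) = ?q j \<xi>" for \<xi>
      by (simp add: \<tau>_def)
    then have "element_error \<alpha> lam 2 h (\<chi> l. k $ \<tau> l) (?q i) = element_error \<alpha> lam 2 h k (?q j)" for k
      using element_error_permute[OF \<tau>(1) qm[of i], of \<alpha> lam 2 h k] by simp
    moreover have "?E i = (\<Sum>k\<in>index_cube N. element_error \<alpha> lam 2 h (\<chi> l. k $ \<tau> l) (?q i))"
      by (rule sum.reindex_bij_witness[of _ "\<lambda>k. \<chi> l. k $ \<tau> l" "\<lambda>k. \<chi> l. k $ \<tau> l"])
        (auto simp: \<tau> index_cube_def vec_eq_iff)
    ultimately show ?thesis by simp
  qed
  have "(\<Sum>i\<in>UNIV. ?E i) = (\<Sum>k\<in>index_cube N. \<Sum>i\<in>UNIV. element_error \<alpha> lam 2 h k (?q i))"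
    by (rule sum.swap)
  also have "\<dots> = (\<Sum>k\<in>index_cube N. element_error \<alpha> lam 2 h k (\<lambda>\<xi>. \<Sum>i\<in>UNIV. ?q i \<xi>))"
    using qw by (intro sum.cong refl) (simp add: element_error_sum)
  also have "\<dots> = 0"
  proof (rule sum.neutral, rule ballI)
    fix k :: "nat ^ 'n"
    \<comment> \<open>At the origin \<open>0 / 0 = 0\<close> makes the sum 0 instead of 1. This is
      harmless: the weight vanishes there, and the origin is a corner of the first element only,
      whose mean leaves it out.\<close>
    have s: "(\<Sum>i\<in>UNIV. ?q i \<xi>) = (if \<xi> = 0 then 0 else 1)" for \<xi>
      by (simp add: sum_divide_distrib[symmetric] sum_component_square)
    have "weight \<alpha> lam 2 (0 :: real ^ 'n) = 0" by (simp add: weight_def)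
    then have "(\<lambda>\<xi>. (\<Sum>i\<in>UNIV. ?q i \<xi>) * weight \<alpha> lam 2 \<xi>) = weight \<alpha> lam 2"
      by (auto simp: s fun_eq_iff)
    moreover have "corner_mean 2 h k (\<lambda>\<xi>. \<Sum>i\<in>UNIV. ?q i \<xi>) = 1"
    proof -
      have nz: "grid_point h n = (0 :: real ^ 'n) \<longleftrightarrow> n = 0" for n :: "nat ^ 'n"
        using assms by (simp add: vec_eq_iff)
      have add0: "k + n = 0 \<longleftrightarrow> k = 0 \<and> n = 0" for n by (auto simp: vec_eq_iff)
      have "(\<Sum>n\<in>index_cube 2 - {0 :: nat ^ 'n}. corner_coeff 2 n * (if n = 0 then 0 else 1)) = (\<Sum>n\<in>index_cube 2 - {0 :: nat ^ 'n}. corner_coeff 2 n)"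
        by (intro sum.cong) auto
      then show ?thesis
        unfolding s corner_mean_def nz add0 by (auto simp: sum_corner_coeff_2 card_index_cube)
    qed
    ultimately show "element_error \<alpha> lam 2 h k (\<lambda>\<xi>. \<Sum>i\<in>UNIV. ?q i \<xi>) = 0"
      by (simp add: element_error_def)
  qed
  finally have "(\<Sum>l\<in>(UNIV :: 'n set). ?E i) = 0" using eq by (metis (mono_tags, lifting) sum.cong)
  then show ?thesis by simp
qed

section \<open>Hoelder continuous functions\<close>

text \<open>The constant of \<open>set_integral_norm_powr_le\<close>.\<close>

definition cube_const :: "nat \<Rightarrow> real \<Rightarrow> real" where
  "cube_const d p = real d powr (p - min p 0) * (2 / (min p 0 / real d + 1)) ^ d"

lemma cube_const_nonneg: "0 < d \<Longrightarrow> - real d < p \<Longrightarrow> 0 \<le> cube_const d p"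
  unfolding cube_const_def
  by (intro mult_nonneg_nonneg zero_le_power divide_nonneg_nonneg) (auto simp: min_def field_simps)

lemma element_0_integral_powr:
  assumes "0 \<le> h" "- real CARD('n) < p"
  shows "set_integrable lborel (element h 0) (\<lambda>\<xi>::real ^ 'n::finite. norm \<xi> powr p)"
    and "(LINT \<xi>:element h 0|lborel. norm (\<xi> :: real ^ 'n) powr p) \<le> cube_const CARD('n) p * h powr (real CARD('n) + p)"
  unfolding cube_const_def
  using set_integrable_norm_powr[OF assms element_0_subset element_borel]
    set_integral_norm_powr_le[OF assms element_0_subset element_borel] by auto

lemma element_0_integral_weight:
  assumes "0 \<le> h" "\<alpha> < \<gamma>" "0 \<le> lam"
  shows "(LINT \<xi>:(element h 0 :: (real ^ 'n::finite) set)|lborel. weight \<alpha> lam \<gamma> \<xi>)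
    \<le> cube_const CARD('n) (\<gamma> - (real CARD('n) + \<alpha>)) * h powr (\<gamma> - \<alpha>)"
proof -
  let ?p = "\<gamma> - (real CARD('n) + \<alpha>)"
  have p: "- real CARD('n) < ?p" using assms by simp
  have "(LINT \<xi>:(element h 0 :: (real ^ 'n) set)|lborel. weight \<alpha> lam \<gamma> \<xi>)
      \<le> (LINT \<xi>:(element h 0 :: (real ^ 'n) set)|lborel. norm \<xi> powr ?p)"
    by (rule set_integral_mono)
      (use assms p in \<open>auto intro: set_integrable_weight element_0_integral_powr weight_le_powr\<close>)
  also have "\<dots> \<le> cube_const CARD('n) ?p * h powr (real CARD('n) + ?p)"
    by (rule element_0_integral_powr[OF assms(1) p])
  finally show ?thesis by simp
qed

lemma norm_corner_0:
  assumes h: "0 < h" and n: "n \<in> index_cube 2" "n \<noteq> 0"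
  shows "h \<le> norm (grid_point h n :: real ^ 'n::finite)"
    and "norm (grid_point h n :: real ^ 'n) \<le> (1 + real CARD('n)) * h"
proof -
  show "h \<le> norm (grid_point h n :: real ^ 'n)" by (rule norm_grid_point_ge) (use h n in auto)
  have "grid_point h (0 + n) \<in> (element h 0 :: (real ^ 'n) set)"
    by (rule grid_point_mem_element) (use h n in auto)
  moreover have "0 \<in> (element h 0 :: (real ^ 'n) set)" using h by (simp add: mem_element)
  ultimately have "norm (grid_point h n - 0 :: real ^ 'n) \<le> real CARD('n) * h"
    using norm_diff_element by fastforce
  then show "norm (grid_point h n :: real ^ 'n) \<le> (1 + real CARD('n)) * h" using h by (simp add: algebra_simps)
qed

lemma abs_sum_index_cube_le:
  fixes f :: "nat ^ 'n::finite \<Rightarrow> real"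
  assumes "\<bar>f 0\<bar> \<le> A" "\<And>k. k \<in> index_cube N - {0} \<Longrightarrow> \<bar>f k\<bar> \<le> c * g k" "0 \<le> c" "(\<Sum>k\<in>index_cube N - {0}. g k) \<le> B"
  shows "\<bar>\<Sum>k\<in>index_cube N. f k\<bar> \<le> A + c * B"
proof -
  have "\<bar>\<Sum>k\<in>index_cube N. f k\<bar> \<le> (\<Sum>k\<in>index_cube N. \<bar>f k\<bar>)" by (rule sum_abs)
  \<comment> \<open>For \<open>N = 0\<close> the cube is empty, so the index \<open>0\<close> is
    inserted rather than split off.\<close>
  also have "\<dots> \<le> (\<Sum>k\<in>insert 0 (index_cube N - {0}). \<bar>f k\<bar>)"
    by (rule sum_mono2) (auto simp: finite_index_cube)
  also have "\<dots> = \<bar>f 0\<bar> + (\<Sum>k\<in>index_cube N - {0}. \<bar>f k\<bar>)"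
    by (subst sum.insert) (auto simp: finite_index_cube)
  also have "\<dots> \<le> A + (\<Sum>k\<in>index_cube N - {0}. c * g k)"
    using assms(1,2) by (intro add_mono sum_mono) auto
  also have "\<dots> \<le> A + c * B"
    unfolding sum_distrib_left[symmetric] using assms(3,4) by (intro add_left_mono mult_left_mono)
  finally show ?thesis .
qed

text \<open>By scaling, the integral of |\<xi>|^(q+p) over the first element is at most a multiple
  of h^(d+q+p), and d + p = \<gamma> - \<alpha>. The exponent q is \<open>s - \<gamma>\<close> for
  Hoelder continuous \<open>u\<close>, and \<open>s\<close> for the Taylor remainder divided by
  |\<xi>|^2.\<close>

lemma element_error_zero_le:
  fixes f :: "real ^ 'n::finite \<Rightarrow> real" and q \<alpha> \<gamma> :: real
  defines "p \<equiv> \<gamma> - (real CARD('n) + \<alpha>)"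
  assumes h: "0 < h" and f: "\<And>\<xi>. \<bar>f \<xi>\<bar> \<le> A * norm \<xi> powr q" and A: "0 \<le> A"
    and \<gamma>: "\<alpha> < \<gamma>" "\<alpha> < \<gamma> + q" and lam: "0 \<le> lam"
  shows "\<bar>element_error \<alpha> lam \<gamma> h 0 f\<bar> \<le> A * (cube_const CARD('n) (q + p)
      + 2 ^ CARD('n) * (1 + real CARD('n)) powr \<bar>q\<bar> * cube_const CARD('n) p) * h powr (q + (\<gamma> - \<alpha>))"
proof -
  let ?d = "real CARD('n)" and ?I = "element h 0 :: (real ^ 'n) set" and ?w = "weight \<alpha> lam \<gamma> :: real ^ 'n \<Rightarrow> real"
  let ?D = "1 + ?d"
  have qp: "- ?d < q + p" using \<gamma> by (simp add: p_def)
  note K = element_0_integral_powr[OF less_imp_le[OF h] qp]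
  have "\<bar>LINT \<xi>:?I|lborel. f \<xi> * ?w \<xi>\<bar> \<le> (LINT \<xi>:?I|lborel. A * norm \<xi> powr (q + p))"
  proof (rule set_integral_abs_le)
    show "set_integrable lborel ?I (\<lambda>\<xi>. A * norm \<xi> powr (q + p))" using K(1) by simp
    fix \<xi> :: "real ^ 'n"
    have "\<bar>f \<xi> * ?w \<xi>\<bar> \<le> (A * norm \<xi> powr q) * norm \<xi> powr p"
      unfolding abs_mult p_def using f weight_le_powr[OF lam] A by (intro mult_mono) auto
    then show "\<bar>f \<xi> * ?w \<xi>\<bar> \<le> A * norm \<xi> powr (q + p)"
      by (simp only: mult.assoc powr_add[symmetric])
  qed
  also have "\<dots> = A * (LINT \<xi>:?I|lborel. norm \<xi> powr (q + p))" by simp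
  also have "\<dots> \<le> A * (cube_const CARD('n) (q + p) * h powr (?d + (q + p)))"
    by (rule mult_left_mono[OF K(2) A])
  also have "?d + (q + p) = q + (\<gamma> - \<alpha>)" by (simp add: p_def)
  finally have X: "\<bar>LINT \<xi>:?I|lborel. f \<xi> * ?w \<xi>\<bar> \<le> A * (cube_const CARD('n) (q + p) * h powr (q + (\<gamma> - \<alpha>)))" .
  have F: "\<bar>f (grid_point h n)\<bar> \<le> A * (?D powr \<bar>q\<bar> * h powr q)" if n: "n \<in> index_cube 2" "n \<noteq> 0" for n
    using norm_corner_0[OF h n] h A by (intro order_trans[OF f] mult_left_mono powr_comparable) auto
  have "\<bar>element_error \<alpha> lam \<gamma> h 0 f\<bar> \<le> A * (cube_const CARD('n) (q + p) * h powr (q + (\<gamma> - \<alpha>)))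
      + 2 ^ CARD('n) * (A * (?D powr \<bar>q\<bar> * h powr q)) * (LINT \<xi>:?I|lborel. ?w \<xi>)"
    by (rule element_error_zero[OF X F]) (use A in auto)
  also have "\<dots> \<le> A * (cube_const CARD('n) (q + p) * h powr (q + (\<gamma> - \<alpha>)))
      + 2 ^ CARD('n) * (A * (?D powr \<bar>q\<bar> * h powr q)) * (cube_const CARD('n) p * h powr (\<gamma> - \<alpha>))"
    using element_0_integral_weight[OF _ \<gamma>(1) lam, of h, where 'n = 'n] h A
    unfolding p_def by (intro add_left_mono mult_left_mono) auto
  also have "\<dots> = A * (cube_const CARD('n) (q + p)
      + 2 ^ CARD('n) * ?D powr \<bar>q\<bar> * cube_const CARD('n) p) * h powr (q + (\<gamma> - \<alpha>))"
    unfolding powr_add[of h q "\<gamma> - \<alpha>"] by (simp add: algebra_simps)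
  finally show ?thesis .
qed

text \<open>\<open>phi\<close> is g |\<xi>|^(-\<gamma>) with g Hoelder continuous and zero at the
  origin. On an element at distance m from the origin its oscillation is at most a multiple of h^s
  m^(-\<gamma>), the weight is at most a multiple of m^(\<gamma>-d-\<alpha>), and \<gamma> cancels.
  The constant is uniform in \<open>x\<close>, as the supremum norm requires.\<close>

lemma sum_element_error_holder:
  fixes u :: "real ^ 'n::finite \<Rightarrow> real"
  assumes H: "\<And>x y. \<bar>u x - u y\<bar> \<le> H * norm (x - y) powr s" and H0: "0 \<le> H"
    and s: "\<alpha> < s" "s \<le> 1" and \<alpha>: "0 < \<alpha>" and lam: "0 \<le> lam" and \<gamma>: "\<alpha> < \<gamma>"
  shows "\<exists>C>0. \<forall>x h N. 0 < h \<longrightarrow>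
      (\<forall>k. set_integrable lborel (element h k) (\<lambda>\<xi>. phi \<gamma> u x \<xi> * weight \<alpha> lam \<gamma> \<xi>)) \<longrightarrow>
      \<bar>\<Sum>k\<in>index_cube N. element_error \<alpha> lam \<gamma> h k (phi \<gamma> u x)\<bar> \<le> C * h powr (s - \<alpha>)"
proof -
  let ?d = "real CARD('n)"
  define D where "D = 1 + ?d"
  have D1: "1 \<le> D" by (simp add: D_def)
  define A where "A = 2 ^ CARD('n) * H"
  have A: "0 \<le> A" using H0 by (simp add: A_def)
  obtain C3 where C3: "C3 > 0" "\<And>N h. 0 < h \<Longrightarrow>
    (\<Sum>k\<in>index_cube N - {0}. norm (grid_point h k :: real ^ 'n) powr (- (?d + \<alpha>)) * h ^ CARD('n)) \<le> C3 * h powr (- \<alpha>)"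
    using sum_grid_far[OF \<alpha>, where 'n = 'n] by blast
  let ?p = "\<gamma> - (?d + \<alpha>)"
  \<comment> \<open>One summand for each term of the product rule: the increment of g over a
    distance of at most d h, and that of |\<xi>|^(-\<gamma>), where g is bounded through |\<eta>|
    \<le> D m.\<close>
  define C1 where "C1 = A * (?d powr s + D powr s * \<gamma> * ?d)"
  define C2 where "C2 = D powr \<bar>?p\<bar>"
  define C4 where "C4 = A * (cube_const CARD('n) ((s - \<gamma>) + ?p) + 2 ^ CARD('n) * D powr \<bar>s - \<gamma>\<bar> * cube_const CARD('n) ?p)"
  have \<gamma>0: "0 < \<gamma>" using \<gamma> \<alpha> by simp
  have C1: "0 \<le> C1" using A \<gamma>0 by (simp add: C1_def)
  have C2: "0 \<le> C2" by (simp add: C2_def)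
  have C4: "0 \<le> C4"
    using A s \<gamma> by (auto simp: C4_def intro!: mult_nonneg_nonneg add_nonneg_nonneg cube_const_nonneg)
  show ?thesis
  proof (intro exI[of _ "C4 + C1 * C2 * C3 + 1"] conjI allI impI)
    show "0 < C4 + C1 * C2 * C3 + 1" using C1 C2 C3(1) C4 by (simp add: add_nonneg_pos)
    fix x :: "real ^ 'n" and h :: real and N
    assume h: "0 < h" and int: "\<forall>k. set_integrable lborel (element h k) (\<lambda>\<xi>. phi \<gamma> u x \<xi> * weight \<alpha> lam \<gamma> \<xi>)"
    let ?f = "phi \<gamma> u x"
    let ?E = "\<lambda>k. element_error \<alpha> lam \<gamma> h k ?f" and ?m = "\<lambda>k. norm (grid_point h k :: real ^ 'n)"
    define g where "g \<xi> = (\<Sum>e\<in>signs. u (x + e * \<xi>)) - 2 ^ CARD('n) * u x" for \<xi>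
    have phi: "?f \<xi> = g \<xi> * norm \<xi> powr (- \<gamma>)" for \<xi>
      by (simp add: phi_eq_signs g_def powr_minus divide_inverse)
    have gdiff: "\<bar>g \<xi> - g \<eta>\<bar> \<le> A * norm (\<xi> - \<eta>) powr s" for \<xi> \<eta>
    proof -
      have "g \<xi> - g \<eta> = (\<Sum>e\<in>signs. u (x + e * \<xi>) - u (x + e * \<eta>))"
        by (simp add: g_def sum_subtractf)
      also have "\<bar>\<dots>\<bar> \<le> (\<Sum>e\<in>(signs :: (real ^ 'n) set). H * norm (\<xi> - \<eta>) powr s)"
      proof (rule order_trans[OF sum_abs sum_mono])
        fix e :: "real ^ 'n" assume "e \<in> signs"
        moreover have "(x + e * \<xi>) - (x + e * \<eta>) = e * (\<xi> - \<eta>)" by (simp add: vec_eq_iff algebra_simps)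
        ultimately show "\<bar>u (x + e * \<xi>) - u (x + e * \<eta>)\<bar> \<le> H * norm (\<xi> - \<eta>) powr s"
          using H[of "x + e * \<xi>" "x + e * \<eta>"] by simp
      qed
      finally show ?thesis by (simp add: card_signs A_def)
    qed
    have "g 0 = 0"
    proof -
      have "e * 0 = (0 :: real ^ 'n)" for e by (simp add: vec_eq_iff)
      then show ?thesis by (simp add: g_def card_signs)
    qed
    then have gle: "\<bar>g \<xi>\<bar> \<le> A * norm \<xi> powr s" for \<xi> using gdiff[of \<xi> 0] by simp
    have phi_le: "\<bar>?f \<xi>\<bar> \<le> A * norm \<xi> powr (s - \<gamma>)" for \<xi>
    proof -
      have "\<bar>?f \<xi>\<bar> \<le> A * norm \<xi> powr s * norm \<xi> powr (- \<gamma>)"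
        unfolding phi abs_mult using gle A by (intro mult_mono) auto
      then show ?thesis by (simp add: mult.assoc powr_add[symmetric])
    qed
    have E0: "\<bar>?E 0\<bar> \<le> C4 * h powr ((s - \<gamma>) + (\<gamma> - \<alpha>))"
      unfolding C4_def D_def by (rule element_error_zero_le[OF h phi_le A \<gamma> _ lam]) (use s in simp)
    have Ek: "\<bar>?E k\<bar>
        \<le> C1 * C2 * h powr s * (?m k powr (- (?d + \<alpha>)) * h ^ CARD('n))"
      if k: "k \<noteq> 0" for k
    proof -
      define m where "m = ?m k"
      have hm: "h \<le> m" unfolding m_def by (rule norm_grid_point_ge) (use h k in auto)
      have m: "0 < m" using h hm by simp
      have lo: "m \<le> norm \<xi>" if "\<xi> \<in> element h k" for \<xi> :: "real ^ 'n"
        unfolding m_def by (rule norm_element_ge) (use h that in auto)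
      have hi: "norm \<xi> \<le> D * m" if "\<xi> \<in> element h k" for \<xi> :: "real ^ 'n"
        unfolding m_def D_def by (rule norm_element_le) (use h k that in auto)
      \<comment> \<open>Brings the Lipschitz increment of |\<xi>|^(-\<gamma>) to the scale h^s: by s
        \<le> 1 and h \<le> m the surplus m^(s-1) is at most h^(s-1).\<close>
      have hs: "m powr (s - 1) * h \<le> h powr s"
      proof -
        have "m powr (s - 1) * h \<le> h powr (s - 1) * h"
          using h hm s by (intro mult_right_mono powr_mono2') auto
        also have "\<dots> = h powr s" using h powr_add[of h "s - 1" 1] by simp
        finally show ?thesis .
      qed
      have B: "\<bar>?f \<xi> - ?f \<eta>\<bar> \<le> C1 * h powr s * m powr (- \<gamma>)"
        if \<xi>: "\<xi> \<in> element h k" and \<eta>: "\<eta> \<in> element h k" for \<xi> \<eta>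
      proof -
        have dist: "norm (\<xi> - \<eta>) \<le> ?d * h" by (rule norm_diff_element[OF \<xi> \<eta>])
        have "?f \<xi> - ?f \<eta> = (g \<xi> - g \<eta>) * norm \<xi> powr (- \<gamma>) + g \<eta> * (norm \<xi> powr (- \<gamma>) - norm \<eta> powr (- \<gamma>))"
          by (simp add: phi algebra_simps)
        also have "\<bar>\<dots>\<bar> \<le> \<bar>g \<xi> - g \<eta>\<bar> * norm \<xi> powr (- \<gamma>) + \<bar>g \<eta>\<bar> * \<bar>norm \<xi> powr (- \<gamma>) - norm \<eta> powr (- \<gamma>)\<bar>"
          by (rule order_trans[OF abs_triangle_ineq]) (simp add: abs_mult)
        also have "\<dots> \<le> (A * (?d powr s * h powr s)) * m powr (- \<gamma>) + (A * (D powr s * m powr s)) * (\<gamma> * m powr (- \<gamma> - 1) * (?d * h))"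
        proof (rule add_mono; rule mult_mono)
          have "norm (\<xi> - \<eta>) powr s \<le> (?d * h) powr s" using dist s \<alpha> by (intro powr_mono2) auto
          then have "A * norm (\<xi> - \<eta>) powr s \<le> A * (?d * h) powr s" using A by (rule mult_left_mono)
          then show "\<bar>g \<xi> - g \<eta>\<bar> \<le> A * (?d powr s * h powr s)"
            using gdiff[of \<xi> \<eta>] h by (simp add: powr_mult)
          show "norm \<xi> powr (- \<gamma>) \<le> m powr (- \<gamma>)" using lo[OF \<xi>] m \<gamma>0 by (intro powr_mono2') auto
          have "norm \<eta> powr s \<le> (D * m) powr s" using hi[OF \<eta>] s \<alpha> by (intro powr_mono2) auto
          then have "A * norm \<eta> powr s \<le> A * (D * m) powr s" using A by (rule mult_left_mono)
          then show "\<bar>g \<eta>\<bar> \<le> A * (D powr s * m powr s)"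
            using gle[of \<eta>] m D1 by (simp add: powr_mult)
          have "\<bar>norm \<xi> powr (- \<gamma>) - norm \<eta> powr (- \<gamma>)\<bar> \<le> \<bar>- \<gamma>\<bar> * m powr (- \<gamma> - 1) * \<bar>norm \<xi> - norm \<eta>\<bar>"
            by (rule powr_diff_le) (use m lo[OF \<xi>] lo[OF \<eta>] \<gamma>0 in auto)
          also have "\<dots> \<le> \<gamma> * m powr (- \<gamma> - 1) * (?d * h)"
            using \<gamma>0 order_trans[OF norm_triangle_ineq3 dist] by (intro mult_mono) auto
          finally show "\<bar>norm \<xi> powr (- \<gamma>) - norm \<eta> powr (- \<gamma>)\<bar> \<le> \<gamma> * m powr (- \<gamma> - 1) * (?d * h)" .
        qed (use A \<gamma>0 h in auto)
        also have "\<dots> = A * ?d powr s * h powr s * m powr (- \<gamma>) + A * D powr s * \<gamma> * ?d * (m powr s * m powr (- \<gamma> - 1) * h)"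
          by (simp only: mult_ac)
        also have "m powr s * m powr (- \<gamma> - 1) * h = m powr (- \<gamma>) * (m powr (s - 1) * h)"
          by (simp only: powr_add[symmetric] mult.assoc[symmetric]) (simp add: algebra_simps)
        also have "A * ?d powr s * h powr s * m powr (- \<gamma>) + A * D powr s * \<gamma> * ?d * (m powr (- \<gamma>) * (m powr (s - 1) * h))
            \<le> A * ?d powr s * h powr s * m powr (- \<gamma>) + A * D powr s * \<gamma> * ?d * (m powr (- \<gamma>) * h powr s)"
          using hs A \<gamma>0 by (intro add_left_mono mult_left_mono) auto
        also have "\<dots> = C1 * h powr s * m powr (- \<gamma>)" by (simp add: C1_def algebra_simps)
        finally show ?thesis .
      qed
      have W: "weight \<alpha> lam \<gamma> \<xi> \<le> C2 * m powr ?p" if \<xi>: "\<xi> \<in> element h k" for \<xi> :: "real ^ 'n"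
        unfolding C2_def
        by (rule order_trans[OF weight_le_powr[OF lam] powr_comparable]) (use m lo[OF \<xi>] hi[OF \<xi>] D1 in auto)
      have "\<bar>?E k\<bar> \<le> (C1 * h powr s * m powr (- \<gamma>)) * (C2 * m powr ?p) * h ^ CARD('n)"
        by (rule element_error_rough[OF _ k]) (use h int B W set_integrable_weight[OF \<gamma> lam] in auto)
      also have "\<dots> = C1 * C2 * h powr s * ((m powr (- \<gamma>) * m powr ?p) * h ^ CARD('n))"
        by (simp only: mult_ac)
      also have "m powr (- \<gamma>) * m powr ?p = m powr (- (?d + \<alpha>))" by (simp add: powr_add[symmetric])
      finally show ?thesis by (simp add: m_def)
    qed
    have "\<bar>\<Sum>k\<in>index_cube N. ?E k\<bar> \<le> C4 * h powr ((s - \<gamma>) + (\<gamma> - \<alpha>)) + C1 * C2 * h powr s * (C3 * h powr (- \<alpha>))"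
      by (rule abs_sum_index_cube_le[OF E0 Ek _ C3(2)[OF h]]) (use C1 C2 in auto)
    also have "\<dots> = C4 * h powr (s - \<alpha>) + C1 * C2 * C3 * (h powr s * h powr (- \<alpha>))"
      by (simp add: mult_ac)
    also have "h powr s * h powr (- \<alpha>) = h powr (s - \<alpha>)" by (simp add: powr_add[symmetric])
    also have "C4 * h powr (s - \<alpha>) + C1 * C2 * C3 * h powr (s - \<alpha>) \<le> (C4 + C1 * C2 * C3 + 1) * h powr (s - \<alpha>)"
      by (simp add: algebra_simps)
    finally show "\<bar>\<Sum>k\<in>index_cube N. ?E k\<bar> \<le> (C4 + C1 * C2 * C3 + 1) * h powr (s - \<alpha>)" .
  qed
qed

section \<open>Twice differentiable functions\<close>

text \<open>With A = |c|^2, b = 2 c.v and E = |v|^2, the squared norms at c + v and c - v are A + b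
  + E and A - b + E, and clearing denominators leaves 2 (b^2 - E (A + E)) in the numerator. Each
  term is at most a multiple of A E, so a factor A cancels: 5 + B^2 is made of 4 from b^2 by
  Cauchy-Schwarz, 1 from E A and B^2 from E E.\<close>

lemma second_difference_inverse_square:
  fixes c v :: "'a::real_inner"
  assumes m: "0 < m" "m \<le> norm c" "m \<le> norm (c + v)" "m \<le> norm (c - v)" and B: "norm v \<le> B * m"
  shows "\<bar>1 / (norm (c + v))\<^sup>2 + 1 / (norm (c - v))\<^sup>2 - 2 * (1 / (norm c)\<^sup>2)\<bar> \<le> 2 * (5 + B\<^sup>2) * (norm v)\<^sup>2 / m ^ 4"
proof -
  define A b E where "A = (norm c)\<^sup>2" and "b = 2 * (c \<bullet> v)" and "E = (norm v)\<^sup>2"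
  define X Y where "X = (norm (c + v))\<^sup>2" and "Y = (norm (c - v))\<^sup>2"
  have X: "X = A + b + E" and Y: "Y = A - b + E"
    by (simp_all add: X_def Y_def A_def b_def E_def power2_norm_eq_inner algebra_simps inner_commute)
  have m2: "m\<^sup>2 \<le> A" "m\<^sup>2 \<le> X" "m\<^sup>2 \<le> Y"
    unfolding A_def X_def Y_def using m by (auto intro!: power_mono)
  have mp: "0 < m\<^sup>2" using m by simp
  have pos: "0 < A" "0 < X" "0 < Y" using m2 mp by linarith+
  have E0: "0 \<le> E" by (simp add: E_def)
  have "\<bar>c \<bullet> v\<bar> \<le> norm c * norm v" by (rule Cauchy_Schwarz_ineq2)
  then have "(c \<bullet> v)\<^sup>2 \<le> (norm c * norm v)\<^sup>2" by (rule abs_le_square_iff[THEN iffD1, OF order_trans]) simp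
  then have bb: "b\<^sup>2 \<le> 4 * A * E" by (simp add: b_def A_def E_def power_mult_distrib)
  have "E \<le> (B * m)\<^sup>2" unfolding E_def using B by (intro power_mono) auto
  also have "\<dots> \<le> B\<^sup>2 * A" using m2 by (simp add: power_mult_distrib mult_left_mono)
  finally have EA: "E \<le> B\<^sup>2 * A" .
  then have EE: "E * E \<le> E * (B\<^sup>2 * A)" using E0 by (rule mult_left_mono)
  have id: "1 / X + 1 / Y - 2 * (1 / A) = 2 * (b\<^sup>2 - E * (A + E)) / (A * (X * Y))"
  proof -
    have "A * (X + Y) - 2 * (X * Y) = 2 * (b\<^sup>2 - E * (A + E))"
      unfolding X Y by (simp add: algebra_simps power2_eq_square)
    moreover have "1 / X + 1 / Y - 2 * (1 / A) = (A * (X + Y) - 2 * (X * Y)) / (A * (X * Y))"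
      using pos by (simp add: field_simps)
    ultimately show ?thesis by simp
  qed
  have "0 \<le> E * (A + E)" using E0 pos by simp
  then have "\<bar>b\<^sup>2 - E * (A + E)\<bar> \<le> b\<^sup>2 + E * (A + E)" by (simp add: abs_le_iff)
  also have "\<dots> \<le> A * ((5 + B\<^sup>2) * E)" using bb EE by (simp add: algebra_simps)
  finally have num: "\<bar>b\<^sup>2 - E * (A + E)\<bar> \<le> A * ((5 + B\<^sup>2) * E)" .
  have "\<bar>1 / X + 1 / Y - 2 * (1 / A)\<bar> = 2 * \<bar>b\<^sup>2 - E * (A + E)\<bar> / (A * (X * Y))"
    unfolding id abs_divide abs_mult using pos by simp
  also have "\<dots> \<le> 2 * (A * ((5 + B\<^sup>2) * E)) / (A * (X * Y))"
    using num pos by (intro divide_right_mono) auto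
  also have "\<dots> = 2 * ((5 + B\<^sup>2) * E) / (X * Y)" using pos by simp
  also have "\<dots> \<le> 2 * ((5 + B\<^sup>2) * E) / (m\<^sup>2 * m\<^sup>2)"
    using m2 mp pos E0 by (intro divide_left_mono mult_mono mult_pos_pos) auto
  also have "m\<^sup>2 * m\<^sup>2 = m ^ 4" by (simp add: power_add[symmetric])
  finally show ?thesis unfolding X_def Y_def A_def E_def by (simp only: mult.assoc)
qed

lemma exp_neg_diff_le:
  fixes lam \<rho> \<sigma> :: real
  assumes "0 \<le> lam" "0 \<le> \<rho>" "0 \<le> \<sigma>"
  shows "\<bar>exp (- lam * \<rho>) - exp (- lam * \<sigma>)\<bar> \<le> lam * \<bar>\<rho> - \<sigma>\<bar>"
proof -
  have *: "\<bar>exp (- lam * \<rho>) - exp (- lam * \<sigma>)\<bar> \<le> lam * \<bar>\<rho> - \<sigma>\<bar>" if "\<sigma> \<le> \<rho>" "0 \<le> \<sigma>" for \<rho> \<sigma>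
  proof -
    have "exp (- lam * \<rho>) = exp (- lam * \<sigma>) * exp (- (lam * (\<rho> - \<sigma>)))" by (simp add: exp_add[symmetric] algebra_simps)
    then have "exp (- lam * \<sigma>) - exp (- lam * \<rho>) = exp (- lam * \<sigma>) * (1 - exp (- (lam * (\<rho> - \<sigma>))))"
      by (simp add: algebra_simps)
    moreover have "1 - exp (- (lam * (\<rho> - \<sigma>))) \<le> lam * (\<rho> - \<sigma>)" "0 \<le> 1 - exp (- (lam * (\<rho> - \<sigma>)))"
      using exp_ge_add_one_self[of "- (lam * (\<rho> - \<sigma>))"] assms(1) that by auto
    moreover have "exp (- lam * \<sigma>) \<le> 1" using assms(1) that by simp
    ultimately have "0 \<le> exp (- lam * \<sigma>) - exp (- lam * \<rho>)" "exp (- lam * \<sigma>) - exp (- lam * \<rho>) \<le> lam * (\<rho> - \<sigma>)"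
      using mult_left_le_one_le[of "1 - exp (- (lam * (\<rho> - \<sigma>)))" "exp (- lam * \<sigma>)"] by auto
    then show ?thesis using that by simp
  qed
  show ?thesis
    using *[of \<sigma> \<rho>] *[of \<rho> \<sigma>] assms by (cases "\<sigma> \<le> \<rho>") (auto simp: abs_minus_commute)
qed

lemma taylor_remainder_measurable:
  assumes "u \<in> borel_measurable borel"
  shows "taylor_remainder u Q x \<in> borel_measurable borel"
proof -
  have "(\<lambda>\<xi>. u (x + e * \<xi>)) \<in> borel_measurable borel" for e
  proof -
    have e: "x + e * \<xi> = signed_permutation x e (\<lambda>i. i) \<xi>" for \<xi>
      by (simp add: signed_permutation_def vec_eq_iff)
    show ?thesis unfolding e by (rule measurable_compose[OF measurable_signed_permutation assms])
  qed
  then show ?thesis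
    unfolding taylor_remainder_def[abs_def] by measurable
qed

lemma phi_2_eq:
  "phi 2 u x \<xi> = (\<Sum>i\<in>UNIV. (2 ^ CARD('n) / 2 * Q i i x) * ((\<xi> $ i)\<^sup>2 / (norm \<xi>)\<^sup>2))
     + taylor_remainder u Q x \<xi> / (norm (\<xi> :: real ^ 'n::finite))\<^sup>2"
proof (cases "\<xi> = 0")
  case False
  then have "norm \<xi> powr 2 = (norm \<xi>)\<^sup>2" by (simp add: powr_numeral)
  moreover have "(\<Sum>i\<in>UNIV. (2 ^ CARD('n) / 2 * Q i i x) * ((\<xi> $ i)\<^sup>2 / (norm \<xi>)\<^sup>2))
      = 2 ^ CARD('n) / 2 * (\<Sum>i\<in>UNIV. Q i i x * (\<xi> $ i)\<^sup>2) / (norm \<xi>)\<^sup>2"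
    by (simp add: sum_distrib_left sum_divide_distrib mult.assoc)
  ultimately show ?thesis
    unfolding phi_eq_signs taylor_remainder_def by (simp add: diff_divide_distrib)
qed (simp add: phi_eq_signs)

text \<open>Let R be the remainder divided by |\<xi>|^2, m the norm of the corner and p = 2 - d -
  \<alpha> the exponent of the weight. Then \<open>element_error_smooth\<close> produces h^2
  (m^(s-1) m^(p-1) + m^p m^(s-2)) per unit volume. Both products equal m^(s-\<alpha>-d), the case of
  \<open>sum_grid_near\<close>, so the sum is controlled by \<open>h * real N = L\<close>.\<close>

lemma sum_element_error_smooth:
  fixes u :: "real ^ 'n::finite \<Rightarrow> real"
  assumes u: "\<And>x v t. ((\<lambda>t. u (x + t *\<^sub>R v)) has_real_derivative (\<Sum>i\<in>UNIV. v $ i * P i (x + t *\<^sub>R v))) (at t)"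
    and P: "\<And>i x v t. ((\<lambda>t. P i (x + t *\<^sub>R v)) has_real_derivative (\<Sum>j\<in>UNIV. v $ j * Q i j (x + t *\<^sub>R v))) (at t)"
    and K0: "0 \<le> K" and K: "\<And>i j x y. \<bar>Q i j x - Q i j y\<bar> \<le> K * norm (x - y) powr s"
    and um: "u \<in> borel_measurable borel"
    and s: "\<alpha> < s" "s \<le> 1" and \<alpha>: "0 < \<alpha>" and lam: "0 \<le> lam"
  shows "\<exists>C>0. \<forall>x h N. 0 < h \<longrightarrow> 1 \<le> N \<longrightarrow> h * real N = L \<longrightarrow>
      (\<forall>k. set_integrable lborel (element h k) (\<lambda>\<xi>. phi 2 u x \<xi> * weight \<alpha> lam 2 \<xi>)) \<longrightarrow>
      \<bar>\<Sum>k\<in>index_cube N. element_error \<alpha> lam 2 h k (phi 2 u x)\<bar> \<le> C * h\<^sup>2"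
proof -
  let ?d = "real CARD('n)"
  define D where "D = 1 + ?d"
  have d1: "1 \<le> ?d" by simp
  have D1: "1 \<le> D" by (simp add: D_def)
  have s0: "0 < s" using s \<alpha> by simp
  define K2 where "K2 = 2 ^ CARD('n) * ?d\<^sup>2 * K"
  have K2: "0 \<le> K2" using K0 by (simp add: K2_def)
  note tr = taylor_remainder_bounds[OF u P K0 K s0, folded K2_def]
  have \<epsilon>: "0 < s - \<alpha>" "s - \<alpha> \<le> ?d" using s \<alpha> d1 by linarith+
  obtain C3 where C3: "C3 > 0" "\<And>N h. 0 < h \<Longrightarrow>
    (\<Sum>k\<in>index_cube N - {0}. norm (grid_point h k :: real ^ 'n) powr ((s - \<alpha>) - ?d) * h ^ CARD('n)) \<le> C3 * (h * real N) powr (s - \<alpha>)"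
    using sum_grid_near[OF \<epsilon>] by blast
  let ?p = "2 - (?d + \<alpha>)"
  have p1: "?p \<le> 1" using d1 \<alpha> by linarith
  define CB1 where "CB1 = K2 * ?d * (D powr (1 + s) + 2 * D powr (2 + s))"
  define CB2 where "CB2 = K2 * ?d\<^sup>2 * (2 * D powr s + 4 * D powr (1 + s) + 2 * (5 + ?d\<^sup>2) * D powr (2 + s))"
  define CW where "CW = D powr \<bar>?p\<bar>"
  \<comment> \<open>The weight is an exponential times a power. Varying the exponential leaves m^p,
    and m \<le> d L brings this to the form m^(p-1) obtained from varying the power.\<close>
  define CV where "CV = ?d * (lam * CW * (?d * \<bar>L\<bar>) + \<bar>?p\<bar>)"
  define C4 where "C4 = K2 * (cube_const CARD('n) (s + ?p) + 2 ^ CARD('n) * D powr \<bar>s\<bar> * cube_const CARD('n) ?p)"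
  define CE where "CE = CB1 * CV + CW * CB2"
  have CB1: "0 \<le> CB1" and CB2: "0 \<le> CB2" and CW: "0 \<le> CW" and CV: "0 \<le> CV"
    using K2 lam by (auto simp: CB1_def CB2_def CW_def CV_def intro!: add_nonneg_nonneg mult_nonneg_nonneg)
  then have CE: "0 \<le> CE" by (simp add: CE_def)
  have \<alpha>2: "\<alpha> < 2" using s by linarith
  have C4: "0 \<le> C4"
    using K2 s \<alpha> \<alpha>2 by (auto simp: C4_def intro!: mult_nonneg_nonneg add_nonneg_nonneg cube_const_nonneg)
  let ?C = "C4 * \<bar>L\<bar> powr (s - \<alpha>) + CE * (C3 * \<bar>L\<bar> powr (s - \<alpha>)) + 1"
  show ?thesis
  proof (intro exI[of _ ?C] conjI allI impI)
    show "0 < ?C" using C3(1) C4 CE by (intro add_nonneg_pos add_nonneg_nonneg mult_nonneg_nonneg) auto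
    fix x :: "real ^ 'n" and h :: real and N
    assume h: "0 < h" and N: "1 \<le> N" and L: "h * real N = L"
      and int: "\<forall>k. set_integrable lborel (element h k) (\<lambda>\<xi>. phi 2 u x \<xi> * weight \<alpha> lam 2 \<xi>)"
    have L0: "0 < L" using h N L by auto
    have hL: "h \<le> L" using h N mult_left_mono[of 1 "real N" h] by (simp add: L[symmetric])
    let ?E = "\<lambda>f k. element_error \<alpha> lam 2 h k f" and ?m = "\<lambda>k. norm (grid_point h k :: real ^ 'n)"
    let ?w = "weight \<alpha> lam 2 :: real ^ 'n \<Rightarrow> real"
    let ?r = "taylor_remainder u Q x"
    define R where "R \<xi> = ?r \<xi> / (norm \<xi>)\<^sup>2" for \<xi>
    have rm: "?r \<in> borel_measurable borel" by (rule taylor_remainder_measurable[OF um])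
    have Rm [measurable]: "R \<in> borel_measurable borel" unfolding R_def[abs_def] using rm by measurable
    have wint: "set_integrable lborel (element h k :: (real ^ 'n) set) (?w)" for k
      by (rule set_integrable_weight[OF \<alpha>2 lam])
    have Rle: "\<bar>R \<xi>\<bar> \<le> K2 * norm \<xi> powr s" for \<xi>
    proof (cases "\<xi> = 0")
      case False
      have "\<bar>R \<xi>\<bar> = \<bar>?r \<xi>\<bar> / norm \<xi> powr 2" using False by (simp add: R_def powr_numeral)
      also have "\<dots> \<le> K2 * norm \<xi> powr (2 + s) / norm \<xi> powr 2" by (intro divide_right_mono tr(1)) simp
      also have "\<dots> = K2 * norm \<xi> powr s" using False by (simp add: powr_add)
      finally show ?thesis .
    qed (simp add: R_def)
    let ?q = "\<lambda>i. \<lambda>\<xi>::real ^ 'n. (2 ^ CARD('n) / 2 * Q i i x) * ((\<xi> $ i)\<^sup>2 / (norm \<xi>)\<^sup>2)"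
    have phi: "phi 2 u x = (\<lambda>\<xi>. (\<Sum>i\<in>UNIV. ?q i \<xi>) + R \<xi>)"
      by (rule ext) (simp only: phi_2_eq[of u x _ Q] R_def)
    have qle: "\<bar>?q i \<xi>\<bar> \<le> \<bar>2 ^ CARD('n) / 2 * Q i i x\<bar>" for i \<xi>
    proof -
      have "\<bar>(\<xi> $ i)\<^sup>2 / (norm \<xi>)\<^sup>2\<bar> \<le> 1"
        using component_le_norm_cart[of \<xi> i] by (auto simp: divide_le_eq_1 abs_le_square_iff[symmetric])
      then show ?thesis unfolding abs_mult[of "2 ^ CARD('n) / 2 * Q i i x"] by (rule mult_left_le) simp
    qed
    have qint: "set_integrable lborel (element h k) (\<lambda>\<xi>. ?q i \<xi> * ?w \<xi>)" for i k
    proof (rule set_integrable_bound[OF set_integrable_mult_right[OF wint[of k], of "2 ^ CARD('n) / 2 * Q i i x"]])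
      show "AE \<xi> in lborel. \<xi> \<in> element h k \<longrightarrow>
          norm (?q i \<xi> * ?w \<xi>) \<le> norm (2 ^ CARD('n) / 2 * Q i i x * ?w \<xi>)"
        unfolding real_norm_def abs_mult[of _ "weight _ _ _ _"] by (intro AE_I2 impI mult_right_mono qle) simp
    qed (simp add: set_borel_measurable_def)
    have qs: "set_integrable lborel (element h k) (\<lambda>\<xi>. (\<Sum>i\<in>UNIV. ?q i \<xi>) * ?w \<xi>)
        \<and> element_error \<alpha> lam 2 h k (\<lambda>\<xi>. \<Sum>i\<in>UNIV. ?q i \<xi>) = (\<Sum>i\<in>UNIV. ?E (?q i) k)" for k
      by (rule element_error_sum[OF finite qint])
    have Rint: "set_integrable lborel (element h k) (\<lambda>\<xi>. R \<xi> * ?w \<xi>)" for k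
      using set_integral_diff(1)[OF int[rule_format, of k] conjunct1[OF qs[of k]]]
      by (simp only: phi distrib_right add_diff_cancel_left')
    have "(\<Sum>k\<in>index_cube N. ?E (phi 2 u x) k)
       = (\<Sum>k\<in>index_cube N. (\<Sum>i\<in>UNIV. ?E (?q i) k) + ?E R k)"
      unfolding phi using qs Rint by (intro sum.cong refl) (simp only: element_error_add)
    also have "\<dots> = (\<Sum>i\<in>UNIV. \<Sum>k\<in>index_cube N. ?E (?q i) k) + (\<Sum>k\<in>index_cube N. ?E R k)"
      unfolding sum.distrib by (subst sum.swap) (rule refl)
    also have "(\<Sum>i\<in>UNIV. \<Sum>k\<in>index_cube N. ?E (?q i) k) = 0"
      unfolding element_error_cmult sum_distrib_left[symmetric] sum_element_error_homogeneous[OF \<alpha>2 lam h] by simp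
    finally have phiR: "(\<Sum>k\<in>index_cube N. ?E (phi 2 u x) k) = (\<Sum>k\<in>index_cube N. ?E R k)"
      by simp
    have E0: "\<bar>?E R 0\<bar> \<le> C4 * \<bar>L\<bar> powr (s - \<alpha>) * h\<^sup>2"
    proof -
      have "\<bar>?E R 0\<bar> \<le> C4 * h powr (s + (2 - \<alpha>))"
        unfolding C4_def D_def by (rule element_error_zero_le[OF h Rle K2 \<alpha>2 _ lam]) (use s0 \<alpha>2 in simp)
      \<comment> \<open>The first element is of higher order than h^2; the surplus h^(s-\<alpha>) is
        estimated by the same power of L.\<close>
      also have "h powr (s + (2 - \<alpha>)) = h powr (s - \<alpha>) * h powr 2" by (simp add: powr_add[symmetric] algebra_simps)
      also have "h powr 2 = h\<^sup>2" using h by (simp add: powr_numeral)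
      also have "C4 * (h powr (s - \<alpha>) * h\<^sup>2) \<le> C4 * (\<bar>L\<bar> powr (s - \<alpha>) * h\<^sup>2)"
        using C4 h hL s by (intro mult_left_mono mult_right_mono powr_mono2) auto
      finally show ?thesis by (simp add: mult.assoc)
    qed
    have Ek: "\<bar>?E R k\<bar>
        \<le> CE * h\<^sup>2 * (?m k powr ((s - \<alpha>) - ?d) * h ^ CARD('n))"
      if k: "k \<in> index_cube N - {0}" for k
    proof -
      have k0: "k \<noteq> 0" using k by simp
      define m where "m = ?m k"
      have hm: "h \<le> m" unfolding m_def by (rule norm_grid_point_ge) (use h k in auto)
      have m: "0 < m" using h hm by simp
      have mL: "m \<le> ?d * L"
      proof -
        have "m \<le> (\<Sum>i\<in>UNIV. \<bar>(grid_point h k :: real ^ 'n) $ i\<bar>)" unfolding m_def by (rule norm_le_l1_cart)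
        also have "\<dots> \<le> (\<Sum>i\<in>(UNIV :: 'n set). L)"
        proof (rule sum_mono)
          fix i
          have "real (k $ i) \<le> real N" using k by (simp add: index_cube_def less_imp_le)
          then show "\<bar>(grid_point h k :: real ^ 'n) $ i\<bar> \<le> L" unfolding L[symmetric] using h by simp
        qed
        finally show ?thesis by simp
      qed
      define c :: "real ^ 'n" where "c = (\<chi> i. (real (k $ i) + 1 / 2) * h)"
      have c: "c \<in> element h k" unfolding c_def mem_element using h by (auto intro!: mult_right_mono)
      have refl_mem: "2 *\<^sub>R c - \<xi> \<in> element h k" if "\<xi> \<in> element h k" for \<xi>
        using that by (auto simp: c_def mem_element algebra_simps)
      have lo: "m \<le> norm \<xi>" if "\<xi> \<in> element h k" for \<xi> :: "real ^ 'n"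
        unfolding m_def by (rule norm_element_ge) (use h that in auto)
      have hi: "norm \<xi> \<le> D * m" if "\<xi> \<in> element h k" for \<xi> :: "real ^ 'n"
        unfolding m_def D_def by (rule norm_element_le) (use h k that in auto)
      have dist: "norm (\<xi> - \<eta>) \<le> ?d * h" if "\<xi> \<in> element h k" "\<eta> \<in> element h k" for \<xi> \<eta> :: "real ^ 'n"
        by (rule norm_diff_element[OF that])
      \<comment> \<open>R is handled as the product of the Taylor remainder and |\<xi>|^-2. The
        facts \<open>r0\<close> to \<open>r2\<close> and \<open>q1\<close> to \<open>q3\<close>
        bound the size, the first and the second differences of the two factors.\<close>
      define q where "q \<xi> = 1 / (norm \<xi>)\<^sup>2" for \<xi> :: "real ^ 'n"
      have R: "R \<xi> = ?r \<xi> * q \<xi>" for \<xi> by (simp add: R_def q_def)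
      have qpowr: "q \<xi> = norm \<xi> powr (- 2)" if "\<xi> \<in> element h k" for \<xi>
        using lo[OF that] m by (simp add: q_def powr_minus powr_numeral divide_inverse)
      have q0: "0 \<le> q \<xi>" for \<xi> by (simp add: q_def)
      have q1: "q \<xi> \<le> m powr (- 2)" if "\<xi> \<in> element h k" for \<xi>
        unfolding qpowr[OF that] using lo[OF that] m by (intro powr_mono2') auto
      have q2: "\<bar>q \<xi> - q \<eta>\<bar> \<le> 2 * m powr (- 3) * (?d * h)" if \<xi>: "\<xi> \<in> element h k" and \<eta>: "\<eta> \<in> element h k" for \<xi> \<eta>
      proof -
        have "\<bar>norm \<xi> powr (- 2) - norm \<eta> powr (- 2)\<bar> \<le> \<bar>- 2\<bar> * m powr (- 2 - 1) * \<bar>norm \<xi> - norm \<eta>\<bar>"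
          by (rule powr_diff_le) (use m lo[OF \<xi>] lo[OF \<eta>] in auto)
        also have "\<dots> \<le> 2 * m powr (- 3) * (?d * h)"
          using order_trans[OF norm_triangle_ineq3 dist[OF \<xi> \<eta>]] by (intro mult_mono) auto
        finally show ?thesis by (simp add: qpowr \<xi> \<eta>)
      qed
      have q3: "\<bar>q \<xi> + q (2 *\<^sub>R c - \<xi>) - 2 * q c\<bar> \<le> 2 * (5 + ?d\<^sup>2) * (?d * h)\<^sup>2 * m powr (- 4)" if \<xi>: "\<xi> \<in> element h k" for \<xi>
      proof -
        have "norm (\<xi> - c) \<le> ?d * m" using dist[OF \<xi> c] hm mult_left_mono[OF hm, of ?d] by linarith
        then have "\<bar>q (c + (\<xi> - c)) + q (c - (\<xi> - c)) - 2 * q c\<bar> \<le> 2 * (5 + ?d\<^sup>2) * (norm (\<xi> - c))\<^sup>2 / m ^ 4"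
          unfolding q_def using lo[OF \<xi>] lo[OF c] lo[OF refl_mem[OF \<xi>]] m
          by (intro second_difference_inverse_square) (auto simp: scaleR_2 algebra_simps)
        also have "\<dots> \<le> 2 * (5 + ?d\<^sup>2) * (?d * h)\<^sup>2 / m ^ 4"
          using dist[OF \<xi> c] by (intro divide_right_mono mult_left_mono power_mono) (auto simp: add_nonneg_nonneg)
        finally show ?thesis using m by (simp add: scaleR_2 algebra_simps powr_minus powr_numeral divide_inverse)
      qed
      have r0: "\<bar>?r \<xi>\<bar> \<le> K2 * (D * m) powr (2 + s)" if \<xi>: "\<xi> \<in> element h k" for \<xi>
        using hi[OF \<xi>] K2 s0 by (intro order_trans[OF tr(1)] mult_left_mono powr_mono2) auto
      have r1: "\<bar>?r \<xi> - ?r \<eta>\<bar> \<le> K2 * (D * m) powr (1 + s) * (?d * h)" if \<xi>: "\<xi> \<in> element h k" and \<eta>: "\<eta> \<in> element h k" for \<xi> \<eta>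
        using dist[OF \<xi> \<eta>] K2 by (intro order_trans[OF tr(2)[OF hi[OF \<xi>] hi[OF \<eta>]]] mult_left_mono) auto
      have r2: "\<bar>?r \<xi> + ?r (2 *\<^sub>R c - \<xi>) - 2 * ?r c\<bar> \<le> 2 * K2 * (D * m) powr s * (?d * h)\<^sup>2" if \<xi>: "\<xi> \<in> element h k" for \<xi>
      proof -
        have "\<bar>?r (c + (\<xi> - c)) + ?r (c - (\<xi> - c)) - 2 * ?r c\<bar> \<le> 2 * K2 * (D * m) powr s * (norm (\<xi> - c))\<^sup>2"
          by (rule tr(3)) (use hi[OF \<xi>] hi[OF refl_mem[OF \<xi>]] in \<open>auto simp: scaleR_2 algebra_simps\<close>)
        also have "\<dots> \<le> 2 * K2 * (D * m) powr s * (?d * h)\<^sup>2"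
          using dist[OF \<xi> c] K2 by (intro mult_left_mono power_mono) auto
        finally show ?thesis by (simp add: scaleR_2 algebra_simps)
      qed
      have Dm: "(D * m) powr a * m powr b = D powr a * m powr (a + b)" for a b
        using D1 m by (simp add: powr_mult powr_add)
      have B1: "\<bar>R \<xi> - R \<eta>\<bar> \<le> CB1 * h * m powr (s - 1)" if \<xi>: "\<xi> \<in> element h k" and \<eta>: "\<eta> \<in> element h k" for \<xi> \<eta>
      proof -
        have "R \<xi> - R \<eta> = (?r \<xi> - ?r \<eta>) * q \<xi> + ?r \<eta> * (q \<xi> - q \<eta>)" by (simp add: R algebra_simps)
        also have "\<bar>\<dots>\<bar> \<le> \<bar>?r \<xi> - ?r \<eta>\<bar> * \<bar>q \<xi>\<bar> + \<bar>?r \<eta>\<bar> * \<bar>q \<xi> - q \<eta>\<bar>"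
          by (rule order_trans[OF abs_triangle_ineq]) (simp add: abs_mult)
        also have "\<dots> \<le> (K2 * (D * m) powr (1 + s) * (?d * h)) * m powr (- 2) + (K2 * (D * m) powr (2 + s)) * (2 * m powr (- 3) * (?d * h))"
          using r1[OF \<xi> \<eta>] q1[OF \<xi>] q0[of \<xi>] r0[OF \<eta>] q2[OF \<xi> \<eta>] K2 h
          by (intro add_mono mult_mono) auto
        also have "\<dots> = K2 * ?d * h * ((D * m) powr (1 + s) * m powr (- 2)) + K2 * ?d * 2 * h * ((D * m) powr (2 + s) * m powr (- 3))"
          by (simp only: mult_ac)
        also have "\<dots> = CB1 * h * m powr (s - 1)"
          unfolding Dm by (simp add: CB1_def algebra_simps)
        finally show ?thesis .
      qed
      have B2: "\<bar>R \<xi> + R (2 *\<^sub>R c - \<xi>) - 2 * R c\<bar> \<le> CB2 * h\<^sup>2 * m powr (s - 2)" if \<xi>: "\<xi> \<in> element h k" for \<xi>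
      proof -
        define \<eta> where "\<eta> = 2 *\<^sub>R c - \<xi>"
        have \<eta>: "\<eta> \<in> element h k" unfolding \<eta>_def by (rule refl_mem[OF \<xi>])
        \<comment> \<open>The Leibniz rule for the second difference about \<open>c\<close> of the
          product of \<open>?r\<close> and \<open>q\<close>.\<close>
        have id: "R \<xi> + R \<eta> - 2 * R c = (?r \<xi> + ?r \<eta> - 2 * ?r c) * q c + (?r \<xi> - ?r c) * (q \<xi> - q c)
           + (?r \<eta> - ?r c) * (q \<eta> - q c) + ?r c * (q \<xi> + q \<eta> - 2 * q c)"
          by (simp add: R algebra_simps)
        have "\<bar>R \<xi> + R \<eta> - 2 * R c\<bar> \<le> \<bar>?r \<xi> + ?r \<eta> - 2 * ?r c\<bar> * \<bar>q c\<bar> + \<bar>?r \<xi> - ?r c\<bar> * \<bar>q \<xi> - q c\<bar>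
           + \<bar>?r \<eta> - ?r c\<bar> * \<bar>q \<eta> - q c\<bar> + \<bar>?r c\<bar> * \<bar>q \<xi> + q \<eta> - 2 * q c\<bar>"
        proof -
          have "\<bar>a + b + c + d\<bar> \<le> \<bar>a\<bar> + \<bar>b\<bar> + \<bar>c\<bar> + \<bar>d\<bar>" for a b c d :: real by linarith
          then show ?thesis unfolding id abs_mult[symmetric] .
        qed
        also have "\<dots> \<le> (2 * K2 * (D * m) powr s * (?d * h)\<^sup>2) * m powr (- 2)
           + (K2 * (D * m) powr (1 + s) * (?d * h)) * (2 * m powr (- 3) * (?d * h))
           + (K2 * (D * m) powr (1 + s) * (?d * h)) * (2 * m powr (- 3) * (?d * h))
           + (K2 * (D * m) powr (2 + s)) * (2 * (5 + ?d\<^sup>2) * (?d * h)\<^sup>2 * m powr (- 4))"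
          using r2[OF \<xi>] q1[OF c] q0[of c] r1[OF \<xi> c] q2[OF \<xi> c] r1[OF \<eta> c] q2[OF \<eta> c] r0[OF c] q3[OF \<xi>] K2 h
          unfolding \<eta>_def[symmetric]
          by (intro add_mono mult_mono) auto
        also have "\<dots> = K2 * (?d * h)\<^sup>2 * 2 * ((D * m) powr s * m powr (- 2))
           + K2 * (?d * h)\<^sup>2 * 4 * ((D * m) powr (1 + s) * m powr (- 3))
           + K2 * (?d * h)\<^sup>2 * (2 * (5 + ?d\<^sup>2)) * ((D * m) powr (2 + s) * m powr (- 4))"
          by (simp only: power2_eq_square[of "?d * h"]) algebra
        also have "\<dots> = CB2 * h\<^sup>2 * m powr (s - 2)"
          unfolding Dm by (simp add: CB2_def power_mult_distrib algebra_simps)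
        finally show ?thesis unfolding \<eta>_def .
      qed
      have Wc: "norm \<xi> powr ?p \<le> CW * m powr ?p" if \<xi>: "\<xi> \<in> element h k" for \<xi> :: "real ^ 'n"
        unfolding CW_def by (rule powr_comparable) (use m lo[OF \<xi>] hi[OF \<xi>] D1 in auto)
      have W: "?w c \<le> CW * m powr ?p"
        by (rule order_trans[OF weight_le_powr[OF lam] Wc[OF c]])
      have V: "\<bar>?w \<xi> - ?w c\<bar> \<le> CV * h * m powr (?p - 1)" if \<xi>: "\<xi> \<in> element h k" for \<xi>
      proof -
        have nd: "\<bar>norm \<xi> - norm c\<bar> \<le> ?d * h" by (rule order_trans[OF norm_triangle_ineq3 dist[OF \<xi> c]])
        have "?w \<xi> - ?w c = (exp (- lam * norm \<xi>) - exp (- lam * norm c)) * norm \<xi> powr ?p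
            + exp (- lam * norm c) * (norm \<xi> powr ?p - norm c powr ?p)"
          by (simp add: weight_def algebra_simps)
        also have "\<bar>\<dots>\<bar> \<le> \<bar>exp (- lam * norm \<xi>) - exp (- lam * norm c)\<bar> * \<bar>norm \<xi> powr ?p\<bar>
            + \<bar>exp (- lam * norm c)\<bar> * \<bar>norm \<xi> powr ?p - norm c powr ?p\<bar>"
          by (rule order_trans[OF abs_triangle_ineq]) (simp only: abs_mult order_refl)
        also have "\<dots> \<le> (lam * (?d * h)) * (CW * m powr ?p) + 1 * (\<bar>?p\<bar> * m powr (?p - 1) * (?d * h))"
        proof (intro add_mono mult_mono)
          show "\<bar>exp (- lam * norm \<xi>) - exp (- lam * norm c)\<bar> \<le> lam * (?d * h)"
            using exp_neg_diff_le[OF lam, of "norm \<xi>" "norm c"] mult_left_mono[OF nd lam] by simp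
          show "\<bar>norm \<xi> powr ?p\<bar> \<le> CW * m powr ?p" using Wc[OF \<xi>] by simp
          have "\<bar>norm \<xi> powr ?p - norm c powr ?p\<bar> \<le> \<bar>?p\<bar> * m powr (?p - 1) * \<bar>norm \<xi> - norm c\<bar>"
            by (rule powr_diff_le[OF m lo[OF \<xi>] lo[OF c] p1])
          also have "\<dots> \<le> \<bar>?p\<bar> * m powr (?p - 1) * (?d * h)" using nd by (intro mult_left_mono) auto
          finally show "\<bar>norm \<xi> powr ?p - norm c powr ?p\<bar> \<le> \<bar>?p\<bar> * m powr (?p - 1) * (?d * h)" .
        qed (use lam h in auto)
        also have "m powr ?p = m * m powr (?p - 1)"
        proof -
          have "m powr (1 + (?p - 1)) = m powr 1 * m powr (?p - 1)" by (rule powr_add)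
          moreover have "1 + (?p - 1) = ?p" by simp
          ultimately show ?thesis using m by (simp only: powr_one less_imp_le)
        qed
        also have "(lam * (?d * h)) * (CW * (m * m powr (?p - 1))) + 1 * (\<bar>?p\<bar> * m powr (?p - 1) * (?d * h))
            = ?d * (lam * CW * m + \<bar>?p\<bar>) * h * m powr (?p - 1)"
          by (simp add: algebra_simps)
        also have "\<dots> \<le> CV * h * m powr (?p - 1)"
          unfolding CV_def using mL L0 h lam CW
          by (intro mult_right_mono mult_left_mono add_right_mono) auto
        finally show ?thesis .
      qed
      have "\<bar>?E R k\<bar> \<le>
          ((CB1 * h * m powr (s - 1)) * (CV * h * m powr (?p - 1)) + (CW * m powr ?p) * (CB2 * h\<^sup>2 * m powr (s - 2))) * h ^ CARD('n)"
        by (rule element_error_smooth[OF less_imp_le[OF h] k0 Rm wint, folded c_def])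
          (use B1 B2 V W in \<open>auto simp: c_def\<close>)
      also have "\<dots> = (CB1 * CV * (m powr (s - 1) * m powr (?p - 1)) + CW * CB2 * (m powr ?p * m powr (s - 2))) * h\<^sup>2 * h ^ CARD('n)"
        by (simp add: power2_eq_square algebra_simps)
      also have "m powr (s - 1) * m powr (?p - 1) = m powr ((s - \<alpha>) - ?d)"
        by (simp add: powr_add[symmetric] algebra_simps)
      also have "m powr ?p * m powr (s - 2) = m powr ((s - \<alpha>) - ?d)"
        by (simp add: powr_add[symmetric] algebra_simps)
      finally show ?thesis by (simp add: CE_def m_def algebra_simps)
    qed
    have "\<bar>\<Sum>k\<in>index_cube N. ?E R k\<bar> \<le> C4 * \<bar>L\<bar> powr (s - \<alpha>) * h\<^sup>2 + CE * h\<^sup>2 * (C3 * (h * real N) powr (s - \<alpha>))"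
      by (rule abs_sum_index_cube_le[OF E0 Ek _ C3(2)[OF h]]) (use CE in auto)
    also have "\<dots> \<le> ?C * h\<^sup>2" using L0 by (simp add: L algebra_simps)
    finally show "\<bar>\<Sum>k\<in>index_cube N. ?E (phi 2 u x) k\<bar> \<le> ?C * h\<^sup>2"
      unfolding phiR .
  qed
qed

section \<open>From element errors to the supremum norm\<close>

lemma sup_norm_on_le:
  assumes "\<And>x. x \<in> S \<Longrightarrow> \<bar>f x\<bar> \<le> c"
  shows "sup_norm_on S f \<le> ereal c"
  unfolding sup_norm_on_def by (rule SUP_least) (use assms in simp)

text \<open>The part common to both rates, with \<open>e h\<close> standing for h^\<epsilon> or h^2.
  Adding 1 to the constant keeps it positive without a lower bound on
  \<open>frac_const\<close>.\<close>

lemma sup_norm_fd_error_le: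
  fixes a b :: "real ^ 'n::finite" and u :: "real ^ 'n \<Rightarrow> real"
  assumes ab: "\<And>i. a $ i < b $ i" and zero: "\<And>x. x \<notin> box a b \<Longrightarrow> u x = 0"
    and H: "\<And>x y. \<bar>u x - u y\<bar> \<le> H * norm (x - y) powr s" and s: "\<alpha> < s" "s \<le> 1" and \<alpha>: "0 < \<alpha>" and lam: "0 \<le> lam"
    and C: "0 < C" and e: "\<And>h. 0 \<le> e h"
    and le: "\<And>x h N. 0 < h \<Longrightarrow> 1 \<le> N \<Longrightarrow> h * real N = max_side a b \<Longrightarrow>
      (\<And>k. set_integrable lborel (element h k) (\<lambda>\<xi>. phi \<gamma> u x \<xi> * weight \<alpha> lam \<gamma> \<xi>)) \<Longrightarrow>
      \<bar>\<Sum>k\<in>index_cube N. element_error \<alpha> lam \<gamma> h k (phi \<gamma> u x)\<bar> \<le> C * e h"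
  shows "\<exists>C>0. \<forall>N\<ge>1. sup_norm_on (box a b) (fd_error a b \<alpha> lam \<gamma> N u) \<le> ereal (C * e (mesh_size a b N))"
proof -
  let ?c = "frac_const CARD('n) \<alpha> lam"
  show ?thesis
  proof (intro exI[of _ "\<bar>?c\<bar> * C + 1"] conjI allI impI sup_norm_on_le)
    show "0 < \<bar>?c\<bar> * C + 1" using C by (simp add: add_nonneg_pos)
    fix N :: nat and x assume N: "1 \<le> N" and x: "x \<in> box a b"
    let ?h = "mesh_size a b N"
    have h: "0 < ?h" "?h * real N = max_side a b"
      using max_side_pos[OF ab] N by (auto simp: mesh_size_def)
    have int: "set_integrable lborel (element ?h k) (\<lambda>\<xi>. phi \<gamma> u x \<xi> * weight \<alpha> lam \<gamma> \<xi>)" for k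
      by (rule fd_error_eq_sum_element_error(1)[OF ab zero H s \<alpha> lam x N])
    have repr: "fd_error a b \<alpha> lam \<gamma> N u x = - ?c * (\<Sum>k\<in>index_cube N. element_error \<alpha> lam \<gamma> ?h k (phi \<gamma> u x))"
      by (rule fd_error_eq_sum_element_error(2)[OF ab zero H s \<alpha> lam x N])
    have "\<bar>fd_error a b \<alpha> lam \<gamma> N u x\<bar> \<le> \<bar>?c\<bar> * (C * e ?h)"
      unfolding repr abs_mult abs_minus_cancel by (intro mult_left_mono le h N int) simp
    also have "\<dots> \<le> (\<bar>?c\<bar> * C + 1) * e ?h" using e[of ?h] by (simp add: algebra_simps)
    finally show "\<bar>fd_error a b \<alpha> lam \<gamma> N u x\<bar> \<le> (\<bar>?c\<bar> * C + 1) * e ?h" .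
  qed
qed

lemma fd_error_le_holder:
  fixes a b :: "real ^ 'n::finite" and u :: "real ^ 'n \<Rightarrow> real"
  assumes "0 < \<alpha>" "0 \<le> lam" and ab: "\<And>i. a $ i < b $ i" and zero: "\<And>x. x \<notin> box a b \<Longrightarrow> u x = 0"
    and \<epsilon>: "0 < \<epsilon>" "\<epsilon> \<le> 1 - \<alpha>" and u: "u \<in> holder_space 0 (\<alpha> + \<epsilon>) (closure (box a b))" and \<gamma>: "\<alpha> < \<gamma>"
  shows "\<exists>C>0. \<forall>N\<ge>1. sup_norm_on (box a b) (fd_error a b \<alpha> lam \<gamma> N u) \<le> ereal (C * mesh_size a b N powr \<epsilon>)"
proof -
  from u obtain H where "\<forall>x\<in>closure (box a b). \<forall>y\<in>closure (box a b). \<bar>u x - u y\<bar> \<le> H * norm (x - y) powr (\<alpha> + \<epsilon>)"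
    unfolding holder_space_def by auto
  then have H: "\<bar>u x - u y\<bar> \<le> \<bar>H\<bar> * norm (x - y) powr (\<alpha> + \<epsilon>)" for x y
    using assms by (intro holder_extend_zero[OF ab zero]) auto
  have s: "\<alpha> < \<alpha> + \<epsilon>" "\<alpha> + \<epsilon> \<le> 1" using \<epsilon> by auto
  obtain C where C: "C > 0" "\<And>x h N. 0 < h \<Longrightarrow>
      (\<And>k. set_integrable lborel (element h k) (\<lambda>\<xi>. phi \<gamma> u x \<xi> * weight \<alpha> lam \<gamma> \<xi>)) \<Longrightarrow>
      \<bar>\<Sum>k\<in>index_cube N. element_error \<alpha> lam \<gamma> h k (phi \<gamma> u x)\<bar> \<le> C * h powr \<epsilon>"
    using sum_element_error_holder[OF H abs_ge_zero s assms(1,2) \<gamma>] unfolding add_diff_cancel_left' by blast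
  show ?thesis
    by (rule sup_norm_fd_error_le[OF ab zero H s assms(1,2) C(1)]) (auto intro: C(2))
qed

lemma fd_error_le_smooth:
  fixes a b :: "real ^ 'n::finite" and u :: "real ^ 'n \<Rightarrow> real"
  assumes "0 < \<alpha>" "\<alpha> < 1" "0 \<le> lam" and ab: "\<And>i. a $ i < b $ i" and zero: "\<And>x. x \<notin> box a b \<Longrightarrow> u x = 0"
    and \<epsilon>: "0 < \<epsilon>" "\<epsilon> \<le> 1 - \<alpha>" and u: "u \<in> holder_space 2 (\<alpha> + \<epsilon>) (closure (box a b))"
  shows "\<exists>C>0. \<forall>N\<ge>1. sup_norm_on (box a b) (fd_error a b \<alpha> lam 2 N u) \<le> ereal (C * (mesh_size a b N)\<^sup>2)"
proof -
  have s: "\<alpha> < \<alpha> + \<epsilon>" "\<alpha> + \<epsilon> \<le> 1" "0 < \<alpha> + \<epsilon>" using \<epsilon> assms(1) by auto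
  obtain P Q K B where u': "\<And>x v t. ((\<lambda>t. u (x + t *\<^sub>R v)) has_real_derivative (\<Sum>i\<in>UNIV. v $ i * P i (x + t *\<^sub>R v))) (at t)"
    and P': "\<And>i x v t. ((\<lambda>t. P i (x + t *\<^sub>R v)) has_real_derivative (\<Sum>j\<in>UNIV. v $ j * Q i j (x + t *\<^sub>R v))) (at t)"
    and K: "0 \<le> K" "\<And>i j x y. \<bar>Q i j x - Q i j y\<bar> \<le> K * norm (x - y) powr (\<alpha> + \<epsilon>)"
    and B: "\<And>x y. \<bar>u x - u y\<bar> \<le> B * norm (x - y)"
    by (rule holder_space_2_dest[OF u ab zero s(3)]) (assumption, rule that)
  \<comment> \<open>The error is represented with exponent 1, as \<open>u\<close> is Lipschitz;
    \<open>\<alpha> + \<epsilon>\<close> measures its second derivatives.\<close>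
  have H: "\<bar>u x - u y\<bar> \<le> B * norm (x - y) powr 1" for x y using B by simp
  have um: "u \<in> borel_measurable borel"
    by (rule borel_measurable_continuous_onI[OF continuous_on_of_holder[OF H]]) simp
  obtain C where C: "C > 0" "\<And>x h N. 0 < h \<Longrightarrow> 1 \<le> N \<Longrightarrow> h * real N = max_side a b \<Longrightarrow>
      (\<And>k. set_integrable lborel (element h k) (\<lambda>\<xi>. phi 2 u x \<xi> * weight \<alpha> lam 2 \<xi>)) \<Longrightarrow>
      \<bar>\<Sum>k\<in>index_cube N. element_error \<alpha> lam 2 h k (phi 2 u x)\<bar> \<le> C * h\<^sup>2"
    using sum_element_error_smooth[OF u' P' K um s(1,2) assms(1,3), of "max_side a b"] by blast
  show ?thesis
    by (rule sup_norm_fd_error_le[OF ab zero H assms(2) order_refl assms(1,3) C(1)]) (auto intro: C(2))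
qed

theorem theorem3p1:
  fixes a b :: "real ^ 'n::finite"
    and u :: "real ^ 'n \<Rightarrow> real"
    and \<alpha> lam \<gamma> \<epsilon> :: real
  assumes "CARD('n) \<in> {1, 2, 3}"
    and "0 < \<alpha>" and "\<alpha> < 1"
    and "0 \<le> lam"
    and "\<And>i. a $ i < b $ i"
    and "\<And>x. x \<notin> box a b \<Longrightarrow> u x = 0"
    and "0 < \<epsilon>" and "\<epsilon> \<le> 1 - \<alpha>"
  shows "\<exists>C>0.
      (u \<in> holder_space 0 (\<alpha> + \<epsilon>) (closure (box a b)) \<and> \<alpha> < \<gamma> \<and> \<gamma> \<le> 2 \<longrightarrow>
        (\<forall>N\<ge>1. sup_norm_on (box a b) (fd_error a b \<alpha> lam \<gamma> N u)
                 \<le> ereal (C * mesh_size a b N powr \<epsilon>))) \<and>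
      (u \<in> holder_space 2 (\<alpha> + \<epsilon>) (closure (box a b)) \<and> \<gamma> = 2 \<longrightarrow>
        (\<forall>N\<ge>1. sup_norm_on (box a b) (fd_error a b \<alpha> lam \<gamma> N u)
                 \<le> ereal (C * (mesh_size a b N)\<^sup>2)))"
proof -
  \<comment> \<open>A single constant has to serve both implications. Each one is obtained under its
    own hypotheses, with 1 as a placeholder where these fail, and the maximum is taken at the
    end.\<close>
  obtain C1 where C1: "C1 > 0" "u \<in> holder_space 0 (\<alpha> + \<epsilon>) (closure (box a b)) \<Longrightarrow> \<alpha> < \<gamma> \<Longrightarrow>
      \<forall>N\<ge>1. sup_norm_on (box a b) (fd_error a b \<alpha> lam \<gamma> N u) \<le> ereal (C1 * mesh_size a b N powr \<epsilon>)"
  proof (cases "u \<in> holder_space 0 (\<alpha> + \<epsilon>) (closure (box a b)) \<and> \<alpha> < \<gamma>")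
    case True
    from fd_error_le_holder[OF assms(2,4-8) conjunct1[OF this] conjunct2[OF this]] that show ?thesis by blast
  qed (use that[of 1] in auto)
  obtain C2 where C2: "C2 > 0" "u \<in> holder_space 2 (\<alpha> + \<epsilon>) (closure (box a b)) \<Longrightarrow>
      \<forall>N\<ge>1. sup_norm_on (box a b) (fd_error a b \<alpha> lam 2 N u) \<le> ereal (C2 * (mesh_size a b N)\<^sup>2)"
  proof (cases "u \<in> holder_space 2 (\<alpha> + \<epsilon>) (closure (box a b))")
    case True
    from fd_error_le_smooth[OF assms(2-8) this] that show ?thesis by blast
  qed (use that[of 1] in auto)
  show ?thesis
  proof (intro exI[of _ "max C1 C2"] conjI allI impI)
    show "0 < max C1 C2" using C1(1) by simp
  next
    fix N :: nat
    assume "u \<in> holder_space 0 (\<alpha> + \<epsilon>) (closure (box a b)) \<and> \<alpha> < \<gamma> \<and> \<gamma> \<le> 2" "1 \<le> N"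
    then have "sup_norm_on (box a b) (fd_error a b \<alpha> lam \<gamma> N u) \<le> ereal (C1 * mesh_size a b N powr \<epsilon>)"
      using C1(2) by blast
    also have "\<dots> \<le> ereal (max C1 C2 * mesh_size a b N powr \<epsilon>)"
      by (simp add: mult_right_mono)
    finally show "sup_norm_on (box a b) (fd_error a b \<alpha> lam \<gamma> N u) \<le> ereal (max C1 C2 * mesh_size a b N powr \<epsilon>)" .
  next
    fix N :: nat
    assume "u \<in> holder_space 2 (\<alpha> + \<epsilon>) (closure (box a b)) \<and> \<gamma> = 2" "1 \<le> N"
    then have "sup_norm_on (box a b) (fd_error a b \<alpha> lam \<gamma> N u) \<le> ereal (C2 * (mesh_size a b N)\<^sup>2)"
      using C2(2) by blast
    also have "\<dots> \<le> ereal (max C1 C2 * (mesh_size a b N)\<^sup>2)"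
      by (simp add: mult_right_mono)
    finally show "sup_norm_on (box a b) (fd_error a b \<alpha> lam \<gamma> N u) \<le> ereal (max C1 C2 * (mesh_size a b N)\<^sup>2)" .
  qed
qed

end
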